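(* Let $N$ nodes be placed independently and uniformly at random in each of two horizontally aligned squares $C_T$ and $C_R$ of side length $D$ whose centers are at distance $L\ge 2D$. Consider the $N\times N$ cooperative MIMO channel $Y=HX+W+Z$ from $C_T$ to $C_R$ described in the context, with external interference covariance matrix $\Sigma$, and let $$\rho_1=\frac{L^2}{NGP}\operatorname{tr}(\Sigma),\qquad \rho_2=\frac{L^4}{N(GP)^2}\operatorname{tr}(\Sigma^2),$$ $$M=\max\left\{1,\ \frac{D^2}{\lambda L}\left(1+\left(\log\frac{D^2}{\lambda L}\right)^+\right)^{-1}\right\}.$$ Then there exist positive constants $K_1'$ and $K_2'$, independent of $D$, $L$, $N$, and $\lambda$, such that the capacity $C(H)$ of this channel satisfies $$C(H)\ \geq\ N\,\frac{\delta^2(\rho_1+K_1'N)^2}{\left(\rho_2^{1/2}+\left(K_2'\max\{N^2,N^3M^{-1}\}\right)^{1/2}\right)^2}\ \log\left(1+\frac{\frac{GP}{L^2}\left((1-\delta)K_1'N-\delta\rho_1\right)}{1+\frac{GP}{L^2}\rho_1}\right)$$ for any $0\le\delta\le 1$, with high probability as $N$ tends to infinity.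
   Context: The $N$ transmitting nodes lie in $C_T$ and the $N$ receiving nodes lie in $C_R$. The matrix $H\in\mathbb{C}^{N\times N}$ has entries $$H_{ik}=\frac{\sqrt{G}}{d_{ik}}\exp\left(-j\frac{2\pi}{\lambda}d_{ik}\right),\qquad j=\sqrt{-1},$$ where $d_{ik}$ is the distance between the $k$-th node of $C_T$ and the $i$-th node of $C_R$, $\lambda>0$ is the wavelength, and $G>0$ is a power gain. $X\in\mathbb{C}^N$ is the vector transmitted by $C_T$, $W\in\mathbb{C}^N$ is an external interference vector with covariance matrix $\Sigma$, and $Z\sim\mathcal{CN}(0,I)$ is circularly symmetric complex Gaussian noise; $X$, $W$, $Z$ are mutually independent. $H$ is known at the receiver only. The capacity is $C(H)=\max I(X;Y)$ (for the given realization of $H$), the maximum being over input distributions with $\operatorname{E}[|X_i|^2]\le P$ for every $i$. $\log$ is base 2 and $(x)^+=\max\{x,0\}$. "With high probability" means with probability (over the random node locations) approaching 1 as $N\to\infty$. *)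

theory Defs
  imports "HOL-Probability.Probability"
begin

text \<open>
  Vectors in \<open>\<complex>\<^sup>N\<close> are functions on \<open>{..<N}\<close>, and \<open>N \<times> N\<close> matrices are functions of two
  indices of which only the values at indices below \<open>N\<close> matter. The dimension cannot be a type
  here because it tends to infinity in the theorem.
\<close>

abbreviation cvec :: "nat \<Rightarrow> (nat \<Rightarrow> complex) measure" where
  "cvec N \<equiv> Pi\<^sub>M {..<N} (\<lambda>_. borel)"

definition mat_trace :: "nat \<Rightarrow> (nat \<Rightarrow> nat \<Rightarrow> complex) \<Rightarrow> complex" where
  "mat_trace N A = (\<Sum>i<N. A i i)"

definition mat_prod ::
  "nat \<Rightarrow> (nat \<Rightarrow> nat \<Rightarrow> complex) \<Rightarrow> (nat \<Rightarrow> nat \<Rightarrow> complex) \<Rightarrow> nat \<Rightarrow> nat \<Rightarrow> complex" where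
  "mat_prod N A B i k = (\<Sum>l<N. A i l * B l k)"

definition square :: "real \<times> real \<Rightarrow> real \<Rightarrow> (real \<times> real) set" where
  "square c D = cbox (c - (D / 2, D / 2)) (c + (D / 2, D / 2))"

text \<open>
  The first component holds the positions of the transmitting nodes, the second those of the
  receiving nodes. Only mutual distances enter the channel, so the squares are put in coordinates
  in which the first is centred at the origin and the second on the horizontal axis.
\<close>

definition placement ::
  "real \<Rightarrow> real \<Rightarrow> nat \<Rightarrow> ((nat \<Rightarrow> real \<times> real) \<times> (nat \<Rightarrow> real \<times> real)) measure" where
  "placement D L N =
     Pi\<^sub>M {..<N} (\<lambda>_. uniform_measure lborel (square (0, 0) D)) \<Otimes>\<^sub>M
     Pi\<^sub>M {..<N} (\<lambda>_. uniform_measure lborel (square (L, 0) D))"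

definition channel_matrix ::
  "real \<Rightarrow> real \<Rightarrow> (nat \<Rightarrow> real \<times> real) \<Rightarrow> (nat \<Rightarrow> real \<times> real) \<Rightarrow> nat \<Rightarrow> nat \<Rightarrow> complex" where
  "channel_matrix G lam t r i k =
     (let d = dist (r i) (t k)
      in of_real (sqrt G / d) * exp (- \<i> * of_real (2 * pi / lam * d)))"

text \<open>
  The law of a vector with independent standard circularly symmetric complex Gaussian entries:
  each entry has unit variance, that is, variance 1/2 per real dimension.
\<close>

definition complex_gaussian :: "nat \<Rightarrow> (nat \<Rightarrow> complex) measure" where
  "complex_gaussian N =
     Pi\<^sub>M {..<N} (\<lambda>_. density lborel (\<lambda>z. ennreal (exp (- (cmod z)\<^sup>2) / pi)))"

text \<open>
  \<open>nu\<close> is the law of a square-integrable random vector with covariance matrix \<open>S\<close>; the vector is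
  not assumed to be centred, Gaussian or circularly symmetric.
\<close>

definition has_covariance ::
  "nat \<Rightarrow> (nat \<Rightarrow> complex) measure \<Rightarrow> (nat \<Rightarrow> nat \<Rightarrow> complex) \<Rightarrow> bool" where
  "has_covariance N nu S \<longleftrightarrow>
     prob_space nu \<and> sets nu = sets (cvec N) \<and>
     (\<forall>i<N. integrable nu (\<lambda>w. (cmod (w i))\<^sup>2)) \<and>
     (\<forall>i<N. \<forall>k<N. S i k =
        (LINT w|nu. (w i - (LINT v|nu. v i)) * cnj (w k - (LINT v|nu. v k))))"

definition channel_output ::
  "nat \<Rightarrow> (nat \<Rightarrow> nat \<Rightarrow> complex) \<Rightarrow> (nat \<Rightarrow> complex) \<Rightarrow> (nat \<Rightarrow> complex) \<Rightarrow> (nat \<Rightarrow> complex)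
     \<Rightarrow> nat \<Rightarrow> complex" where
  "channel_output N H x w z = (\<lambda>i\<in>{..<N}. (\<Sum>k<N. H i k * x k) + w i + z i)"

text \<open>
  Mutual information in bits between input and output when the input has law \<open>mu\<close> and the
  interference law \<open>nu\<close>; the product measure makes input, interference and noise independent.
  For square-integrable \<open>mu\<close> and \<open>nu\<close> the Gaussian noise makes the joint law absolutely
  continuous with respect to the product of its marginals and the divergence finite, so the
  real-valued library notion is meaningful.
\<close>

definition channel_information ::
  "nat \<Rightarrow> (nat \<Rightarrow> nat \<Rightarrow> complex) \<Rightarrow> (nat \<Rightarrow> complex) measure \<Rightarrow> (nat \<Rightarrow> complex) measure \<Rightarrow> real"
where
  "channel_information N H nu mu =
     prob_space.mutual_information (mu \<Otimes>\<^sub>M nu \<Otimes>\<^sub>M complex_gaussian N) 2 (cvec N) (cvec N)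
       (\<lambda>(x, w, z). x) (\<lambda>(x, w, z). channel_output N H x w z)"

definition admissible_inputs :: "nat \<Rightarrow> real \<Rightarrow> (nat \<Rightarrow> complex) measure set" where
  "admissible_inputs N P =
     {mu. prob_space mu \<and> sets mu = sets (cvec N) \<and>
          (\<forall>i<N. (\<integral>\<^sup>+x. ennreal ((cmod (x i))\<^sup>2) \<partial>mu) \<le> ennreal P)}"

text \<open>The maximum is read as a supremum, taken in the extended reals.\<close>

definition capacity ::
  "nat \<Rightarrow> (nat \<Rightarrow> nat \<Rightarrow> complex) \<Rightarrow> (nat \<Rightarrow> complex) measure \<Rightarrow> real \<Rightarrow> ereal" where
  "capacity N H nu P = (SUP mu \<in> admissible_inputs N P. ereal (channel_information N H nu mu))"

definition rho1 :: "nat \<Rightarrow> real \<Rightarrow> real \<Rightarrow> real \<Rightarrow> (nat \<Rightarrow> nat \<Rightarrow> complex) \<Rightarrow> real" where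
  "rho1 N L G P S = L\<^sup>2 / (real N * G * P) * Re (mat_trace N S)"

definition rho2 :: "nat \<Rightarrow> real \<Rightarrow> real \<Rightarrow> real \<Rightarrow> (nat \<Rightarrow> nat \<Rightarrow> complex) \<Rightarrow> real" where
  "rho2 N L G P S = L ^ 4 / (real N * (G * P)\<^sup>2) * Re (mat_trace N (mat_prod N S S))"

definition spatial_dof :: "real \<Rightarrow> real \<Rightarrow> real \<Rightarrow> real" where
  "spatial_dof D L lam =
     max 1 (D\<^sup>2 / (lam * L) * inverse (1 + max 0 (log 2 (D\<^sup>2 / (lam * L)))))"

text \<open>
  The probability of an event tends to 1. Formulated with measurable events contained in the
  given one, so that no measurability of \<open>Q N\<close> itself is presupposed; if \<open>Q N\<close> is measurable,
  this is convergence of its probability to 1.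
\<close>

definition with_high_probability :: "(nat \<Rightarrow> 'a measure) \<Rightarrow> (nat \<Rightarrow> 'a \<Rightarrow> bool) \<Rightarrow> bool" where
  "with_high_probability M Q \<longleftrightarrow>
     (\<exists>E. (\<forall>N. E N \<in> sets (M N) \<and> (\<forall>\<omega>\<in>E N. Q N \<omega>)) \<and>
          (\<lambda>N. measure (M N) (E N)) \<longlonglongrightarrow> 1)"

end

theory Submission
  imports Defs
begin

text \<open>
  The logarithm in the bound is positive only if \<open>\<delta> (\<rho>\<^sub>1 + K\<^sub>1 N) < K\<^sub>1 N\<close>, and then the factor in
  front of it is at most \<open>(K\<^sub>1\<^sup>2 / K\<^sub>2) m\<close> with \<open>m = min N M\<close>. So it suffices to convey
  \<open>c m log (1 + snr K\<^sub>1 N / (1 + snr \<rho>\<^sub>1))\<close> bits. A deterministic channel matrix allows this as soon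
  as its entries have the right order and the squared Frobenius norm of \<open>H H\<^sup>*\<close> is
  \<open>O((G / L\<^sup>2)\<^sup>2 N\<^sup>4 / m)\<close>: a projection \<open>P\<close> of rank less than \<open>n = c m\<close> then satisfies
  \<open>tr (P H H\<^sup>*) \<le> tr (H H\<^sup>*) / 2\<close>, so one finds greedily \<open>n\<close> sign patterns over all antennas whose
  images under \<open>H\<close> have mutually orthogonal residuals of energy \<open>\<ge> c N\<^sup>2\<close>. Each stream carries a
  sum of independent binary digits, and all digits are decoded successively. The inputs
  being discrete, each digit contributes at least \<open>SINR / (1 + SINR)\<close> up to a constant, for an
  arbitrary interference law; the sum over the digits of one stream is a logarithm, and the
  interference seen by the orthonormal filters adds up to at most \<open>tr \<Sigma>\<close>.

  The Frobenius norm is a sum over pairs of receivers and pairs of transmitters. Integrating by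
  parts in the vertical coordinate of a receiver shows that, for any fixed transmitter, the
  channel vectors of a random second one have mean squared correlation \<open>O(\<lambda> L / D\<^sup>2)\<close>; the second
  moment method, first for the transmitters and then for the receivers, gives concentration.
\<close>

section \<open>Mutual information with a finite input alphabet\<close>

text \<open>The squared total energy divided by the squared Frobenius norm of H H* is an effective
  rank, and the number of streams is a constant multiple of the value which the Gram estimate
  guarantees for it; singular values of H never enter. Singular vectors would also be awkward as
  beams: the power constraint limits every antenna separately, whereas sign patterns load all
  antennas equally. The patterns may be tailored to H because the capacity is that of a fixed
  matrix. The interference is known through its covariance only, so a decoding statistic has to be
  judged by its first two moments. This is why the likelihood ratios are damped and why the filters
  are analysed through variances. The value 1/16 of \<open>K1\<close> is the product of 1/4 (the
  least channel gain is G / (4 L^2)), 1/2 (the energy that earlier directions may capture) and 1/2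
  (interference and noise are separated by doubling both variances).\<close>

lemma density_le_of_emeasure_le:
  fixes g :: "'a \<Rightarrow> ennreal"
  assumes "finite_measure P" and g[measurable]: "g \<in> borel_measurable P"
    and dom: "\<And>A. A \<in> sets P \<Longrightarrow> emeasure (density P g) A \<le> ennreal C * emeasure P A"
  shows "AE x in P. g x \<le> ennreal C"
proof -
  interpret finite_measure P by fact
  \<comment> \<open>The excess of \<open>g\<close> over \<open>C\<close> is integrated over the set
    where it is positive; domination makes this integral vanish.\<close>
  define A where "A = {x \<in> space P. ennreal C < g x}"
  have A[measurable]: "A \<in> sets P" unfolding A_def by measurable
  have fin: "(\<integral>\<^sup>+x. ennreal C * indicator A x \<partial>P) \<noteq> \<infinity>"
    by (simp add: nn_integral_cmult_indicator emeasure_eq_measure ennreal_mult_eq_top_iff)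
  have "(\<integral>\<^sup>+x. g x * indicator A x - ennreal C * indicator A x \<partial>P) =
      (\<integral>\<^sup>+x. g x * indicator A x \<partial>P) - (\<integral>\<^sup>+x. ennreal C * indicator A x \<partial>P)"
    by (rule nn_integral_diff) (use fin in \<open>auto simp: A_def indicator_def less_imp_le\<close>)
  also have "\<dots> = emeasure (density P g) A - ennreal C * emeasure P A"
    by (simp add: emeasure_density nn_integral_cmult_indicator)
  also have "\<dots> = 0"
    using dom[OF A] fin
    by (intro diff_eq_0_ennreal) (auto simp: nn_integral_cmult_indicator top.not_eq_extremum intro: le_less_trans)
  finally have "AE x in P. g x * indicator A x - ennreal C * indicator A x = 0"
    by (subst (asm) nn_integral_0_iff_AE) auto
  then show ?thesis
  proof (rule AE_mp, intro AE_I2 impI)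
    fix x assume x: "x \<in> space P" and eq: "g x * indicator A x - ennreal C * indicator A x = 0"
    show "g x \<le> ennreal C"
    proof (rule ccontr)
      assume "\<not> g x \<le> ennreal C"
      then have "x \<in> A" using x by (auto simp: A_def)
      then have "g x - ennreal C = 0" using eq by simp
      with \<open>\<not> g x \<le> ennreal C\<close> show False
        using diff_eq_0_iff_ennreal[of "g x" "ennreal C"] by simp
    qed
  qed
qed

text \<open>Gibbs' inequality: among subprobability densities with respect to \<open>P\<close>, the
  derivative of \<open>Q\<close> has the largest mean logarithm under \<open>Q\<close>. In the
  argument order of the library, \<open>KL_divergence 2 P Q\<close> is the divergence of
  \<open>Q\<close> from \<open>P\<close>. Domination by \<open>C\<close> bounds the derivative, so
  that every integral involved converges.\<close>

lemma KL_divergence_ge: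
  fixes f :: "'a \<Rightarrow> real"
  assumes "prob_space P" "prob_space Q" and sets_eq: "sets Q = sets P"
    and dom: "\<And>A. A \<in> sets P \<Longrightarrow> emeasure Q A \<le> ennreal C * emeasure P A"
    and f[measurable]: "f \<in> borel_measurable P"
    and lu: "0 < l" "\<And>x. l \<le> f x" "\<And>x. f x \<le> u"
    and int1: "(\<integral>x. f x \<partial>P) \<le> 1"
  shows "(\<integral>x. log 2 (f x) \<partial>Q) \<le> KL_divergence 2 P Q"
proof -
  interpret P: prob_space P by fact
  interpret Q: prob_space Q by fact
  have fpos: "0 < f x" for x using lu(1) lu(2)[of x] by linarith
  have ac: "absolutely_continuous P Q"
    unfolding absolutely_continuous_def
  proof
    fix A assume "A \<in> null_sets P"
    then have "A \<in> sets P" "emeasure P A = 0" by auto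
    with dom[of A] show "A \<in> null_sets Q" by (simp add: sets_eq null_sets_def)
  qed
  define D where "D x = enn2real (RN_deriv P Q x)" for x
  have D[measurable]: "D \<in> borel_measurable P" unfolding D_def by measurable
  have den: "density P (RN_deriv P Q) = Q"
    using ac sets_eq by (rule P.density_RN_deriv)
  have le: "AE x in P. RN_deriv P Q x \<le> ennreal C"
    by (rule density_le_of_emeasure_le) (use dom in \<open>auto simp: den P.finite_measure_axioms\<close>)
  have AED: "AE x in P. RN_deriv P Q x = ennreal (D x)"
    using le by (rule AE_mp) (auto intro!: AE_I2 simp: D_def dest: le_less_trans[OF _ ennreal_less_top])
  have D0: "0 \<le> D x" for x by (simp add: D_def)
  have DC: "AE x in P. D x \<le> max C 0"
    using le AED
  proof eventually_elim
    case (elim x)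
    then show ?case using D0[of x]
      by (auto simp: ennreal_le_iff2 max_def)
  qed
  have denD: "density P (\<lambda>x. ennreal (D x)) = Q"
    using density_cong[OF _ _ AED] den by simp
  have KL: "KL_divergence 2 P Q = (\<integral>x. D x * log 2 (D x) \<partial>P)"
    unfolding denD[symmetric] by (rule P.KL_density) (use D0 in auto)
  have lf: "(\<integral>x. log 2 (f x) \<partial>Q) = (\<integral>x. D x * log 2 (f x) \<partial>P)"
    unfolding denD[symmetric] by (subst integral_real_density) (use D0 in auto)
  have intD: "integrable P D"
    by (rule P.integrable_const_bound[where B="max C 0"]) (use DC D0 in auto)
  have intf: "integrable P f"
    by (rule P.integrable_const_bound[where B="u"]) (use lu fpos in \<open>auto simp: less_imp_le\<close>)
  have D1: "(\<integral>x. D x \<partial>P) = 1"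
  proof -
    have "ennreal (\<integral>x. D x \<partial>P) = (\<integral>\<^sup>+x. ennreal (D x) \<partial>P)"
      by (rule nn_integral_eq_integral[symmetric]) (use intD D0 in auto)
    also have "\<dots> = emeasure Q (space Q)"
      unfolding denD[symmetric] by (simp add: emeasure_density cong: nn_integral_cong)
    finally show ?thesis by (simp add: Q.emeasure_space_1)
  qed
  have i1: "integrable P (\<lambda>x. D x * log 2 (D x))"
  proof (rule P.integrable_const_bound[where B="((max C 0)\<^sup>2 + 1) / ln 2"])
    show "AE x in P. norm (D x * log 2 (D x)) \<le> ((max C 0)\<^sup>2 + 1) / ln 2"
      using DC
    proof eventually_elim
      case (elim x)
      \<comment> \<open>The inequality ln t \<le> t - 1, used at t and at 1/t, places t ln t between
        -1 and t^2.\<close>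
      have "\<bar>D x * ln (D x)\<bar> \<le> (max C 0)\<^sup>2 + 1"
      proof (cases "D x = 0")
        case False
        then have p: "0 < D x" using D0[of x] by linarith
        have "ln (D x) \<le> D x" using ln_le_minus_one[OF p] by linarith
        then have "D x * ln (D x) \<le> D x * D x" using p by simp
        also have "\<dots> \<le> (max C 0)\<^sup>2" using p elim by (auto simp: power2_eq_square intro!: mult_mono)
        finally have a: "D x * ln (D x) \<le> (max C 0)\<^sup>2" .
        have "- ln (D x) \<le> 1 / D x - 1" using ln_le_minus_one[of "1 / D x"] p by (simp add: ln_div)
        then have "D x * (- ln (D x)) \<le> D x * (1 / D x - 1)" using p by (intro mult_left_mono) auto
        also have "\<dots> = 1 - D x" using p by (simp add: right_diff_distrib)
        finally have "- (D x * ln (D x)) \<le> 1" using p by simp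
        then show ?thesis using a by (smt (verit) zero_le_power2)
      qed simp
      then show ?case by (simp add: log_def abs_mult field_simps divide_right_mono)
    qed
  qed measurable
  have i2: "integrable P (\<lambda>x. D x * log 2 (f x))"
  proof (rule P.integrable_const_bound[where B="max C 0 * max \<bar>log 2 l\<bar> \<bar>log 2 u\<bar>"])
    show "AE x in P. norm (D x * log 2 (f x)) \<le> max C 0 * max \<bar>log 2 l\<bar> \<bar>log 2 u\<bar>"
      using DC
    proof eventually_elim
      case (elim x)
      have "log 2 l \<le> log 2 (f x)" "log 2 (f x) \<le> log 2 u"
        using lu(1) lu(2)[of x] lu(3)[of x] fpos[of x] by auto
      then have "\<bar>log 2 (f x)\<bar> \<le> max \<bar>log 2 l\<bar> \<bar>log 2 u\<bar>" by linarith
      then show ?case using elim D0[of x] by (auto simp: abs_mult intro!: mult_mono)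
    qed
  qed measurable
  have "0 \<le> (1 - (\<integral>x. f x \<partial>P)) / ln 2" using int1 by simp
  also have "\<dots> = (\<integral>x. (D x - f x) / ln 2 \<partial>P)"
    using intD intf D1 by simp
  also have "\<dots> \<le> (\<integral>x. D x * log 2 (D x) - D x * log 2 (f x) \<partial>P)"
  proof (rule integral_mono_AE)
    show "AE x in P. (D x - f x) / ln 2 \<le> D x * log 2 (D x) - D x * log 2 (f x)"
    proof (rule AE_I2)
      fix x
      \<comment> \<open>This is ln z \<le> z - 1 at z = f / D, multiplied by D; for D = 0 it says
        that f is nonnegative.\<close>
      have "D x - f x \<le> D x * ln (D x) - D x * ln (f x)"
      proof (cases "D x = 0")
        case False
        then have p: "0 < D x" using D0[of x] by linarith
        have "ln (f x / D x) \<le> f x / D x - 1" using fpos[of x] p by (intro ln_le_minus_one) auto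
        then have "D x * (ln (f x) - ln (D x)) \<le> D x * (f x / D x - 1)"
          using p fpos[of x] by (intro mult_left_mono) (auto simp: ln_div)
        then show ?thesis using p by (simp add: algebra_simps)
      qed (use fpos[of x] in simp)
      then show "(D x - f x) / ln 2 \<le> D x * log 2 (D x) - D x * log 2 (f x)"
        by (simp add: log_def diff_divide_distrib[symmetric] divide_right_mono)
    qed
  qed (use intD intf i1 i2 in auto)
  also have "\<dots> = KL_divergence 2 P Q - (\<integral>x. log 2 (f x) \<partial>Q)"
    unfolding KL lf using i1 i2 by simp
  finally show ?thesis by simp
qed

lemma integral_uniform_input:
  fixes h :: "'x \<times> 'm \<Rightarrow> real" and enc :: "'o \<Rightarrow> 'x"
  assumes \<Omega>: "finite \<Omega>" "\<Omega> \<noteq> {}" and enc: "\<And>\<omega>. enc \<omega> \<in> space S" and "prob_space M2"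
    and h[measurable]: "h \<in> borel_measurable (S \<Otimes>\<^sub>M M2)" and b: "\<And>z. \<bar>h z\<bar> \<le> B"
  shows "(\<integral>z. h z \<partial>(distr (measure_pmf (pmf_of_set \<Omega>)) S enc \<Otimes>\<^sub>M M2)) =
    (\<Sum>\<omega>\<in>\<Omega>. \<integral>m. h (enc \<omega>, m) \<partial>M2) / card \<Omega>"
proof -
  let ?mu = "distr (measure_pmf (pmf_of_set \<Omega>)) S enc"
  have em[measurable]: "enc \<in> measurable (measure_pmf (pmf_of_set \<Omega>)) S" using enc by simp
  interpret mu: prob_space ?mu by (rule measure_pmf.prob_space_distr) measurable
  interpret M2: prob_space M2 by fact
  interpret pair_prob_space ?mu M2 ..
  have sets_pair[measurable_cong, simp]: "sets (?mu \<Otimes>\<^sub>M M2) = sets (S \<Otimes>\<^sub>M M2)"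
    by (intro sets_pair_measure_cong) simp_all
  have "integrable (?mu \<Otimes>\<^sub>M M2) h"
    by (rule P.integrable_const_bound[where B=B]) (use b in auto)
  then have "(\<integral>z. h z \<partial>(?mu \<Otimes>\<^sub>M M2)) = (\<integral>x. (\<integral>m. h (x, m) \<partial>M2) \<partial>?mu)"
    by (rule integral_fst'[symmetric])
  also have "\<dots> = (\<Sum>\<omega>\<in>\<Omega>. \<integral>m. h (enc \<omega>, m) \<partial>M2) / card \<Omega>"
    by (subst integral_distr) (use \<Omega> enc in \<open>simp_all add: integral_pmf_of_set\<close>)
  finally show ?thesis .
qed

text \<open>
  A function with \<open>\<integral> f(x, y) dP\<^sub>X(x) \<le> 1\<close> for all \<open>y\<close> is, up to normalisation, a
  conditional law of the input given the output divided by the law of the input; this is the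
  usual lower bound on mutual information by a mismatched decoder. The finite input alphabet
  bounds the Radon-Nikodym derivative of the joint law, so the library's Kullback-Leibler
  divergence is a genuine one.
\<close>

lemma mutual_information_finite_input_ge:
  fixes f :: "'x \<times> 'y \<Rightarrow> real" and enc :: "'o \<Rightarrow> 'x"
  assumes \<Omega>: "finite \<Omega>" "\<Omega> \<noteq> {}" and enc: "\<And>\<omega>. enc \<omega> \<in> space S" and "prob_space M2"
    and Y[measurable]: "Y \<in> measurable (S \<Otimes>\<^sub>M M2) T"
    and f[measurable]: "f \<in> borel_measurable (S \<Otimes>\<^sub>M T)"
    and lu: "0 < l" "\<And>z. l \<le> f z" "\<And>z. f z \<le> u"
    and sum_le: "\<And>y. y \<in> space T \<Longrightarrow> (\<Sum>\<omega>\<in>\<Omega>. f (enc \<omega>, y)) \<le> card \<Omega>"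
  defines "mu \<equiv> distr (measure_pmf (pmf_of_set \<Omega>)) S enc"
  shows "(\<Sum>\<omega>\<in>\<Omega>. \<integral>m. log 2 (f (enc \<omega>, Y (enc \<omega>, m))) \<partial>M2) / card \<Omega>
    \<le> prob_space.mutual_information (mu \<Otimes>\<^sub>M M2) 2 S T fst Y"
proof -
  have em[measurable]: "enc \<in> measurable (measure_pmf (pmf_of_set \<Omega>)) S" using enc by simp
  interpret mu: prob_space mu unfolding mu_def by (rule measure_pmf.prob_space_distr) measurable
  interpret M2: prob_space M2 by fact
  interpret pair_prob_space mu M2 ..
  have sets_mu[measurable_cong, simp]: "sets mu = sets S" by (simp add: mu_def)
  have sets_pair[measurable_cong, simp]: "sets (mu \<Otimes>\<^sub>M M2) = sets (S \<Otimes>\<^sub>M M2)"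
    by (intro sets_pair_measure_cong) simp_all
  define PY where "PY = distr (mu \<Otimes>\<^sub>M M2) T Y"
  define J where "J = distr (mu \<Otimes>\<^sub>M M2) (S \<Otimes>\<^sub>M T) (\<lambda>x. (fst x, Y x))"
  have PX: "distr (mu \<Otimes>\<^sub>M M2) S fst = mu"
    using M2.distr_pair_fst[of mu] by (simp cong: distr_cong)
  have MI: "mutual_information 2 S T fst Y = KL_divergence 2 (mu \<Otimes>\<^sub>M PY) J"
    unfolding mutual_information_def PX PY_def J_def ..
  interpret PY: prob_space PY unfolding PY_def by (rule P.prob_space_distr) simp
  interpret J: prob_space J unfolding J_def by (rule P.prob_space_distr) simp
  interpret PP: pair_prob_space mu PY ..
  have sets_PY[measurable_cong, simp]: "sets PY = sets T" by (simp add: PY_def)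
  have sets_PP[measurable_cong, simp]: "sets (mu \<Otimes>\<^sub>M PY) = sets (S \<Otimes>\<^sub>M T)"
    by (intro sets_pair_measure_cong) simp_all
  have space_PY: "space PY = space T" by (simp add: PY_def)
  define c where "c = real (card \<Omega>)"
  have c: "0 < c" using \<Omega> by (simp add: c_def card_gt_0_iff)
  have J_int: "(\<integral>z. h z \<partial>J) = (\<Sum>\<omega>\<in>\<Omega>. \<integral>m. h (enc \<omega>, Y (enc \<omega>, m)) \<partial>M2) / c"
    if [measurable]: "h \<in> borel_measurable (S \<Otimes>\<^sub>M T)" and "\<And>z. \<bar>h z\<bar> \<le> B" for h :: "_ \<Rightarrow> real" and B
  proof -
    have "(\<integral>z. h z \<partial>J) = (\<integral>x. h (fst x, Y x) \<partial>(mu \<Otimes>\<^sub>M M2))"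
      unfolding J_def by (rule integral_distr) simp_all
    also have "\<dots> = (\<Sum>\<omega>\<in>\<Omega>. \<integral>m. h (fst (enc \<omega>, m), Y (enc \<omega>, m)) \<partial>M2) / c"
      unfolding mu_def c_def
      by (rule integral_uniform_input[where B=B]) (use \<Omega> enc assms(4) that(2) in auto)
    finally show ?thesis by simp
  qed
  have P_int: "(\<integral>z. h z \<partial>(mu \<Otimes>\<^sub>M PY)) = (\<Sum>\<omega>\<in>\<Omega>. \<integral>y. h (enc \<omega>, y) \<partial>PY) / c"
    if [measurable]: "h \<in> borel_measurable (S \<Otimes>\<^sub>M T)" and "\<And>z. \<bar>h z\<bar> \<le> B" for h :: "_ \<Rightarrow> real" and B
    unfolding mu_def c_def
    by (rule integral_uniform_input[where B=B]) (use \<Omega> enc PY.prob_space_axioms that(2) in auto)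
  have Y_int: "(\<integral>y. g y \<partial>PY) = (\<Sum>\<omega>\<in>\<Omega>. \<integral>m. g (Y (enc \<omega>, m)) \<partial>M2) / c"
    if [measurable]: "g \<in> borel_measurable T" and "\<And>z. \<bar>g z\<bar> \<le> B" for g :: "_ \<Rightarrow> real" and B
  proof -
    have "(\<integral>y. g y \<partial>PY) = (\<integral>x. g (Y x) \<partial>(mu \<Otimes>\<^sub>M M2))"
      unfolding PY_def by (rule integral_distr) simp_all
    also have "\<dots> = (\<Sum>\<omega>\<in>\<Omega>. \<integral>m. g (Y (enc \<omega>, m)) \<partial>M2) / c"
      unfolding mu_def c_def
      by (rule integral_uniform_input[where B=B]) (use \<Omega> enc assms(4) that(2) in auto)
    finally show ?thesis .
  qed
  \<comment> \<open>The output law is the average, over \<open>c\<close> codewords, of the output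
    laws given the codeword, so it is at least 1/c times each of them.\<close>
  have dom: "emeasure J A \<le> ennreal c * emeasure (mu \<Otimes>\<^sub>M PY) A" if "A \<in> sets (mu \<Otimes>\<^sub>M PY)" for A
  proof -
    have A[measurable]: "A \<in> sets (S \<Otimes>\<^sub>M T)" using that by simp
    let ?i = "indicator A :: _ \<Rightarrow> real"
    have int_le: "(\<integral>m. ?i (enc \<omega>, Y (enc \<omega>, m)) \<partial>M2) \<le> c * (\<integral>y. ?i (enc \<omega>, y) \<partial>PY)"
      if "\<omega> \<in> \<Omega>" for \<omega>
    proof -
      have [measurable]: "enc \<omega> \<in> space S" by (rule enc)
      have "(\<integral>y. ?i (enc \<omega>, y) \<partial>PY) = (\<Sum>\<omega>'\<in>\<Omega>. \<integral>m. ?i (enc \<omega>, Y (enc \<omega>', m)) \<partial>M2) / c"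
        by (rule Y_int[of _ 1]) (auto simp: indicator_def)
      moreover have "(\<integral>m. ?i (enc \<omega>, Y (enc \<omega>, m)) \<partial>M2) \<le>
          (\<Sum>\<omega>'\<in>\<Omega>. \<integral>m. ?i (enc \<omega>, Y (enc \<omega>', m)) \<partial>M2)"
        using that \<Omega> by (intro member_le_sum) auto
      ultimately show ?thesis using c by simp
    qed
    have "measure J A = (\<integral>z. ?i z \<partial>J)"
      using A by (simp add: J_def)
    also have "\<dots> = (\<Sum>\<omega>\<in>\<Omega>. \<integral>m. ?i (enc \<omega>, Y (enc \<omega>, m)) \<partial>M2) / c"
      by (rule J_int[of _ 1]) (auto simp: indicator_def)
    also have "\<dots> \<le> (\<Sum>\<omega>\<in>\<Omega>. c * (\<integral>y. ?i (enc \<omega>, y) \<partial>PY)) / c"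
      using c int_le by (intro divide_right_mono sum_mono) auto
    also have "\<dots> = c * ((\<Sum>\<omega>\<in>\<Omega>. (\<integral>y. ?i (enc \<omega>, y) \<partial>PY)) / c)"
      by (simp add: sum_distrib_left)
    also have "(\<Sum>\<omega>\<in>\<Omega>. (\<integral>y. ?i (enc \<omega>, y) \<partial>PY)) / c = (\<integral>z. ?i z \<partial>(mu \<Otimes>\<^sub>M PY))"
      by (rule P_int[of _ 1, symmetric]) (auto simp: indicator_def)
    also have "\<dots> = measure (mu \<Otimes>\<^sub>M PY) A" using that by simp
    finally show ?thesis
      using c by (simp add: J.emeasure_eq_measure PP.P.emeasure_eq_measure ennreal_mult[symmetric])
  qed
  \<comment> \<open>Under the product measure the codeword is independent of the output, so
    \<open>sum_le\<close> bounds the average over the codewords for each fixed output.\<close>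
  have Pf: "(\<integral>z. f z \<partial>(mu \<Otimes>\<^sub>M PY)) \<le> 1"
  proof -
    have fb: "\<bar>f z\<bar> \<le> u" for z using lu(1) lu(2)[of z] lu(3)[of z] by simp
    have [measurable]: "enc \<omega> \<in> space S" for \<omega> by (rule enc)
    have int: "integrable PY (\<lambda>y. f (enc \<omega>, y))" for \<omega>
      by (rule PY.integrable_const_bound[where B=u]) (use fb in auto)
    have "(\<integral>z. f z \<partial>(mu \<Otimes>\<^sub>M PY)) = (\<Sum>\<omega>\<in>\<Omega>. \<integral>y. f (enc \<omega>, y) \<partial>PY) / c"
      by (rule P_int[of _ u]) (use fb in auto)
    also have "\<dots> = (\<integral>y. (\<Sum>\<omega>\<in>\<Omega>. f (enc \<omega>, y)) \<partial>PY) / c"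
      using int by simp
    also have "\<dots> \<le> (\<integral>y. c \<partial>PY) / c"
      using c int sum_le
      by (intro divide_right_mono integral_mono) (auto simp: c_def space_PY)
    also have "\<dots> = 1" using c by (simp add: PY.prob_space)
    finally show ?thesis .
  qed
  have "(\<integral>z. log 2 (f z) \<partial>J) \<le> KL_divergence 2 (mu \<Otimes>\<^sub>M PY) J"
    by (rule KL_divergence_ge[where C=c and l=l and u=u])
       (use dom lu Pf PP.P.prob_space_axioms J.prob_space_axioms in \<open>auto simp: J_def\<close>)
  moreover have "(\<integral>z. log 2 (f z) \<partial>J) = (\<Sum>\<omega>\<in>\<Omega>. \<integral>m. log 2 (f (enc \<omega>, Y (enc \<omega>, m))) \<partial>M2) / c"
  proof (rule J_int[of _ "max \<bar>log 2 l\<bar> \<bar>log 2 u\<bar>"])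
    fix z
    have "log 2 l \<le> log 2 (f z)" "log 2 (f z) \<le> log 2 u"
      using lu(1) lu(2)[of z] lu(3)[of z] by auto
    then show "\<bar>log 2 (f z)\<bar> \<le> max \<bar>log 2 l\<bar> \<bar>log 2 u\<bar>" by linarith
  qed measurable
  ultimately show ?thesis unfolding MI c_def by simp
qed

section \<open>Random signs and complex Gaussian noise\<close>

text \<open>Expectations over fair signs are finite sums over this set. \<open>PiE\<close> fixes the
  values outside the index range, so that a sign vector is determined by its entries below
  \<open>J\<close>.\<close>

definition signs :: "nat \<Rightarrow> (nat \<Rightarrow> real) set" where
  "signs J = PiE {..<J} (\<lambda>_. {-1, 1})"

lemma finite_signs [simp]: "finite (signs J)"
  unfolding signs_def by (intro finite_PiE) auto

lemma card_signs: "card (signs J) = 2 ^ J"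
  unfolding signs_def by (subst card_PiE) (auto simp: numeral_2_eq_2)

lemma signs_nonempty [simp]: "signs J \<noteq> {}"
  by (auto simp: signs_def PiE_eq_empty_iff)

lemma sum_signs_Suc:
  "(\<Sum>s\<in>signs (Suc J). F s) = (\<Sum>s\<in>signs J. F (s(J := 1)) + F (s(J := -1)))"
  for F :: "(nat \<Rightarrow> real) \<Rightarrow> 'b::comm_monoid_add"
proof -
  have eq: "signs (Suc J) = (\<lambda>(y, s). s(J := y)) ` ({-1, 1} \<times> signs J)"
    by (simp add: signs_def lessThan_Suc PiE_insert_eq)
  have inj: "inj_on (\<lambda>(y, s). s(J := y)) ({-1, 1} \<times> signs J)"
    using inj_combinator[of J "{..<J}" "\<lambda>_. {-1, 1 :: real}"] by (simp add: signs_def)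
  have "(\<Sum>s\<in>signs (Suc J). F s) = (\<Sum>(y, s)\<in>{-1, 1} \<times> signs J. F (s(J := y)))"
    unfolding eq by (subst sum.reindex[OF inj]) (simp add: case_prod_unfold)
  also have "\<dots> = (\<Sum>s\<in>signs J. F (s(J := 1)) + F (s(J := -1)))"
    by (subst sum.cartesian_product[symmetric]) (simp add: sum.distrib add.commute)
  finally show ?thesis .
qed

text \<open>Independent fair signs are orthonormal. The offsets \<open>c\<close> and
  \<open>d\<close> are free so that the induction can absorb the last sign into them, once with each
  value; in the application they hold interference plus noise.\<close>

lemma sum_signs_bilinear:
  fixes a b :: "nat \<Rightarrow> real"
  shows "(\<Sum>s\<in>signs J. ((\<Sum>i<J. s i * a i) + c) * ((\<Sum>i<J. s i * b i) + d)) =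
    2 ^ J * ((\<Sum>i<J. a i * b i) + c * d)"
proof (induction J arbitrary: c d)
  case (Suc J)
  have upd: "(\<Sum>i<J. (s(J := y)) i * f i) = (\<Sum>i<J. s i * f i)" for s f and y :: real
    by (intro sum.cong) auto
  have "(\<Sum>s\<in>signs (Suc J). ((\<Sum>i<Suc J. s i * a i) + c) * ((\<Sum>i<Suc J. s i * b i) + d)) =
     (\<Sum>s\<in>signs J. ((\<Sum>i<J. s i * a i) + (a J + c)) * ((\<Sum>i<J. s i * b i) + (b J + d))) +
     (\<Sum>s\<in>signs J. ((\<Sum>i<J. s i * a i) + (- a J + c)) * ((\<Sum>i<J. s i * b i) + (- b J + d)))"
    unfolding sum_signs_Suc sum.distrib lessThan_Suc
    by (simp only: sum.insert finite_lessThan lessThan_iff less_irrefl not_False_eq_True upd fun_upd_same)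
       (simp add: algebra_simps)
  then show ?case unfolding Suc.IH by (simp add: algebra_simps)
qed (simp add: card_signs)

lemma sum_signs_linear:
  assumes "j < J"
  shows "(\<Sum>s\<in>signs J. s j * ((\<Sum>i<J. s i * a i) + c)) = 2 ^ J * a j"
proof -
  have "(\<Sum>i<J. f i * (if i = j then 1 else 0)) = f j" for f :: "nat \<Rightarrow> real"
    using assms by (subst sum.remove[of _ j]) auto
  then show ?thesis
    using sum_signs_bilinear[where a=a and c=c and b="\<lambda>i. if i = j then 1 else 0" and d=0 and J=J]
    by (simp add: mult.commute)
qed

lemma sum_signs_square:
  "(\<Sum>s\<in>signs J. ((\<Sum>i<J. s i * a i) + c)\<^sup>2) = 2 ^ J * ((\<Sum>i<J. (a i)\<^sup>2) + c\<^sup>2)" for a :: "nat \<Rightarrow> real"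
  using sum_signs_bilinear[where a=a and c=c and b=a and d=c] by (simp add: power2_eq_square)

text \<open>Under fair signs the product is a martingale: \<open>T j\<close> depends on earlier
  signs only, so averaging over the last sign removes its factor. This is the normalisation required
  of the likelihood ratio of the successive decoder.\<close>

lemma sum_signs_prod_predictable:
  fixes T :: "nat \<Rightarrow> (nat \<Rightarrow> real) \<Rightarrow> real"
  assumes "\<And>j s s'. (\<And>i. i < j \<Longrightarrow> s i = s' i) \<Longrightarrow> T j s = T j s'"
  shows "(\<Sum>s\<in>signs J. \<Prod>j<J. 1 + s j * T j s) = 2 ^ J"
proof (induction J)
  case (Suc J)
  have T: "T j (s(J := y)) = T j s" if "j \<le> J" for j s y
    using that by (intro assms) auto
  have "(\<Prod>j<Suc J. 1 + (s(J := y)) j * T j (s(J := y))) =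
      (\<Prod>j<J. 1 + s j * T j s) * (1 + y * T J s)" for s y
  proof -
    have "(\<Prod>j<J. 1 + (s(J := y)) j * T j (s(J := y))) = (\<Prod>j<J. 1 + s j * T j s)"
      by (intro prod.cong) (auto simp: T)
    then show ?thesis by (simp add: T)
  qed
  then have "(\<Sum>s\<in>signs (Suc J). \<Prod>j<Suc J. 1 + s j * T j s) =
      (\<Sum>s\<in>signs J. 2 * (\<Prod>j<J. 1 + s j * T j s))"
    unfolding sum_signs_Suc by (simp only:) (simp add: algebra_simps)
  then show ?case by (simp add: sum_distrib_left[symmetric] Suc.IH)
qed (simp add: card_signs)

text \<open>
  For a sign \<open>s\<close> and a bounded statistic \<open>T = x / (1 + 4 x\<^sup>2)\<close>, \<open>1 + s T\<close> is a likelihood ratio,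
  and the expectation of its logarithm is controlled by two moments of \<open>x\<close> alone.
\<close>

lemma ln_one_plus_damped_ge:
  fixes x s :: real
  assumes "s \<in> {-1, 1}"
  defines "t \<equiv> x / (1 + 4 * x\<^sup>2)"
  shows "\<bar>s * t\<bar> \<le> 1 / 4" and "s * x - 3 * x\<^sup>2 \<le> ln (1 + s * t)"
proof -
  have p: "0 < 1 + 4 * x\<^sup>2" by (simp add: add_pos_nonneg)
  have amgm: "4 * \<bar>x\<bar> \<le> 1 + 4 * x\<^sup>2"
    using zero_le_power2[of "2 * \<bar>x\<bar> - 1"] by (simp add: power2_eq_square algebra_simps)
  have abs_s: "\<bar>s * y\<bar> = \<bar>y\<bar>" for y using assms(1) by (auto simp: abs_mult)
  have "\<bar>t\<bar> = \<bar>x\<bar> / (1 + 4 * x\<^sup>2)" using p by (simp add: t_def)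
  moreover have "4 * \<bar>x\<bar> / (1 + 4 * x\<^sup>2) \<le> 1" "\<bar>x\<bar> / (1 + 4 * x\<^sup>2) \<le> \<bar>x\<bar> / 1"
    using amgm p by (simp, intro divide_left_mono) auto
  ultimately have t4: "\<bar>t\<bar> \<le> 1 / 4" and tx: "\<bar>t\<bar> \<le> \<bar>x\<bar>"
    by (simp_all add: mult.commute)
  show b: "\<bar>s * t\<bar> \<le> 1 / 4" using t4 abs_s by simp
  \<comment> \<open>The second factor is at most 1 in absolute value, so the damping costs x^2;
    linearising the logarithm costs another 2 x^2, whence the coefficient 3.\<close>
  have "x - t = x\<^sup>2 * (4 * x / (1 + 4 * x\<^sup>2))"
    using p by (simp add: t_def field_simps power2_eq_square)
  then have "\<bar>x - t\<bar> = x\<^sup>2 * (4 * \<bar>x\<bar> / (1 + 4 * x\<^sup>2))"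
    using p by (simp add: abs_mult)
  also have "\<dots> \<le> x\<^sup>2 * 1"
    using amgm p by (intro mult_left_mono) (auto simp: field_simps)
  finally have "\<bar>s * (x - t)\<bar> \<le> x\<^sup>2" using abs_s by simp
  then have 1: "s * x - x\<^sup>2 \<le> s * t" by (simp add: algebra_simps abs_le_iff)
  have "\<bar>ln (1 + s * t) - s * t\<bar> \<le> 2 * (s * t)\<^sup>2"
    using b by (intro abs_ln_one_plus_x_minus_x_bound) linarith
  moreover have "(s * t)\<^sup>2 \<le> x\<^sup>2"
    using tx abs_s[of t] by (metis abs_le_square_iff)
  ultimately show "s * x - 3 * x\<^sup>2 \<le> ln (1 + s * t)"
    using 1 by linarith
qed

section \<open>The standard complex Gaussian law and its first two moments\<close>

abbreviation gauss1 :: "complex measure" where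
  "gauss1 \<equiv> density lborel (\<lambda>z. ennreal (exp (- (cmod z)\<^sup>2) / pi))"

lemma normal_density_half: "normal_density 0 (1 / sqrt 2) x = exp (- x\<^sup>2) / sqrt pi"
  by (simp add: normal_density_def power_divide)

text \<open>The density factors into two normal densities of variance 1/2. The weight
  \<open>f\<close> is indexed by the basis vectors 1 and \<i> because Tonelli's theorem is applied
  over the Euclidean basis of the complex plane.\<close>

lemma nn_integral_complex_gaussian_weight:
  fixes f :: "complex \<Rightarrow> real \<Rightarrow> real"
  assumes [measurable]: "\<And>b. f b \<in> borel_measurable borel" and nn: "\<And>b x. 0 \<le> f b x"
  shows "(\<integral>\<^sup>+z. ennreal (f 1 (Re z) * f \<i> (Im z) * (exp (- (cmod z)\<^sup>2) / pi)) \<partial>lborel) =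
    (\<integral>\<^sup>+x. ennreal (normal_density 0 (1 / sqrt 2) x * f 1 x) \<partial>lborel) *
    (\<integral>\<^sup>+x. ennreal (normal_density 0 (1 / sqrt 2) x * f \<i> x) \<partial>lborel)"
proof -
  have Basis: "(\<Prod>b\<in>Basis. g b) = g 1 * g \<i>" for g :: "complex \<Rightarrow> ennreal"
    by (simp add: Basis_complex_def complex_eq_iff)
  have "(\<integral>\<^sup>+z. ennreal (f 1 (Re z) * f \<i> (Im z) * (exp (- (cmod z)\<^sup>2) / pi)) \<partial>lborel) =
      (\<integral>\<^sup>+z. (\<Prod>b\<in>Basis. ennreal (normal_density 0 (1 / sqrt 2) (z \<bullet> b) * f b (z \<bullet> b))) \<partial>lborel)"
  proof (rule nn_integral_cong)
    fix z :: complex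
    have "exp (- (cmod z)\<^sup>2) / pi = (exp (- (Re z)\<^sup>2) / sqrt pi) * (exp (- (Im z)\<^sup>2) / sqrt pi)"
      by (simp add: cmod_power2 exp_diff[symmetric] exp_minus_inverse mult_exp_exp)
    then have "f 1 (Re z) * f \<i> (Im z) * (exp (- (cmod z)\<^sup>2) / pi) =
       (exp (- (Re z)\<^sup>2) / sqrt pi * f 1 (Re z)) * (exp (- (Im z)\<^sup>2) / sqrt pi * f \<i> (Im z))"
      by (simp only: mult_ac)
    then show "ennreal (f 1 (Re z) * f \<i> (Im z) * (exp (- (cmod z)\<^sup>2) / pi)) =
        (\<Prod>b\<in>Basis. ennreal (normal_density 0 (1 / sqrt 2) (z \<bullet> b) * f b (z \<bullet> b)))"
      unfolding Basis normal_density_half using nn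
      by (simp only: ennreal_mult[symmetric] mult_nonneg_nonneg divide_nonneg_nonneg exp_ge_zero
        real_sqrt_ge_zero pi_ge_zero inner_complex_def) simp
  qed
  also have "\<dots> = (\<Prod>b\<in>Basis. \<integral>\<^sup>+x. ennreal (normal_density 0 (1 / sqrt 2) x * f b x) \<partial>lborel)"
    by (subst nn_integral_lborel_prod) auto
  also have "\<dots> = (\<integral>\<^sup>+x. ennreal (normal_density 0 (1 / sqrt 2) x * f 1 x) \<partial>lborel) *
    (\<integral>\<^sup>+x. ennreal (normal_density 0 (1 / sqrt 2) x * f \<i> x) \<partial>lborel)"
    by (rule Basis)
  finally show ?thesis .
qed

lemma nn_integral_normal_half:
  "(\<integral>\<^sup>+x. ennreal (normal_density 0 (1 / sqrt 2) x) \<partial>lborel) = 1"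
  "(\<integral>\<^sup>+x. ennreal (normal_density 0 (1 / sqrt 2) x * x\<^sup>2) \<partial>lborel) = ennreal (1 / 2)"
proof -
  show "(\<integral>\<^sup>+x. ennreal (normal_density 0 (1 / sqrt 2) x) \<partial>lborel) = 1"
    by (subst nn_integral_eq_integral) (auto simp: normal_density_nonneg)
  have h: "has_bochner_integral lborel (\<lambda>x. normal_density 0 (1 / sqrt 2) x * x\<^sup>2) (1 / 2)"
    using normal_moment_even[of "1 / sqrt 2" 0 1] by (simp add: power_divide fact_numeral)
  show "(\<integral>\<^sup>+x. ennreal (normal_density 0 (1 / sqrt 2) x * x\<^sup>2) \<partial>lborel) = ennreal (1 / 2)"
    using nn_integral_eq_integral[of lborel "\<lambda>x. normal_density 0 (1 / sqrt 2) x * x\<^sup>2"] h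
    by (simp only: has_bochner_integral_iff normal_density_nonneg zero_le_power2 mult_nonneg_nonneg
      AE_I2 simp_thms)
qed

lemma prob_space_gauss1: "prob_space gauss1"
proof
  show "emeasure gauss1 (space gauss1) = 1"
    using nn_integral_complex_gaussian_weight[of "\<lambda>_ _. 1"]
    by (simp add: emeasure_density nn_integral_normal_half)
qed

lemma gauss1_second_moment:
  "integrable gauss1 (\<lambda>z. (cmod z)\<^sup>2)" "(\<integral>z. (cmod z)\<^sup>2 \<partial>gauss1) = 1"
proof -
  have "(\<integral>\<^sup>+z. ennreal ((cmod z)\<^sup>2) \<partial>gauss1) =
      (\<integral>\<^sup>+z. ennreal ((Re z)\<^sup>2 * (exp (- (cmod z)\<^sup>2) / pi)) + ennreal ((Im z)\<^sup>2 * (exp (- (cmod z)\<^sup>2) / pi)) \<partial>lborel)"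
    by (subst nn_integral_density)
       (auto intro!: nn_integral_cong simp: ennreal_mult[symmetric] ennreal_plus[symmetric] cmod_power2
         field_simps simp del: ennreal_plus)
  also have "\<dots> = (\<integral>\<^sup>+z. ennreal ((Re z)\<^sup>2 * (exp (- (cmod z)\<^sup>2) / pi)) \<partial>lborel) +
      (\<integral>\<^sup>+z. ennreal ((Im z)\<^sup>2 * (exp (- (cmod z)\<^sup>2) / pi)) \<partial>lborel)"
    by (subst nn_integral_add) auto
  also have "\<dots> = ennreal (1 / 2) + ennreal (1 / 2)"
    using nn_integral_complex_gaussian_weight[of "\<lambda>b x. if b = 1 then x\<^sup>2 else 1"]
      nn_integral_complex_gaussian_weight[of "\<lambda>b x. if b = 1 then 1 else x\<^sup>2"]
    by (simp add: nn_integral_normal_half complex_eq_iff)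
  also have "\<dots> = ennreal 1" by (subst ennreal_plus[symmetric]) auto
  finally have e: "(\<integral>\<^sup>+z. ennreal ((cmod z)\<^sup>2) \<partial>gauss1) = ennreal 1" .
  show i: "integrable gauss1 (\<lambda>z. (cmod z)\<^sup>2)"
    by (rule integrableI_nn_integral_finite[OF _ _ e]) auto
  show "(\<integral>z. (cmod z)\<^sup>2 \<partial>gauss1) = 1"
    using e by (subst integral_eq_nn_integral) auto
qed

lemma gauss1_mean: "integrable gauss1 (\<lambda>z. z)" "(\<integral>z. z \<partial>gauss1) = 0"
proof -
  interpret prob_space gauss1 by (rule prob_space_gauss1)
  show "integrable gauss1 (\<lambda>z. z)"
  proof (rule Bochner_Integration.integrable_bound)
    show "integrable gauss1 (\<lambda>z. 1 + (cmod z)\<^sup>2)"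
      using gauss1_second_moment by auto
    show "AE z in gauss1. norm z \<le> norm (1 + (cmod z)\<^sup>2)"
    proof (rule AE_I2)
      fix z :: complex
      have "0 \<le> (cmod z - 1)\<^sup>2" by simp
      then have "2 * cmod z \<le> 1 + (cmod z)\<^sup>2" by (simp add: power2_eq_square algebra_simps)
      then show "norm z \<le> norm (1 + (cmod z)\<^sup>2)" by (smt (verit) norm_ge_zero real_norm_def)
    qed
  qed simp
  \<comment> \<open>The density is even, so reflection at the origin turns the mean into its
    negative.\<close>
  have refl: "distr lborel borel uminus = (lborel :: complex measure)"
    using lborel_affine[of "-1" "0 :: complex"] by (simp add: density_1)
  have "(\<integral>z. z \<partial>gauss1) = (\<integral>z. (exp (- (cmod z)\<^sup>2) / pi) *\<^sub>R z \<partial>lborel)"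
    by (rule integral_density) auto
  also have "\<dots> = (\<integral>z. (exp (- (cmod (- z))\<^sup>2) / pi) *\<^sub>R (- z) \<partial>lborel)"
    by (subst refl[symmetric], subst integral_distr) auto
  also have "\<dots> = - (\<integral>z. (exp (- (cmod z)\<^sup>2) / pi) *\<^sub>R z \<partial>lborel)" by simp
  also have "\<dots> = - (\<integral>z. z \<partial>gauss1)"
    by (subst integral_density) auto
  finally show "(\<integral>z. z \<partial>gauss1) = 0" by simp
qed

lemma prob_space_complex_gaussian: "prob_space (complex_gaussian N)"
  unfolding complex_gaussian_def by (rule prob_space_PiM) (rule prob_space_gauss1)

lemma sets_complex_gaussian [simp, measurable_cong]: "sets (complex_gaussian N) = sets (cvec N)"
  unfolding complex_gaussian_def by (intro sets_PiM_cong) simp_all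

lemma complex_gaussian_component_integral:
  fixes f :: "complex \<Rightarrow> 'b::{real_normed_field, banach, second_countable_topology}"
  assumes "p < N" "integrable gauss1 f"
  shows "integrable (complex_gaussian N) (\<lambda>z. f (z p))"
    and "(\<integral>z. f (z p) \<partial>complex_gaussian N) = (\<integral>z. f z \<partial>gauss1)"
proof -
  interpret product_prob_space "\<lambda>_. gauss1" "{..<N}"
    by (intro product_prob_spaceI prob_space_gauss1)
  have d: "distr (complex_gaussian N) gauss1 (\<lambda>z. z p) = gauss1"
    unfolding complex_gaussian_def using assms(1) by (intro PiM_component) auto
  have m: "(\<lambda>z. z p) \<in> measurable (complex_gaussian N) gauss1"
    unfolding complex_gaussian_def using assms(1) by (intro measurable_component_singleton) auto
  show "integrable (complex_gaussian N) (\<lambda>z. f (z p))"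
    using assms(2) d m by (metis integrable_distr)
  show "(\<integral>z. f (z p) \<partial>complex_gaussian N) = (\<integral>z. f z \<partial>gauss1)"
    using integral_distr[OF m, of f] assms(2) unfolding d by (auto dest: borel_measurable_integrable)
qed

lemma complex_gaussian_mean:
  assumes "p < N"
  shows "(\<integral>z. z p \<partial>complex_gaussian N) = 0"
  using complex_gaussian_component_integral(2)[OF assms gauss1_mean(1)] gauss1_mean(2) by simp

text \<open>Makes the noise an instance of the interference model, so that one identity for
  quadratic forms serves both.\<close>

lemma complex_gaussian_has_covariance:
  "has_covariance N (complex_gaussian N) (\<lambda>i k. if i = k then 1 else 0)"
proof -
  interpret product_prob_space "\<lambda>_. gauss1" "{..<N}"
    by (intro product_prob_spaceI prob_space_gauss1)
  have diag: "(\<integral>z. z p * cnj (z p) \<partial>complex_gaussian N) = 1" if "p < N" for p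
  proof -
    have i: "integrable gauss1 (\<lambda>z. complex_of_real ((cmod z)\<^sup>2))"
      using gauss1_second_moment(1) by (rule integrable_of_real)
    show ?thesis
      using complex_gaussian_component_integral(2)[OF that i] gauss1_second_moment
      by (simp add: complex_norm_square[symmetric] del: of_real_power)
  qed
  have off: "(\<integral>z. z p * cnj (z q) \<partial>complex_gaussian N) = 0" if "p < N" "q < N" "p \<noteq> q" for p q
  proof -
    \<comment> \<open>Two coordinates are written as a product over all coordinates with factor 1
      elsewhere; independence then factors the integral, and the factor at \<open>p\<close> is a
      mean, hence zero.\<close>
    let ?f = "\<lambda>i z. if i = p then z else if i = q then cnj z else 1 :: complex"
    have int: "integrable gauss1 (?f i)" for i
      using gauss1_mean(1) by (cases "i = p"; cases "i = q") auto
    have "(\<Prod>i<N. ?f i (z i)) = z p * cnj (z q)" for z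
    proof -
      have "(\<Prod>i<N. ?f i (z i)) = (\<Prod>i\<in>{p, q}. ?f i (z i))"
        using that by (intro prod.mono_neutral_right) auto
      then show ?thesis using that by simp
    qed
    then have "(\<integral>z. z p * cnj (z q) \<partial>complex_gaussian N) = (\<Prod>i<N. integral\<^sup>L gauss1 (?f i))"
      unfolding complex_gaussian_def
      using product_integral_prod[of "{..<N}" ?f] int by simp
    also have "\<dots> = 0"
      using that gauss1_mean(2) by (intro prod_zero) (auto intro!: bexI[of _ p])
    finally show ?thesis .
  qed
  show ?thesis
    unfolding has_covariance_def
    using prob_space_complex_gaussian complex_gaussian_component_integral(1)[OF _ gauss1_second_moment(1)]
    by (auto simp: complex_gaussian_mean diag off)
qed

section \<open>Successive decoding of binary inputs\<close>

lemma borel_measurable_cnj [measurable]: "cnj \<in> borel_measurable borel"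
  by (intro borel_measurable_continuous_onI continuous_intros)

lemma has_covariance_integrable:
  assumes cov: "has_covariance N nu S" and "p < N"
  shows "integrable nu (\<lambda>w. w p)"
    and "integrable nu (\<lambda>w. (cmod (w p - (\<integral>v. v p \<partial>nu)))\<^sup>2)"
proof -
  interpret prob_space nu using cov by (simp add: has_covariance_def)
  have [measurable_cong]: "sets nu = sets (cvec N)" using cov by (simp add: has_covariance_def)
  have [measurable]: "(\<lambda>w. w p) \<in> borel_measurable nu" using \<open>p < N\<close> by simp
  have sq: "integrable nu (\<lambda>w. (cmod (w p))\<^sup>2)" using assms by (simp add: has_covariance_def)
  show i: "integrable nu (\<lambda>w. w p)"
  proof (rule Bochner_Integration.integrable_bound)
    show "integrable nu (\<lambda>w. 1 + (cmod (w p))\<^sup>2)" using sq by auto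
    show "AE w in nu. norm (w p) \<le> norm (1 + (cmod (w p))\<^sup>2)"
    proof (rule AE_I2)
      fix w
      have "0 \<le> (cmod (w p) - 1)\<^sup>2" by simp
      then have "2 * cmod (w p) \<le> 1 + (cmod (w p))\<^sup>2" by (simp add: power2_eq_square algebra_simps)
      then show "norm (w p) \<le> norm (1 + (cmod (w p))\<^sup>2)" by (smt (verit) norm_ge_zero real_norm_def)
    qed
  qed simp
  let ?m = "\<integral>v. v p \<partial>nu"
  show "integrable nu (\<lambda>w. (cmod (w p - ?m))\<^sup>2)"
  proof (rule Bochner_Integration.integrable_bound)
    show "integrable nu (\<lambda>w. 2 * (cmod (w p))\<^sup>2 + 2 * (cmod ?m)\<^sup>2)" using sq by auto
    show "AE w in nu. norm ((cmod (w p - ?m))\<^sup>2) \<le> norm (2 * (cmod (w p))\<^sup>2 + 2 * (cmod ?m)\<^sup>2)"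
    proof (rule AE_I2)
      fix w
      have "(cmod (w p - ?m))\<^sup>2 \<le> (cmod (w p) + cmod ?m)\<^sup>2"
        by (intro power_mono norm_triangle_ineq4) auto
      also have "\<dots> \<le> 2 * (cmod (w p))\<^sup>2 + 2 * (cmod ?m)\<^sup>2"
        using zero_le_power2[of "cmod (w p) - cmod ?m"] by (simp add: power2_eq_square algebra_simps)
      finally show "norm ((cmod (w p - ?m))\<^sup>2) \<le> norm (2 * (cmod (w p))\<^sup>2 + 2 * (cmod ?m)\<^sup>2)"
        by simp
    qed
  qed simp
qed

text \<open>Besides giving the variance of a filter output, this shows that the quadratic form of
  \<open>S\<close> is nonnegative without diagonalising \<open>S\<close>.\<close>

lemma covariance_quadratic_form:
  fixes v :: "nat \<Rightarrow> complex"
  assumes cov: "has_covariance N nu S"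
  defines "L \<equiv> \<lambda>w. \<Sum>p<N. cnj (v p) * (w p - (\<integral>u. u p \<partial>nu))"
  shows "integrable nu (\<lambda>w. (cmod (L w))\<^sup>2)"
    and "(\<integral>w. (cmod (L w))\<^sup>2 \<partial>nu) = Re (\<Sum>p<N. \<Sum>q<N. cnj (v p) * S p q * v q)"
proof -
  interpret prob_space nu using cov by (simp add: has_covariance_def)
  have sets_nu[measurable_cong]: "sets nu = sets (cvec N)" using cov by (simp add: has_covariance_def)
  define d where "d p w = w p - (\<integral>u. u p \<partial>nu)" for p and w :: "nat \<Rightarrow> complex"
  have [measurable]: "d p \<in> borel_measurable nu" if "p < N" for p
    unfolding d_def using that by simp
  have int: "integrable nu (\<lambda>w. d p w * cnj (d q w))" if "p < N" "q < N" for p q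
  proof (rule Bochner_Integration.integrable_bound)
    show "integrable nu (\<lambda>w. (cmod (d p w))\<^sup>2 + (cmod (d q w))\<^sup>2)"
      unfolding d_def using has_covariance_integrable(2)[OF cov] that by auto
    show "AE w in nu. norm (d p w * cnj (d q w)) \<le> norm ((cmod (d p w))\<^sup>2 + (cmod (d q w))\<^sup>2)"
    proof (rule AE_I2)
      fix w
      have "0 \<le> (cmod (d p w) - cmod (d q w))\<^sup>2" by simp
      then have "2 * (cmod (d p w) * cmod (d q w)) \<le> (cmod (d p w))\<^sup>2 + (cmod (d q w))\<^sup>2"
        by (simp add: power2_eq_square algebra_simps)
      moreover have "0 \<le> cmod (d p w) * cmod (d q w)" by simp
      ultimately have "cmod (d p w) * cmod (d q w) \<le> (cmod (d p w))\<^sup>2 + (cmod (d q w))\<^sup>2"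
        by linarith
      then show "norm (d p w * cnj (d q w)) \<le> norm ((cmod (d p w))\<^sup>2 + (cmod (d q w))\<^sup>2)"
        by (simp add: norm_mult)
    qed
  qed (use that in \<open>auto intro!: borel_measurable_times measurable_compose[OF _ borel_measurable_cnj]\<close>)
  have S: "(\<integral>w. d p w * cnj (d q w) \<partial>nu) = S p q" if "p < N" "q < N" for p q
    using cov that by (simp add: has_covariance_def d_def)
  have sq: "complex_of_real ((cmod (L w))\<^sup>2) =
      (\<Sum>p<N. \<Sum>q<N. cnj (v p) * (d p w * cnj (d q w)) * v q)" for w
    unfolding complex_norm_square L_def d_def[symmetric] cnj_sum sum_product
    by (intro sum.cong) (simp_all add: mult_ac)
  have i: "integrable nu (\<lambda>w. cnj (v p) * (d p w * cnj (d q w)) * v q)" if "p < N" "q < N" for p q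
    using int[OF that] by (intro integrable_mult_left integrable_mult_right)
  have iall: "integrable nu (\<lambda>w. complex_of_real ((cmod (L w))\<^sup>2))"
    unfolding sq by (intro Bochner_Integration.integrable_sum i) auto
  from integrable_Re[OF iall] show "integrable nu (\<lambda>w. (cmod (L w))\<^sup>2)" by simp
  have "(\<integral>w. complex_of_real ((cmod (L w))\<^sup>2) \<partial>nu) = (\<Sum>p<N. \<Sum>q<N. cnj (v p) * S p q * v q)"
  proof -
    have "(\<integral>w. complex_of_real ((cmod (L w))\<^sup>2) \<partial>nu) =
        (\<Sum>p<N. \<integral>w. (\<Sum>q<N. cnj (v p) * (d p w * cnj (d q w)) * v q) \<partial>nu)"
      unfolding sq by (intro Bochner_Integration.integral_sum Bochner_Integration.integrable_sum i) auto
    also have "\<dots> = (\<Sum>p<N. \<Sum>q<N. \<integral>w. cnj (v p) * (d p w * cnj (d q w)) * v q \<partial>nu)"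
      by (intro sum.cong refl Bochner_Integration.integral_sum i) auto
    also have "\<dots> = (\<Sum>p<N. \<Sum>q<N. cnj (v p) * S p q * v q)"
      by (intro sum.cong refl) (simp add: S)
    finally show ?thesis .
  qed
  then show "(\<integral>w. (cmod (L w))\<^sup>2 \<partial>nu) = Re (\<Sum>p<N. \<Sum>q<N. cnj (v p) * S p q * v q)"
    unfolding integral_complex_of_real by (metis Re_complex_of_real)
qed

text \<open>Interference and noise are separated by (a + b)^2 \<le> 2 a^2 + 2 b^2, the source of
  both factors 2. The mean of the interference is subtracted because its law need not be
  centred.\<close>

lemma interference_plus_noise_second_moment:
  fixes v :: "nat \<Rightarrow> complex"
  assumes cov: "has_covariance N nu S"
  defines "c \<equiv> \<lambda>(w, z). Re (\<Sum>p<N. cnj (v p) * (w p + z p - (\<integral>u. u p \<partial>nu)))"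
  shows "c \<in> borel_measurable (nu \<Otimes>\<^sub>M complex_gaussian N)"
    and "integrable (nu \<Otimes>\<^sub>M complex_gaussian N) (\<lambda>x. (c x)\<^sup>2)"
    and "(\<integral>x. (c x)\<^sup>2 \<partial>(nu \<Otimes>\<^sub>M complex_gaussian N)) \<le>
      2 * Re (\<Sum>p<N. \<Sum>q<N. cnj (v p) * S p q * v q) + 2 * (\<Sum>p<N. (cmod (v p))\<^sup>2)"
proof -
  let ?G = "complex_gaussian N"
  interpret nu: prob_space nu using cov by (simp add: has_covariance_def)
  interpret G: prob_space ?G by (rule prob_space_complex_gaussian)
  interpret pair_prob_space nu ?G ..
  have [measurable_cong]: "sets nu = sets (cvec N)" using cov by (simp add: has_covariance_def)
  define A where "A w = (cmod (\<Sum>p<N. cnj (v p) * (w p - (\<integral>u. u p \<partial>nu))))\<^sup>2" for w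
  define B where "B z = (cmod (\<Sum>p<N. cnj (v p) * (z p - (\<integral>u. u p \<partial>?G))))\<^sup>2" for z
  have le: "(c x)\<^sup>2 \<le> 2 * A (fst x) + 2 * B (snd x)" for x
  proof -
    let ?a = "\<Sum>p<N. cnj (v p) * (fst x p - (\<integral>u. u p \<partial>nu))"
    let ?b = "\<Sum>p<N. cnj (v p) * (snd x p - (\<integral>u. u p \<partial>?G))"
    have "c x = Re ?a + Re ?b"
      by (simp add: c_def case_prod_unfold complex_gaussian_mean sum.distrib[symmetric] algebra_simps)
    then have "(c x)\<^sup>2 = (Re ?a + Re ?b)\<^sup>2" by simp
    also have "\<dots> \<le> 2 * (Re ?a)\<^sup>2 + 2 * (Re ?b)\<^sup>2"
      using zero_le_power2[of "Re ?a - Re ?b"] by (simp add: power2_eq_square algebra_simps)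
    also have "\<dots> \<le> 2 * A (fst x) + 2 * B (snd x)"
      unfolding A_def B_def by (simp add: cmod_power2)
    finally show ?thesis .
  qed
  have iA: "integrable nu A" and eA: "(\<integral>w. A w \<partial>nu) = Re (\<Sum>p<N. \<Sum>q<N. cnj (v p) * S p q * v q)"
    unfolding A_def using covariance_quadratic_form[OF cov] by auto
  have iB: "integrable ?G B" and eB: "(\<integral>w. B w \<partial>?G) = (\<Sum>p<N. (cmod (v p))\<^sup>2)"
  proof -
    show "integrable ?G B"
      unfolding B_def by (rule covariance_quadratic_form[OF complex_gaussian_has_covariance])
    have "(\<integral>w. B w \<partial>?G) = Re (\<Sum>p<N. \<Sum>q<N. cnj (v p) * (if p = q then 1 else 0) * v q)"
      unfolding B_def by (rule covariance_quadratic_form[OF complex_gaussian_has_covariance])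
    also have "(\<Sum>p<N. \<Sum>q<N. cnj (v p) * (if p = q then 1 else 0) * v q) = (\<Sum>p<N. of_real ((cmod (v p))\<^sup>2))"
    proof (intro sum.cong refl)
      fix p assume "p \<in> {..<N}"
      then have "(\<Sum>q<N. cnj (v p) * (if p = q then 1 else 0) * v q) = cnj (v p) * v p"
        by (subst sum.remove[of _ p]) auto
      then show "(\<Sum>q<N. cnj (v p) * (if p = q then 1 else 0) * v q) = of_real ((cmod (v p))\<^sup>2)"
        by (simp only: complex_norm_square mult.commute)
    qed
    finally show "(\<integral>w. B w \<partial>?G) = (\<Sum>p<N. (cmod (v p))\<^sup>2)" by simp
  qed
  have d1: "distr (nu \<Otimes>\<^sub>M ?G) nu fst = nu" by (rule G.distr_pair_fst)
  have d2: "distr (nu \<Otimes>\<^sub>M ?G) ?G snd = ?G"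
  proof -
    have "distr (nu \<Otimes>\<^sub>M ?G) ?G snd = distr (distr (?G \<Otimes>\<^sub>M nu) (nu \<Otimes>\<^sub>M ?G) (\<lambda>(x, y). (y, x))) ?G snd"
      by (subst distr_pair_swap) simp
    also have "\<dots> = distr (?G \<Otimes>\<^sub>M nu) ?G fst"
      by (subst distr_distr) (auto simp: comp_def case_prod_unfold)
    finally show ?thesis using nu.distr_pair_fst[of ?G] by simp
  qed
  have mA[measurable]: "A \<in> borel_measurable nu" and mB[measurable]: "B \<in> borel_measurable ?G"
    using iA iB by auto
  have iA': "integrable (nu \<Otimes>\<^sub>M ?G) (\<lambda>x. A (fst x))"
    using integrable_distr[of fst "nu \<Otimes>\<^sub>M ?G" nu A] iA d1 by simp
  have iB': "integrable (nu \<Otimes>\<^sub>M ?G) (\<lambda>x. B (snd x))"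
    using integrable_distr[of snd "nu \<Otimes>\<^sub>M ?G" ?G B] iB d2 by simp
  have eA': "(\<integral>x. A (fst x) \<partial>(nu \<Otimes>\<^sub>M ?G)) = (\<integral>w. A w \<partial>nu)"
    using integral_distr[of fst "nu \<Otimes>\<^sub>M ?G" nu A] d1 by simp
  have eB': "(\<integral>x. B (snd x) \<partial>(nu \<Otimes>\<^sub>M ?G)) = (\<integral>w. B w \<partial>?G)"
    using integral_distr[of snd "nu \<Otimes>\<^sub>M ?G" ?G B] d2 by simp
  show mc: "c \<in> borel_measurable (nu \<Otimes>\<^sub>M ?G)" unfolding c_def by measurable
  show ic: "integrable (nu \<Otimes>\<^sub>M ?G) (\<lambda>x. (c x)\<^sup>2)"
  proof (rule Bochner_Integration.integrable_bound)
    show "integrable (nu \<Otimes>\<^sub>M ?G) (\<lambda>x. 2 * A (fst x) + 2 * B (snd x))" using iA' iB' by auto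
    show "AE x in nu \<Otimes>\<^sub>M ?G. norm ((c x)\<^sup>2) \<le> norm (2 * A (fst x) + 2 * B (snd x))"
    proof (rule AE_I2)
      fix x show "norm ((c x)\<^sup>2) \<le> norm (2 * A (fst x) + 2 * B (snd x))"
        using le[of x] zero_le_power2[of "c x"] unfolding real_norm_def by linarith
    qed
  qed (use mc in measurable)
  have "(\<integral>x. (c x)\<^sup>2 \<partial>(nu \<Otimes>\<^sub>M ?G)) \<le> (\<integral>x. 2 * A (fst x) + 2 * B (snd x) \<partial>(nu \<Otimes>\<^sub>M ?G))"
    using ic iA' iB' le by (intro integral_mono) auto
  also have "\<dots> = 2 * (\<integral>w. A w \<partial>nu) + 2 * (\<integral>w. B w \<partial>?G)"
    using iA' iB' by (simp add: eA' eB')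
  finally show "(\<integral>x. (c x)\<^sup>2 \<partial>(nu \<Otimes>\<^sub>M ?G)) \<le>
      2 * Re (\<Sum>p<N. \<Sum>q<N. cnj (v p) * S p q * v q) + 2 * (\<Sum>p<N. (cmod (v p))\<^sup>2)"
    unfolding eA eB .
qed

text \<open>
  Successive interference cancellation: the signs are decoded in increasing order, the decoder of
  the \<open>j\<close>-th sign seeing only the contributions of the signs \<open>i \<ge> j\<close> through the filter \<open>v j\<close>.
  The dominance hypothesis makes the transmitted vector determine the signs.
\<close>

lemma channel_information_binary_ge:
  fixes g v H :: "nat \<Rightarrow> nat \<Rightarrow> complex" and J :: nat
  assumes cov: "has_covariance N nu S"
  defines "\<alpha> \<equiv> \<lambda>j i. Re (\<Sum>p<N. cnj (v j p) * (\<Sum>k<N. H p k * g i k))"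
    and "\<sigma>2 \<equiv> \<lambda>j. 2 * Re (\<Sum>p<N. \<Sum>q<N. cnj (v j p) * S p q * v j q) + 2 * (\<Sum>p<N. (cmod (v j p))\<^sup>2)"
    and "mu \<equiv> distr (measure_pmf (pmf_of_set (signs J))) (cvec N)
      (\<lambda>s. \<lambda>p\<in>{..<N}. \<Sum>j<J. of_real (s j) * g j p)"
  assumes dom: "\<And>j. j < J \<Longrightarrow> (\<Sum>i\<in>{j<..<J}. \<bar>\<alpha> j i\<bar>) < \<alpha> j j"
  shows "(\<Sum>j<J. (\<alpha> j j)\<^sup>2 / ((\<Sum>i\<in>{j..<J}. (\<alpha> j i)\<^sup>2) + \<sigma>2 j)) / (12 * ln 2)
    \<le> channel_information N H nu mu"
proof -
  let ?G = "complex_gaussian N"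
  define M2 where "M2 = nu \<Otimes>\<^sub>M ?G"
  define enc where "enc s = (\<lambda>p\<in>{..<N}. \<Sum>j<J. of_real (s j) * g j p)" for s :: "nat \<Rightarrow> real"
  interpret nu: prob_space nu using cov by (simp add: has_covariance_def)
  interpret G: prob_space ?G by (rule prob_space_complex_gaussian)
  interpret M2: pair_prob_space nu ?G ..
  have prob_M2: "prob_space M2" unfolding M2_def by (rule M2.prob_space_axioms)
  interpret M2': prob_space M2 by (rule prob_M2)
  have sets_nu[measurable_cong]: "sets nu = sets (cvec N)" using cov by (simp add: has_covariance_def)
  have sets_M2[measurable_cong]: "sets M2 = sets (cvec N \<Otimes>\<^sub>M cvec N)"
    unfolding M2_def by (intro sets_pair_measure_cong) (simp_all add: sets_nu)
  define m where "m p = (\<integral>u. u p \<partial>nu)" for p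
  define Y where "Y = (\<lambda>(x, w, z). channel_output N H x w z)"
  have mY[measurable]: "Y \<in> measurable (cvec N \<Otimes>\<^sub>M M2) (cvec N)"
    unfolding Y_def channel_output_def by measurable
  define c where "c j = (\<lambda>(w, z). Re (\<Sum>p<N. cnj (v j p) * (w p + z p - m p)))" for j
  have mc[measurable]: "c j \<in> borel_measurable M2"
    and ic2: "integrable M2 (\<lambda>x. (c j x)\<^sup>2)"
    and ec: "(\<integral>x. (c j x)\<^sup>2 \<partial>M2) \<le> \<sigma>2 j" for j
    using interference_plus_noise_second_moment[OF cov, of "v j"]
    unfolding c_def M2_def m_def \<sigma>2_def by auto
  have ic: "integrable M2 (c j)" for j
  proof (rule Bochner_Integration.integrable_bound)
    show "integrable M2 (\<lambda>x. 1 + (c j x)\<^sup>2)" using ic2 by auto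
    show "AE x in M2. norm (c j x) \<le> norm (1 + (c j x)\<^sup>2)"
    proof (rule AE_I2)
      fix x
      have "0 \<le> (\<bar>c j x\<bar> - 1)\<^sup>2" by simp
      then have "2 * \<bar>c j x\<bar> \<le> 1 + (c j x)\<^sup>2" by (simp add: power2_eq_square algebra_simps)
      then show "norm (c j x) \<le> norm (1 + (c j x)\<^sup>2)" by (smt (verit) real_norm_def)
    qed
  qed simp
  have \<alpha>_pos: "0 < \<alpha> j j" if "j < J" for j
    by (rule order.strict_trans1[OF sum_nonneg dom[OF that]]) simp
  \<comment> \<open>Row \<open>j\<close> restricted to the signs that are not yet decoded. Padding
    it with zeros lets the orthogonality of all \<open>J\<close> signs be applied unchanged.\<close>
  define a where "a j i = (if j \<le> i then \<alpha> j i else 0)" for j i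
  have suma: "(\<Sum>i<J. h i * a j i) = (\<Sum>i\<in>{j..<J}. h i * \<alpha> j i)" for h :: "nat \<Rightarrow> real" and j
    unfolding a_def by (rule sum.mono_neutral_cong_right) auto
  have suma2: "(\<Sum>i<J. (a j i)\<^sup>2) = (\<Sum>i\<in>{j..<J}. (\<alpha> j i)\<^sup>2)" for j
    unfolding a_def by (rule sum.mono_neutral_cong_right) auto
  define Q where "Q j = (\<Sum>i\<in>{j..<J}. (\<alpha> j i)\<^sup>2) + \<sigma>2 j" for j
  have Q_pos: "0 < Q j" if "j < J" for j
  proof -
    have "0 \<le> (\<integral>x. (c j x)\<^sup>2 \<partial>M2)" by simp
    then have "0 \<le> \<sigma>2 j" using ec[of j] by linarith
    moreover have "(\<alpha> j j)\<^sup>2 \<le> (\<Sum>i\<in>{j..<J}. (\<alpha> j i)\<^sup>2)"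
      using that by (intro member_le_sum) auto
    moreover have "0 < (\<alpha> j j)\<^sup>2" using \<alpha>_pos[OF that] by simp
    ultimately show ?thesis unfolding Q_def by linarith
  qed
  \<comment> \<open>This value maximises \<eta> \<alpha> - 3 \<eta>^2 Q; the maximum \<alpha>^2 /
    (12 Q) explains the 12 in the conclusion.\<close>
  define \<eta> where "\<eta> j = \<alpha> j j / (6 * Q j)" for j
  \<comment> \<open>The filter output after removing the mean interference and the contributions of
    the decoded signs. It depends on \<open>s\<close> only through indices below \<open>j\<close>,
    as predictability demands.\<close>
  define V where "V j s y = Re (\<Sum>p<N. cnj (v j p) * (y p - m p)) - (\<Sum>i<j. s i * \<alpha> j i)"
    for j and s :: "nat \<Rightarrow> real" and y
  define T where "T j s y = (\<eta> j * V j s y) / (1 + 4 * (\<eta> j * V j s y)\<^sup>2)"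
    for j and s :: "nat \<Rightarrow> real" and y
  define F where "F s y = (\<Prod>j<J. 1 + s j * T j s y)" for s y
  have mF[measurable]: "F s \<in> borel_measurable (cvec N)" for s
    unfolding F_def T_def V_def by measurable
  have sign: "s j \<in> {-1, 1}" if "s \<in> signs J" "j < J" for s j
    using that by (auto simp: signs_def PiE_iff)
  have T4: "\<bar>s j * T j s y\<bar> \<le> 1 / 4" if "s \<in> signs J" "j < J" for s j y
    using ln_one_plus_damped_ge(1)[OF sign[OF that]] unfolding T_def .
  have F_bounds: "(3 / 4) ^ J \<le> F s y" "F s y \<le> (5 / 4) ^ J" if "s \<in> signs J" for s y
  proof -
    have "(\<Prod>j<J. 3 / 4) \<le> F s y" "F s y \<le> (\<Prod>j<J. 5 / 4)"
      unfolding F_def using T4[OF that, of _ y] by (intro prod_mono; force simp: abs_le_iff)+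
    then show "(3 / 4) ^ J \<le> F s y" "F s y \<le> (5 / 4) ^ J" by simp_all
  qed
  have F_sum: "(\<Sum>s\<in>signs J. F s y) = 2 ^ J" for y
    unfolding F_def
    by (rule sum_signs_prod_predictable) (auto simp: T_def V_def intro!: arg_cong2[where f="(-)"] sum.cong)
  have filter_enc: "Re (\<Sum>p<N. cnj (v j p) * (\<Sum>k<N. H p k * enc s k)) = (\<Sum>i<J. s i * \<alpha> j i)" for j s
  proof -
    have "(\<Sum>p<N. cnj (v j p) * (\<Sum>k<N. H p k * enc s k)) =
        (\<Sum>p<N. \<Sum>i<J. of_real (s i) * (cnj (v j p) * (\<Sum>k<N. H p k * g i k)))"
    proof (intro sum.cong refl)
      fix p
      have "(\<Sum>k<N. H p k * enc s k) = (\<Sum>k<N. \<Sum>i<J. of_real (s i) * (H p k * g i k))"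
        by (intro sum.cong) (auto simp: enc_def sum_distrib_left mult_ac)
      also have "\<dots> = (\<Sum>i<J. of_real (s i) * (\<Sum>k<N. H p k * g i k))"
        by (subst sum.swap) (simp add: sum_distrib_left)
      finally show "cnj (v j p) * (\<Sum>k<N. H p k * enc s k) =
          (\<Sum>i<J. of_real (s i) * (cnj (v j p) * (\<Sum>k<N. H p k * g i k)))"
        by (simp add: sum_distrib_left mult_ac)
    qed
    also have "\<dots> = (\<Sum>i<J. of_real (s i) * (\<Sum>p<N. cnj (v j p) * (\<Sum>k<N. H p k * g i k)))"
      by (subst sum.swap) (simp add: sum_distrib_left)
    finally show ?thesis by (simp add: \<alpha>_def)
  qed
  \<comment> \<open>The decoder's ratio has to be a function of the transmitted vector, so distinct
    signs must give distinct codewords. Once all earlier signs agree, dominance in row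
    \<open>j\<close> forces the difference at \<open>j\<close> below 2, while distinct signs differ
    by exactly 2.\<close>
  have inj: "inj_on enc (signs J)"
  proof (rule inj_onI)
    fix s s' assume s: "s \<in> signs J" "s' \<in> signs J" and eq: "enc s = enc s'"
    have zero: "(\<Sum>i<J. (s i - s' i) * \<alpha> j i) = 0" for j
      using filter_enc[of j s] filter_enc[of j s'] eq by (simp add: sum_subtractf left_diff_distrib)
    have "s j = s' j" if "j < J" for j
      using that
    proof (induction j rule: less_induct)
      case (less j)
      have "(\<Sum>i<J. (s i - s' i) * \<alpha> j i) = (\<Sum>i\<in>{j..<J}. (s i - s' i) * \<alpha> j i)"
        using less by (intro sum.mono_neutral_right) auto
      also have "{j..<J} = insert j {j<..<J}" using less.prems by auto
      also have "(\<Sum>i\<in>insert j {j<..<J}. (s i - s' i) * \<alpha> j i) =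
          (s j - s' j) * \<alpha> j j + (\<Sum>i\<in>{j<..<J}. (s i - s' i) * \<alpha> j i)" by simp
      finally have "(s j - s' j) * \<alpha> j j = - (\<Sum>i\<in>{j<..<J}. (s i - s' i) * \<alpha> j i)"
        using zero[of j] by simp
      then have "\<bar>s j - s' j\<bar> * \<alpha> j j = \<bar>\<Sum>i\<in>{j<..<J}. (s i - s' i) * \<alpha> j i\<bar>"
        using \<alpha>_pos[OF less.prems] by (metis abs_minus abs_mult abs_of_pos)
      also have "\<dots> \<le> (\<Sum>i\<in>{j<..<J}. 2 * \<bar>\<alpha> j i\<bar>)"
      proof (rule order_trans[OF sum_abs], rule sum_mono)
        fix i assume "i \<in> {j<..<J}"
        then have "\<bar>s i - s' i\<bar> \<le> 2" using sign[OF s(1), of i] sign[OF s(2), of i] by auto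
        then show "\<bar>(s i - s' i) * \<alpha> j i\<bar> \<le> 2 * \<bar>\<alpha> j i\<bar>"
          by (simp add: abs_mult mult_right_mono)
      qed
      also have "\<dots> < 2 * \<alpha> j j"
        using dom[OF less.prems] by (simp add: sum_distrib_left[symmetric])
      finally have "\<bar>s j - s' j\<bar> < 2" using \<alpha>_pos[OF less.prems] by simp
      then show ?case using sign[OF s(1) less.prems] sign[OF s(2) less.prems] by auto
    qed
    then show "s = s'"
      using s unfolding signs_def by (intro PiE_ext[of s _ _ s']) auto
  qed
  have enc_space: "enc s \<in> space (cvec N)" for s
    by (auto simp: enc_def space_PiM)
  have sing[measurable]: "{enc s} \<in> sets (cvec N)" for s
  proof -
    have "PiE {..<N} (\<lambda>p. {enc s p}) \<in> sets (cvec N)"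
      by (intro sets_PiM_I_finite) auto
    moreover have "enc s \<in> extensional {..<N}" by (simp add: enc_def)
    ultimately show ?thesis by (simp add: PiE_singleton)
  qed
  \<comment> \<open>The value 1 off the codewords lies between the two bounds proved below; the
    input law has no mass there.\<close>
  define f where "f z = (if fst z \<in> enc ` signs J
    then (\<Sum>s\<in>signs J. indicator {enc s} (fst z) * F s (snd z)) else 1)" for z
  have f_enc: "f (enc s, y) = F s y" if "s \<in> signs J" for s y
  proof -
    have "f (enc s, y) = (\<Sum>s'\<in>signs J. indicator {enc s'} (enc s) * F s' y)"
      using that by (simp add: f_def)
    also have "\<dots> = (\<Sum>s'\<in>{s}. F s' y)"
      using that inj by (intro sum.mono_neutral_cong_right) (auto simp: inj_on_eq_iff indicator_def)
    finally show ?thesis by simp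
  qed
  have mf[measurable]: "f \<in> borel_measurable (cvec N \<Otimes>\<^sub>M cvec N)"
  proof -
    have [measurable]: "enc ` signs J \<in> sets (cvec N)"
      by (subst UNION_singleton_eq_range[symmetric], intro sets.finite_UN) auto
    show ?thesis unfolding f_def by measurable
  qed
  have f_bounds: "(3 / 4) ^ J \<le> f z" "f z \<le> (5 / 4) ^ J" for z
  proof -
    have "(3 / 4 :: real) ^ J \<le> 1" "1 \<le> (5 / 4 :: real) ^ J" by (simp_all add: power_le_one)
    moreover have "\<exists>s\<in>signs J. f z = F s (snd z)" if "fst z \<in> enc ` signs J"
      using that f_enc[of _ "snd z"] by (metis imageE prod.collapse)
    ultimately show "(3 / 4) ^ J \<le> f z" "f z \<le> (5 / 4) ^ J"
      using F_bounds by (cases "fst z \<in> enc ` signs J"; fastforce simp: f_def)+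
  qed
  have V_Y: "V j s (Y (enc s, x)) = (\<Sum>i<J. s i * a j i) + c j x" if "j < J" for j s x
  proof -
    obtain w z where x: "x = (w, z)" by (cases x)
    have "(\<Sum>p<N. cnj (v j p) * (Y (enc s, x) p - m p)) =
        (\<Sum>p<N. cnj (v j p) * (\<Sum>k<N. H p k * enc s k)) + (\<Sum>p<N. cnj (v j p) * (w p + z p - m p))"
      unfolding sum.distrib[symmetric]
      by (intro sum.cong) (auto simp: Y_def x channel_output_def algebra_simps)
    then have "V j s (Y (enc s, x)) = (\<Sum>i<J. s i * \<alpha> j i) + c j x - (\<Sum>i<j. s i * \<alpha> j i)"
      by (simp only: V_def filter_enc[symmetric] c_def x plus_complex.sel case_prod_conv)
    moreover have "(\<Sum>i<J. s i * \<alpha> j i) = (\<Sum>i<j. s i * \<alpha> j i) + (\<Sum>i\<in>{j..<J}. s i * \<alpha> j i)"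
    proof -
      have "{..<J} = {..<j} \<union> {j..<J}" "{..<j} \<inter> {j..<J} = {}" using that by auto
      then show ?thesis by (metis finite_atLeastLessThan finite_lessThan sum.union_disjoint)
    qed
    ultimately show ?thesis by (simp add: suma)
  qed
  define W where "W j s x = (\<Sum>i<J. s i * a j i) + c j x" for j s x
  have intW: "integrable M2 (\<lambda>x. \<eta> j * (s j * W j s x) - 3 * (\<eta> j)\<^sup>2 * (W j s x)\<^sup>2)" for j s
    unfolding W_def power2_sum using ic ic2 by (auto intro!: Bochner_Integration.integrable_add Bochner_Integration.integrable_diff)
  have F_lower: "(\<Sum>j<J. \<eta> j * (s j * W j s x) - 3 * (\<eta> j)\<^sup>2 * (W j s x)\<^sup>2) / ln 2
      \<le> log 2 (f (enc s, Y (enc s, x)))" if "s \<in> signs J" for s x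
  proof -
    let ?y = "Y (enc s, x)"
    have "(\<Sum>j<J. \<eta> j * (s j * W j s x) - 3 * (\<eta> j)\<^sup>2 * (W j s x)\<^sup>2) \<le> (\<Sum>j<J. ln (1 + s j * T j s ?y))"
    proof (rule sum_mono)
      fix j assume "j \<in> {..<J}"
      then have j: "j < J" by simp
      show "\<eta> j * (s j * W j s x) - 3 * (\<eta> j)\<^sup>2 * (W j s x)\<^sup>2 \<le> ln (1 + s j * T j s ?y)"
        using ln_one_plus_damped_ge(2)[OF sign[OF that j], of "\<eta> j * V j s ?y"]
        unfolding T_def V_Y[OF j] W_def[symmetric] by (simp add: power_mult_distrib mult_ac)
    qed
    also have "\<dots> = ln (F s ?y)"
      unfolding F_def
    proof (rule ln_prod[symmetric])
      fix j assume "j \<in> {..<J}"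
      then show "1 + s j * T j s ?y \<noteq> 0" using T4[OF that, of j ?y] by auto
    qed auto
    finally show ?thesis
      using f_enc[OF that] by (simp add: log_def divide_right_mono)
  qed
  have int_log: "integrable M2 (\<lambda>x. log 2 (f (enc s, Y (enc s, x))))" for s
  proof (rule M2'.integrable_const_bound[where B="max \<bar>log 2 ((3 / 4) ^ J)\<bar> \<bar>log 2 ((5 / 4) ^ J)\<bar>"])
    have [measurable]: "enc s \<in> space (cvec N)" by (rule enc_space)
    show "(\<lambda>x. log 2 (f (enc s, Y (enc s, x)))) \<in> borel_measurable M2" by measurable
    show "AE x in M2. norm (log 2 (f (enc s, Y (enc s, x)))) \<le>
        max \<bar>log 2 ((3 / 4) ^ J)\<bar> \<bar>log 2 ((5 / 4) ^ J)\<bar>"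
    proof (rule AE_I2)
      fix x
      let ?u = "f (enc s, Y (enc s, x))"
      have "0 < (3 / 4 :: real) ^ J" by simp
      moreover then have "0 < ?u" using f_bounds(1) less_le_trans by blast
      ultimately have "log 2 ((3 / 4) ^ J) \<le> log 2 ?u" "log 2 ?u \<le> log 2 ((5 / 4) ^ J)"
        using f_bounds[of "(enc s, Y (enc s, x))"] by auto
      then show "norm (log 2 ?u) \<le> max \<bar>log 2 ((3 / 4) ^ J)\<bar> \<bar>log 2 ((5 / 4) ^ J)\<bar>"
        unfolding real_norm_def by linarith
    qed
  qed
  \<comment> \<open>Orthogonality of the signs, for fixed interference and noise: the linear term
    retains the coefficient of \<open>s j\<close>, and the quadratic term retains the
    squares.\<close>
  have avg: "(\<Sum>s\<in>signs J. (\<Sum>j<J. \<eta> j * (s j * W j s x) - 3 * (\<eta> j)\<^sup>2 * (W j s x)\<^sup>2)) =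
      2 ^ J * (\<Sum>j<J. \<eta> j * \<alpha> j j - 3 * (\<eta> j)\<^sup>2 * ((\<Sum>i\<in>{j..<J}. (\<alpha> j i)\<^sup>2) + (c j x)\<^sup>2))" for x
  proof -
    have "(\<Sum>s\<in>signs J. \<eta> j * (s j * W j s x) - 3 * (\<eta> j)\<^sup>2 * (W j s x)\<^sup>2) =
      2 ^ J * (\<eta> j * \<alpha> j j - 3 * (\<eta> j)\<^sup>2 * ((\<Sum>i\<in>{j..<J}. (\<alpha> j i)\<^sup>2) + (c j x)\<^sup>2))" if "j < J" for j
    proof -
      have "(\<Sum>s\<in>signs J. s j * W j s x) = 2 ^ J * \<alpha> j j"
        unfolding W_def using sum_signs_linear[OF that, of "a j"] by (simp add: a_def)
      moreover have "(\<Sum>s\<in>signs J. (W j s x)\<^sup>2) = 2 ^ J * ((\<Sum>i\<in>{j..<J}. (\<alpha> j i)\<^sup>2) + (c j x)\<^sup>2)"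
        unfolding W_def sum_signs_square suma2 ..
      ultimately show ?thesis
        by (simp only: sum_subtractf sum_distrib_left[symmetric]) (simp add: algebra_simps)
    qed
    then show ?thesis by (subst sum.swap) (simp add: sum_distrib_left)
  qed
  have "(\<Sum>j<J. (\<alpha> j j)\<^sup>2 / Q j) / (12 * ln 2) = (\<Sum>j<J. (\<alpha> j j)\<^sup>2 / (12 * Q j)) / ln 2"
    by (simp add: sum_divide_distrib mult_ac)
  also have "\<dots> \<le> (\<Sum>j<J. \<eta> j * \<alpha> j j - 3 * (\<eta> j)\<^sup>2 *
      ((\<Sum>i\<in>{j..<J}. (\<alpha> j i)\<^sup>2) + (\<integral>x. (c j x)\<^sup>2 \<partial>M2))) / ln 2"
  proof (intro divide_right_mono sum_mono)
    fix j assume "j \<in> {..<J}"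
    then have q: "0 < Q j" using Q_pos by simp
    have "(\<alpha> j j)\<^sup>2 / (12 * Q j) = \<eta> j * \<alpha> j j - 3 * (\<eta> j)\<^sup>2 * Q j"
      using q by (simp add: \<eta>_def field_simps power2_eq_square)
    also have "\<dots> \<le> \<eta> j * \<alpha> j j - 3 * (\<eta> j)\<^sup>2 * ((\<Sum>i\<in>{j..<J}. (\<alpha> j i)\<^sup>2) + (\<integral>x. (c j x)\<^sup>2 \<partial>M2))"
      using ec[of j] unfolding Q_def by (intro diff_left_mono mult_left_mono) auto
    finally show "(\<alpha> j j)\<^sup>2 / (12 * Q j) \<le>
      \<eta> j * \<alpha> j j - 3 * (\<eta> j)\<^sup>2 * ((\<Sum>i\<in>{j..<J}. (\<alpha> j i)\<^sup>2) + (\<integral>x. (c j x)\<^sup>2 \<partial>M2))" .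
  qed simp
  also have "\<dots> = (\<integral>x. (\<Sum>j<J. \<eta> j * \<alpha> j j - 3 * (\<eta> j)\<^sup>2 *
      ((\<Sum>i\<in>{j..<J}. (\<alpha> j i)\<^sup>2) + (c j x)\<^sup>2)) \<partial>M2) / ln 2"
    using ic2 by (simp add: Bochner_Integration.integral_sum M2'.prob_space)
  also have "\<dots> = (\<integral>x. (\<Sum>s\<in>signs J. (\<Sum>j<J. \<eta> j * (s j * W j s x) - 3 * (\<eta> j)\<^sup>2 * (W j s x)\<^sup>2)) \<partial>M2) / ln 2 / 2 ^ J"
    unfolding avg by simp
  also have "\<dots> = (\<Sum>s\<in>signs J. \<integral>x. (\<Sum>j<J. \<eta> j * (s j * W j s x) - 3 * (\<eta> j)\<^sup>2 * (W j s x)\<^sup>2) / ln 2 \<partial>M2) / 2 ^ J"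
    using intW by (simp add: Bochner_Integration.integral_sum sum_divide_distrib)
  also have "\<dots> \<le> (\<Sum>s\<in>signs J. \<integral>x. log 2 (f (enc s, Y (enc s, x))) \<partial>M2) / 2 ^ J"
    using intW int_log F_lower by (intro divide_right_mono sum_mono integral_mono) auto
  also have "\<dots> \<le> prob_space.mutual_information (mu \<Otimes>\<^sub>M M2) 2 (cvec N) (cvec N) fst Y"
    using mutual_information_finite_input_ge[of "signs J" enc "cvec N" M2 Y "cvec N" f "(3 / 4) ^ J" "(5 / 4) ^ J"]
      enc_space prob_M2 f_bounds f_enc F_sum
    by (simp add: card_signs mu_def enc_def[abs_def])
  also have "\<dots> = channel_information N H nu mu"
    unfolding channel_information_def M2_def Y_def
    by (rule arg_cong2[where f="prob_space.mutual_information _ 2 _ _"]) auto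
  finally show ?thesis unfolding Q_def .
qed

section \<open>Orthogonal streams\<close>

definition hdot :: "nat \<Rightarrow> (nat \<Rightarrow> complex) \<Rightarrow> (nat \<Rightarrow> complex) \<Rightarrow> complex" where
  "hdot N u v = (\<Sum>p<N. cnj (u p) * v p)"

definition sqnorm :: "nat \<Rightarrow> (nat \<Rightarrow> complex) \<Rightarrow> real" where
  "sqnorm N v = (\<Sum>p<N. (cmod (v p))\<^sup>2)"

definition orthonormal :: "nat \<Rightarrow> nat \<Rightarrow> (nat \<Rightarrow> nat \<Rightarrow> complex) \<Rightarrow> bool" where
  "orthonormal N n u \<longleftrightarrow> (\<forall>i<n. \<forall>j<n. hdot N (u i) (u j) = (if i = j then 1 else 0))"

lemma sqnorm_nonneg [simp]: "0 \<le> sqnorm N v"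
  unfolding sqnorm_def by (intro sum_nonneg) auto

lemma hdot_self: "hdot N v v = of_real (sqnorm N v)"
  unfolding hdot_def sqnorm_def of_real_sum complex_norm_square
  by (simp add: mult.commute)

lemma cnj_hdot: "cnj (hdot N u v) = hdot N v u"
  unfolding hdot_def by (simp add: mult.commute)

lemma hdot_cong: "(\<And>p. p < N \<Longrightarrow> u p = u' p) \<Longrightarrow> (\<And>p. p < N \<Longrightarrow> v p = v' p) \<Longrightarrow> hdot N u v = hdot N u' v'"
  unfolding hdot_def by (intro sum.cong) auto

lemma hdot_diff_right: "hdot N u (\<lambda>p. v p - w p) = hdot N u v - hdot N u w"
  unfolding hdot_def by (simp add: right_diff_distrib sum_subtractf)

lemma hdot_scale_right: "hdot N u (\<lambda>p. c * v p) = c * hdot N u v"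
  unfolding hdot_def by (simp add: sum_distrib_left mult_ac)

lemma hdot_scale_left: "hdot N (\<lambda>p. c * u p) v = cnj c * hdot N u v"
  unfolding hdot_def by (simp add: sum_distrib_left mult_ac)

lemma hdot_sum_right: "hdot N u (\<lambda>p. \<Sum>i\<in>I. w i p) = (\<Sum>i\<in>I. hdot N u (w i))"
  unfolding hdot_def by (subst sum.swap) (simp add: sum_distrib_left)

lemma hdot_Cauchy_Schwarz: "(cmod (hdot N u v))\<^sup>2 \<le> sqnorm N u * sqnorm N v"
proof -
  have "cmod (hdot N u v) \<le> (\<Sum>p<N. cmod (u p) * cmod (v p))"
    unfolding hdot_def by (rule order_trans[OF norm_sum]) (simp add: norm_mult)
  then have "(cmod (hdot N u v))\<^sup>2 \<le> (\<Sum>p<N. cmod (u p) * cmod (v p))\<^sup>2"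
    by (intro power_mono) auto
  also have "\<dots> \<le> sqnorm N u * sqnorm N v"
    unfolding sqnorm_def by (rule Cauchy_Schwarz_ineq_sum)
  finally show ?thesis .
qed

definition residual :: "nat \<Rightarrow> nat \<Rightarrow> (nat \<Rightarrow> nat \<Rightarrow> complex) \<Rightarrow> (nat \<Rightarrow> complex) \<Rightarrow> nat \<Rightarrow> complex" where
  "residual N n u v p = v p - (\<Sum>j<n. hdot N (u j) v * u j p)"

lemma hdot_residual:
  assumes "orthonormal N n u" "i < n"
  shows "hdot N (u i) (residual N n u v) = 0"
proof -
  have "hdot N (u i) (residual N n u v) = hdot N (u i) v - (\<Sum>j<n. hdot N (u j) v * hdot N (u i) (u j))"
    unfolding residual_def[abs_def] hdot_diff_right hdot_sum_right hdot_scale_right ..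
  also have "(\<Sum>j<n. hdot N (u j) v * hdot N (u i) (u j)) = (\<Sum>j\<in>{i}. hdot N (u j) v)"
    using assms by (intro sum.mono_neutral_cong_right) (auto simp: orthonormal_def)
  finally show ?thesis by simp
qed

text \<open>Pythagoras: the residual is orthogonal to every \<open>u j\<close>, so its product with
  itself equals its product with \<open>v\<close>.\<close>

lemma sqnorm_residual:
  assumes "orthonormal N n u"
  shows "sqnorm N (residual N n u v) = sqnorm N v - (\<Sum>j<n. (cmod (hdot N (u j) v))\<^sup>2)"
proof -
  let ?r = "residual N n u v"
  have orth: "hdot N ?r (u j) = 0" if "j < n" for j
    using hdot_residual[OF assms that, of v] by (metis cnj_hdot complex_cnj_zero)
  have "hdot N ?r ?r = hdot N ?r v - (\<Sum>j<n. hdot N (u j) v * hdot N ?r (u j))"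
    by (subst (2) residual_def[abs_def]) (simp only: hdot_diff_right hdot_sum_right hdot_scale_right)
  also have "\<dots> = cnj (hdot N v ?r)" by (simp add: orth cnj_hdot)
  also have "hdot N v ?r = hdot N v v - (\<Sum>j<n. hdot N (u j) v * hdot N v (u j))"
    by (subst residual_def[abs_def]) (simp only: hdot_diff_right hdot_sum_right hdot_scale_right)
  also have "\<dots> = of_real (sqnorm N v - (\<Sum>j<n. (cmod (hdot N (u j) v))\<^sup>2))"
    by (simp add: hdot_self complex_norm_square cnj_hdot del: of_real_power)
  finally show ?thesis
    unfolding hdot_self by (simp only: complex_cnj_complex_of_real of_real_eq_iff)
qed

lemma Bessel_inequality:
  assumes "orthonormal N n u"
  shows "(\<Sum>j<n. (cmod (hdot N (u j) v))\<^sup>2) \<le> sqnorm N v"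
  using sqnorm_residual[OF assms, of v] sqnorm_nonneg[of N "residual N n u v"] by linarith

text \<open>By linearity of the projection, signs that are good for the residuals of the columns are
  good for the residual of the signed combination of the columns.\<close>

lemma residual_sum:
  "residual N n u (\<lambda>p. \<Sum>i\<in>I. c i * h i p) = (\<lambda>p. \<Sum>i\<in>I. c i * residual N n u (h i) p)"
proof
  fix p
  have "(\<Sum>j<n. hdot N (u j) (\<lambda>p. \<Sum>i\<in>I. c i * h i p) * u j p) =
      (\<Sum>i\<in>I. c i * (\<Sum>j<n. hdot N (u j) (h i) * u j p))"
    unfolding hdot_sum_right hdot_scale_right sum_distrib_right sum_distrib_left
    by (subst sum.swap) (simp add: mult_ac)
  then show "residual N n u (\<lambda>p. \<Sum>i\<in>I. c i * h i p) p = (\<Sum>i\<in>I. c i * residual N n u (h i) p)"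
    by (simp add: residual_def right_diff_distrib sum_subtractf)
qed

text \<open>Averaging over the sign of each summand kills the cross terms.\<close>

lemma exists_signs_sqnorm_ge:
  fixes w :: "nat \<Rightarrow> nat \<Rightarrow> complex"
  shows "\<exists>e. (\<forall>i. e i \<in> {-1, 1 :: real}) \<and>
    (\<Sum>i<n. sqnorm N (w i)) \<le> sqnorm N (\<lambda>p. \<Sum>i<n. of_real (e i) * w i p)"
proof (induction n)
  case 0
  show ?case by (rule exI[of _ "\<lambda>_. 1"]) simp
next
  case (Suc n)
  then obtain e where e: "\<forall>i. e i \<in> {-1, 1 :: real}"
    and le: "(\<Sum>i<n. sqnorm N (w i)) \<le> sqnorm N (\<lambda>p. \<Sum>i<n. of_real (e i) * w i p)" by blast
  define x where "x p = (\<Sum>i<n. of_real (e i) * w i p)" for p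
  have par: "sqnorm N (\<lambda>p. x p + w n p) + sqnorm N (\<lambda>p. x p - w n p) = 2 * sqnorm N x + 2 * sqnorm N (w n)"
    unfolding sqnorm_def sum.distrib[symmetric] sum_distrib_left
  proof (intro sum.cong refl)
    fix p
    show "(cmod (x p + w n p))\<^sup>2 + (cmod (x p - w n p))\<^sup>2 = 2 * (cmod (x p))\<^sup>2 + 2 * (cmod (w n p))\<^sup>2"
      unfolding cmod_power2 by (simp add: power2_eq_square algebra_simps)
  qed
  have upd: "(\<Sum>i<Suc n. of_real ((e(n := y)) i) * w i p) = x p + of_real y * w n p" for y p
    by (simp add: x_def)
  consider "sqnorm N x + sqnorm N (w n) \<le> sqnorm N (\<lambda>p. x p + w n p)"
    | "sqnorm N x + sqnorm N (w n) \<le> sqnorm N (\<lambda>p. x p - w n p)"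
    using par by linarith
  then obtain y :: real where y: "y \<in> {-1, 1}"
    "sqnorm N x + sqnorm N (w n) \<le> sqnorm N (\<lambda>p. x p + of_real y * w n p)"
  proof cases
    case 1 then show ?thesis by (intro that[of 1]) auto
  next
    case 2 then show ?thesis by (intro that[of "-1"]) auto
  qed
  have "(\<Sum>i<Suc n. sqnorm N (w i)) \<le> sqnorm N x + sqnorm N (w n)"
    using le by (simp add: x_def[abs_def])
  with y(2) have "(\<Sum>i<Suc n. sqnorm N (w i)) \<le> sqnorm N (\<lambda>p. \<Sum>i<Suc n. of_real ((e(n := y)) i) * w i p)"
    unfolding upd by linarith
  then show ?case using e y(1) by (intro exI[of _ "e(n := y)"]) auto
qed

text \<open>
  \<open>tr(P H H\<^sup>*) \<le> \<parallel>P\<parallel> \<parallel>H H\<^sup>*\<parallel>\<close> in Frobenius norm, \<open>P\<close> being the projection onto the span of the \<open>u j\<close>.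
\<close>

lemma projected_energy_le:
  fixes h :: "nat \<Rightarrow> nat \<Rightarrow> complex"
  assumes on: "orthonormal N k u"
  shows "(\<Sum>j<k. \<Sum>i<n. (cmod (hdot N (u j) (h i)))\<^sup>2)\<^sup>2 \<le>
    real k * (\<Sum>p<N. \<Sum>q<N. (cmod (\<Sum>i<n. h i p * cnj (h i q)))\<^sup>2)"
proof -
  define \<Gamma> where "\<Gamma> p q = (\<Sum>i<n. h i p * cnj (h i q))" for p q
  define y where "y j p = (\<Sum>q<N. \<Gamma> p q * u j q)" for j p
  define x where "x j = (\<Sum>i<n. (cmod (hdot N (u j) (h i)))\<^sup>2)" for j
  have x_eq: "of_real (x j) = hdot N (u j) (y j)" for j
  proof -
    have "y j p = (\<Sum>i<n. hdot N (h i) (u j) * h i p)" for p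
      unfolding y_def \<Gamma>_def hdot_def sum_distrib_right
      by (subst sum.swap) (simp add: mult_ac)
    then have "hdot N (u j) (y j) = (\<Sum>i<n. hdot N (h i) (u j) * hdot N (u j) (h i))"
      by (simp only: hdot_sum_right hdot_scale_right flip: fun_eq_iff cong: hdot_cong)
    then show ?thesis
      by (simp add: x_def complex_norm_square cnj_hdot mult.commute del: of_real_power)
  qed
  have x_le: "(x j)\<^sup>2 \<le> sqnorm N (y j)" if "j < k" for j
  proof -
    have "sqnorm N (u j) = 1"
      using on that hdot_self[of N "u j"] by (auto simp: orthonormal_def)
    then have "(cmod (of_real (x j)))\<^sup>2 \<le> sqnorm N (y j)"
      using hdot_Cauchy_Schwarz[of N "u j" "y j"] unfolding x_eq by simp
    then show ?thesis by simp
  qed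
  have "(\<Sum>j<k. x j)\<^sup>2 \<le> real k * (\<Sum>j<k. (x j)\<^sup>2)"
    using Cauchy_Schwarz_ineq_sum[of "\<lambda>_. 1" x "{..<k}"] by simp
  also have "\<dots> \<le> real k * (\<Sum>j<k. sqnorm N (y j))"
    using x_le by (intro mult_left_mono sum_mono) auto
  \<comment> \<open>Exchanging the sums brings the expression into a form where Bessel's inequality
    applies to each row of the Gram matrix.\<close>
  also have "(\<Sum>j<k. sqnorm N (y j)) = (\<Sum>p<N. \<Sum>j<k. (cmod (hdot N (u j) (\<lambda>q. cnj (\<Gamma> p q))))\<^sup>2)"
  proof -
    have "cmod (y j p) = cmod (hdot N (u j) (\<lambda>q. cnj (\<Gamma> p q)))" for j p
    proof -
      have "y j p = cnj (hdot N (u j) (\<lambda>q. cnj (\<Gamma> p q)))"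
        by (simp add: y_def hdot_def mult.commute)
      then show ?thesis by simp
    qed
    then show ?thesis unfolding sqnorm_def by (subst sum.swap) simp
  qed
  also have "\<dots> \<le> (\<Sum>p<N. sqnorm N (\<lambda>q. cnj (\<Gamma> p q)))"
    by (intro sum_mono Bessel_inequality on)
  finally show ?thesis
    by (simp only: sqnorm_def x_def \<Gamma>_def complex_mod_cnj mult_left_mono of_nat_0_le_iff)
qed

text \<open>By \<open>corr\<close>, fewer than \<open>n\<close> orthonormal directions capture at
  most energy \<open>a\<close> out of the available 2 a, so a new sign pattern can always be found
  whose residual has energy \<open>a\<close>. The normalised residual is orthogonal to the images of
  all earlier patterns but not conversely; the resulting triangular structure is what successive
  cancellation can handle.\<close>

lemma exists_orthogonal_streams:
  fixes h :: "nat \<Rightarrow> nat \<Rightarrow> complex"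
  assumes energy: "2 * a \<le> (\<Sum>i<M. sqnorm N (h i))" and "0 < a"
    and corr: "\<And>k. k < n \<Longrightarrow> real k * (\<Sum>p<N. \<Sum>q<N. (cmod (\<Sum>i<M. h i p * cnj (h i q)))\<^sup>2) \<le> a\<^sup>2"
  shows "\<exists>u e. orthonormal N n u \<and> (\<forall>j i. e j i \<in> {-1, 1 :: real}) \<and>
    (\<forall>j<n. sqrt a \<le> Re (hdot N (u j) (\<lambda>p. \<Sum>i<M. of_real (e j i) * h i p))) \<and>
    (\<forall>j<n. \<forall>l<j. hdot N (u j) (\<lambda>p. \<Sum>i<M. of_real (e l i) * h i p) = 0)"
proof -
  let ?t = "\<lambda>e p. \<Sum>i<M. of_real (e i) * h i p"
  \<comment> \<open>The last clause of the invariant, that the images found so far lie in the span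
    of \<open>u\<close>, makes the next direction orthogonal to all of them.\<close>
  have "\<exists>u e. orthonormal N k u \<and> (\<forall>j i. e j i \<in> {-1, 1 :: real}) \<and>
    (\<forall>j<k. sqrt a \<le> Re (hdot N (u j) (?t (e j)))) \<and>
    (\<forall>j<k. \<forall>l<j. hdot N (u j) (?t (e l)) = 0) \<and>
    (\<forall>j<k. \<forall>p<N. ?t (e j) p = (\<Sum>l<k. hdot N (u l) (?t (e j)) * u l p))"
    if "k \<le> n" for k
    using that
  proof (induction k)
    case 0
    show ?case
      by (rule exI[of _ "\<lambda>_ _. 0"], rule exI[of _ "\<lambda>_ _. 1"]) (simp add: orthonormal_def)
  next
    case (Suc k)
    then obtain u e where on: "orthonormal N k u" and e: "\<forall>j i. e j i \<in> {-1, 1 :: real}"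
      and ge: "\<forall>j<k. sqrt a \<le> Re (hdot N (u j) (?t (e j)))"
      and tri: "\<forall>j<k. \<forall>l<j. hdot N (u j) (?t (e l)) = 0"
      and span: "\<forall>j<k. \<forall>p<N. ?t (e j) p = (\<Sum>l<k. hdot N (u l) (?t (e j)) * u l p)"
      by auto
    obtain s where s: "\<forall>i. s i \<in> {-1, 1 :: real}"
      and s_ge: "(\<Sum>i<M. sqnorm N (residual N k u (h i))) \<le>
        sqnorm N (\<lambda>p. \<Sum>i<M. of_real (s i) * residual N k u (h i) p)"
      using exists_signs_sqnorm_ge[where w="\<lambda>i. residual N k u (h i)" and n=M and N=N] by blast
    define r where "r = residual N k u (?t s)"
    have "(\<Sum>j<k. \<Sum>i<M. (cmod (hdot N (u j) (h i)))\<^sup>2)\<^sup>2 \<le> a\<^sup>2"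
      using projected_energy_le[OF on, of h M] corr[of k] Suc.prems by simp
    then have "(\<Sum>j<k. \<Sum>i<M. (cmod (hdot N (u j) (h i)))\<^sup>2) \<le> a"
      using \<open>0 < a\<close> by (simp add: power2_le_iff_abs_le)
    then have "a \<le> (\<Sum>i<M. sqnorm N (residual N k u (h i)))"
      using energy unfolding sqnorm_residual[OF on] sum_subtractf by (subst (asm) sum.swap) linarith
    also have "\<dots> \<le> sqnorm N r"
      using s_ge unfolding r_def residual_sum .
    finally have r_ge: "a \<le> sqnorm N r" .
    define A where "A = sqrt (sqnorm N r)"
    have A: "0 < A" "sqrt a \<le> A" "A\<^sup>2 = sqnorm N r"
      using r_ge \<open>0 < a\<close> by (auto simp: A_def)
    define w where "w p = of_real (1 / A) * r p" for p
    have w_orth: "hdot N (u j) w = 0" if "j < k" for j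
      unfolding w_def[abs_def] hdot_scale_right r_def by (simp add: hdot_residual[OF on that])
    have w_orth': "hdot N w (u j) = 0" if "j < k" for j
      using w_orth[OF that] by (metis cnj_hdot complex_cnj_zero)
    have w_r: "hdot N w r = of_real A"
      using A unfolding w_def[abs_def] hdot_scale_left hdot_self
      by (simp add: A(3)[symmetric] power2_eq_square)
    have w_w: "hdot N w w = 1"
      using w_r A(1) unfolding w_def[abs_def] by (subst hdot_scale_right) simp
    have t_s: "?t s p = r p + (\<Sum>j<k. hdot N (u j) (?t s) * u j p)" for p
      by (simp add: r_def residual_def)
    have w_t: "hdot N w (?t s) = of_real A"
    proof -
      have "hdot N w r = hdot N w (?t s) - (\<Sum>j<k. hdot N (u j) (?t s) * hdot N w (u j))"
        unfolding r_def residual_def[abs_def] hdot_diff_right hdot_sum_right hdot_scale_right ..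
      then show ?thesis using w_r w_orth' by simp
    qed
    have w_prev: "hdot N w (?t (e j)) = 0" if "j < k" for j
    proof -
      have "hdot N w (?t (e j)) = hdot N w (\<lambda>p. \<Sum>l<k. hdot N (u l) (?t (e j)) * u l p)"
        using span that by (intro hdot_cong) auto
      also have "\<dots> = 0"
        unfolding hdot_sum_right hdot_scale_right using w_orth' by simp
      finally show ?thesis .
    qed
    let ?u = "u(k := w)" and ?e = "e(k := s)"
    have "orthonormal N (Suc k) ?u"
      using on w_orth w_orth' w_w by (auto simp: orthonormal_def less_Suc_eq)
    moreover have "\<forall>j i. ?e j i \<in> {-1, 1}" using e s by auto
    moreover have "\<forall>j<Suc k. sqrt a \<le> Re (hdot N (?u j) (?t (?e j)))"
      using ge w_t A(2) by (auto simp: less_Suc_eq)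
    moreover have "\<forall>j<Suc k. \<forall>l<j. hdot N (?u j) (?t (?e l)) = 0"
      using tri w_prev by (auto simp: less_Suc_eq)
    moreover have "\<forall>j<Suc k. \<forall>p<N. ?t (?e j) p = (\<Sum>l<Suc k. hdot N (?u l) (?t (?e j)) * ?u l p)"
    proof (intro allI impI)
      fix j p assume j: "j < Suc k" and p: "p < N"
      show "?t (?e j) p = (\<Sum>l<Suc k. hdot N (?u l) (?t (?e j)) * ?u l p)"
      proof (cases "j = k")
        case True
        have "of_real A * w p = r p" using A by (simp add: w_def)
        with t_s[of p] w_t True show ?thesis by simp
      next
        case False
        with j have "j < k" by simp
        with span p w_prev show ?thesis by simp
      qed
    qed
    ultimately show ?case by blast
  qed
  from this[of n] show ?thesis by blast
qed

section \<open>Capacity lower bounds for a fixed channel matrix\<close>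

text \<open>
  The \<open>b\<close>-th binary digit of amplitude \<open>2\<^sup>-\<^sup>(\<^sup>b\<^sup>+\<^sup>1\<^sup>)\<close> sees the later digits as noise; each digit is worth
  a constant fraction of a bit as long as it is above the noise, and the sum over the digits
  telescopes to a logarithm.
\<close>

lemma digit_sum_ge_ln:
  fixes x :: real
  assumes "0 < x"
  shows "\<exists>B. ln (1 + x) / 8 \<le> (\<Sum>b<B. (1 / 4) ^ Suc b * x / (4 / 3 * ((1 / 4) ^ Suc b * x) + 1))"
proof -
  \<comment> \<open>One more digit quarters the remaining power, and the logarithm drops by ln ((1 +
    4 y) / (1 + y)) \<le> 3 y / (1 + y), at most four times the new term. The factor 4/3 sums the
    powers of a digit and all its successors.\<close>
  have tel: "(ln (1 + x) - ln (1 + (1 / 4) ^ B * x)) / 4 \<le>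
      (\<Sum>b<B. (1 / 4) ^ Suc b * x / (4 / 3 * ((1 / 4) ^ Suc b * x) + 1))" for B
  proof (induction B)
    case (Suc B)
    define y where "y = (1 / 4) ^ Suc B * x"
    have y: "0 < y" "(1 / 4) ^ B * x = 4 * y" using assms by (simp_all add: y_def)
    have "ln (1 + 4 * y) - ln (1 + y) = ln ((1 + 4 * y) / (1 + y))"
      using y by (simp add: ln_div)
    also have "\<dots> \<le> (1 + 4 * y) / (1 + y) - 1"
      using y by (intro ln_le_minus_one) auto
    also have "\<dots> = 3 * y / (1 + y)" using y by (simp add: field_simps)
    also have "\<dots> \<le> 4 * (y / (4 / 3 * y + 1))"
    proof -
      have "3 * y * (4 / 3 * y + 1) \<le> 4 * y * (1 + y)" using y by (simp add: algebra_simps)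
      then show ?thesis using y by (simp add: divide_simps add_pos_pos mult.commute)
    qed
    finally have step: "ln (1 + 4 * y) - ln (1 + y) \<le> 4 * (y / (4 / 3 * y + 1))" .
    have "(r - q) / 4 \<le> s + t" if "p - q \<le> 4 * t" "(r - p) / 4 \<le> s" for p q r s t :: real
      using that by simp
    from this[OF step Suc.IH[unfolded y(2)]] show ?case
      unfolding sum.lessThan_Suc y_def[symmetric] .
  qed simp
  \<comment> \<open>Enough digits are taken for the remaining power to account for at most half of
    the logarithm; this turns 1/4 into 1/8.\<close>
  have "(\<lambda>B. (1 / 4 :: real) ^ B * x) \<longlonglongrightarrow> 0 * x"
    by (intro tendsto_mult tendsto_const LIMSEQ_realpow_zero) auto
  moreover have "0 < ln (1 + x) / 2" using assms by simp
  ultimately have "eventually (\<lambda>B. (1 / 4 :: real) ^ B * x < ln (1 + x) / 2) sequentially"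
    by (intro order_tendstoD(2)) auto
  then obtain B where "(1 / 4 :: real) ^ B * x < ln (1 + x) / 2"
    by (auto simp: eventually_sequentially)
  moreover have "ln (1 + (1 / 4) ^ B * x) \<le> (1 / 4) ^ B * x"
    using assms by (intro ln_add_one_self_le_self) auto
  ultimately have "ln (1 + x) / 8 \<le> (ln (1 + x) - ln (1 + (1 / 4) ^ B * x)) / 4" by simp
  from order_trans[OF this tel[of B]] show ?thesis ..
qed

text \<open>Jensen's inequality for the convex function 1/x, obtained by summing its tangent at
  \<open>c\<close>.\<close>

lemma sum_inverse_ge:
  fixes x :: "nat \<Rightarrow> real"
  assumes "0 < n" and pos: "\<And>k. k < n \<Longrightarrow> 0 < x k" and le: "(\<Sum>k<n. x k) \<le> real n * c"
  shows "real n / c \<le> (\<Sum>k<n. 1 / x k)"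
proof -
  have "0 < (\<Sum>k<n. x k)" using assms by (intro sum_pos) auto
  then have c: "0 < c" using le \<open>0 < n\<close> by (smt (verit) mult_nonneg_nonpos of_nat_0_le_iff)
  have tangent: "2 / c - x k / c\<^sup>2 \<le> 1 / x k" if "k < n" for k
  proof -
    have "0 \<le> (x k - c)\<^sup>2 / (x k * c\<^sup>2)" using pos[OF that] c by simp
    also have "\<dots> = 1 / x k - (2 / c - x k / c\<^sup>2)"
      using pos[OF that] c by (simp add: field_simps power2_eq_square)
    finally show ?thesis by simp
  qed
  have "real n / c = real n * (2 / c) - (real n * c) / c\<^sup>2"
    using c by (simp add: field_simps power2_eq_square)
  also have "\<dots> \<le> real n * (2 / c) - (\<Sum>k<n. x k) / c\<^sup>2"
    using le c by (intro diff_left_mono divide_right_mono) auto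
  also have "\<dots> = (\<Sum>k<n. 2 / c - x k / c\<^sup>2)"
    by (simp add: sum_subtractf sum_divide_distrib)
  also have "\<dots> \<le> (\<Sum>k<n. 1 / x k)"
    using tangent by (intro sum_mono) auto
  finally show ?thesis .
qed

section \<open>Geometric tails of the digit amplitudes, and blocks of signs\<close>

lemma half_power_tail: "(\<Sum>b\<in>{b..<B}. (1 / 2 :: real) ^ Suc b) < 2 * (1 / 2) ^ Suc b"
proof -
  have "(\<Sum>b\<in>{b..<B}. (1 / 2 :: real) ^ Suc b) < (1 / 2) ^ b" for b
  proof (cases "b \<le> B")
    case True
    then have "(\<Sum>b\<in>{b..<B}. (1 / 2 :: real) ^ Suc b) = (1 / 2) ^ b - (1 / 2) ^ B"
      by (induction B rule: dec_induct) auto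
    then show ?thesis by simp
  qed simp
  from this[of b] show ?thesis by simp
qed

lemma quarter_power_tail: "(\<Sum>b\<in>{b..<B}. (1 / 4 :: real) ^ Suc b) \<le> 4 / 3 * (1 / 4) ^ Suc b"
proof -
  have "(\<Sum>b\<in>{b..<B}. (1 / 4 :: real) ^ Suc b) \<le> ((1 / 4) ^ b - (1 / 4) ^ max b B) / 3"
  proof (cases "b \<le> B")
    case True
    then have "(\<Sum>b\<in>{b..<B}. (1 / 4 :: real) ^ Suc b) = ((1 / 4) ^ b - (1 / 4) ^ B) / 3"
      by (induction B rule: dec_induct) auto
    with True show ?thesis by (simp add: max_def)
  qed simp
  also have "\<dots> \<le> (1 / 4) ^ b / 3" by simp
  finally show ?thesis by simp
qed

text \<open>Signs are numbered in blocks of \<open>B\<close>, one block per stream. A row that does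
  not see later blocks reduces to the tail of its own block.\<close>

lemma sum_block_tail:
  fixes f :: "nat \<Rightarrow> real"
  assumes "k < n" "b \<le> B" and zero: "\<And>i. Suc k * B \<le> i \<Longrightarrow> i < n * B \<Longrightarrow> f i = 0"
  shows "(\<Sum>i\<in>{k * B + b..<n * B}. f i) = (\<Sum>c\<in>{b..<B}. f (k * B + c))"
proof -
  have "Suc k * B \<le> n * B" using assms by (intro mult_le_mono1) simp
  then have "(\<Sum>i\<in>{k * B + b..<n * B}. f i) = (\<Sum>i\<in>{k * B + b..<k * B + B}. f i)"
    using zero by (intro sum.mono_neutral_right) (auto simp: not_less add.commute)
  also have "\<dots> = (\<Sum>c\<in>{b..<B}. f (c + k * B))"
    using sum.shift_bounds_nat_ivl[of f b "k * B" B] by (simp add: add.commute)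
  finally show ?thesis by (simp add: add.commute)
qed

text \<open>Bessel's inequality under the expectation: orthonormal filters together collect at most
  the total variance of the interference.\<close>

lemma covariance_trace:
  assumes cov: "has_covariance N nu S" and on: "orthonormal N n u"
  shows "(\<Sum>k<n. Re (\<Sum>p<N. \<Sum>q<N. cnj (u k p) * S p q * u k q)) \<le> Re (mat_trace N S)"
proof -
  define d where "d w p = w p - (\<integral>v. v p \<partial>nu)" for w :: "nat \<Rightarrow> complex" and p
  have "(\<Sum>k<n. Re (\<Sum>p<N. \<Sum>q<N. cnj (u k p) * S p q * u k q)) =
      (\<Sum>k<n. \<integral>w. (cmod (hdot N (u k) (d w)))\<^sup>2 \<partial>nu)"
    unfolding hdot_def d_def covariance_quadratic_form(2)[OF cov] ..
  also have "\<dots> = (\<integral>w. (\<Sum>k<n. (cmod (hdot N (u k) (d w)))\<^sup>2) \<partial>nu)"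
    unfolding hdot_def d_def
    by (rule Bochner_Integration.integral_sum[symmetric]) (rule covariance_quadratic_form(1)[OF cov])
  also have "\<dots> \<le> (\<integral>w. sqnorm N (d w) \<partial>nu)"
    by (intro integral_mono Bochner_Integration.integrable_sum Bessel_inequality[OF on])
       (auto simp: hdot_def d_def sqnorm_def
         intro!: covariance_quadratic_form(1)[OF cov] has_covariance_integrable(2)[OF cov])
  also have "\<dots> = (\<Sum>p<N. \<integral>w. (cmod (d w p))\<^sup>2 \<partial>nu)"
    unfolding sqnorm_def d_def
    by (intro Bochner_Integration.integral_sum has_covariance_integrable(2)[OF cov]) auto
  also have "\<dots> = (\<Sum>p<N. Re (S p p))"
  proof (intro sum.cong refl)
    fix p assume "p \<in> {..<N}"
    then have "S p p = (\<integral>w. complex_of_real ((cmod (d w p))\<^sup>2) \<partial>nu)"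
      using cov by (simp add: has_covariance_def d_def complex_norm_square del: of_real_power)
    then show "(\<integral>w. (cmod (d w p))\<^sup>2 \<partial>nu) = Re (S p p)"
      unfolding integral_complex_of_real by simp
  qed
  finally show ?thesis by (simp add: mat_trace_def)
qed

lemma covariance_trace_nonneg:
  assumes "has_covariance N nu S"
  shows "0 \<le> Re (mat_trace N S)"
  using covariance_trace[OF assms, of 0] by (simp add: orthonormal_def)

text \<open>The signs are uncorrelated, so the mean power at an antenna is the sum of the squared
  amplitudes used there.\<close>

lemma admissible_binary_input:
  fixes r :: "nat \<Rightarrow> nat \<Rightarrow> real"
  assumes "\<And>i. i < N \<Longrightarrow> (\<Sum>j<J. (r j i)\<^sup>2) \<le> P"
  shows "distr (measure_pmf (pmf_of_set (signs J))) (cvec N)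
    (\<lambda>s. \<lambda>p\<in>{..<N}. \<Sum>j<J. of_real (s j) * of_real (r j p)) \<in> admissible_inputs N P"
proof -
  let ?enc = "\<lambda>s. \<lambda>p\<in>{..<N}. \<Sum>j<J. complex_of_real (s j) * of_real (r j p)"
  let ?M = "measure_pmf (pmf_of_set (signs J))"
  have enc[measurable]: "?enc \<in> measurable ?M (cvec N)" by (simp add: space_PiM)
  have "(\<integral>\<^sup>+x. ennreal ((cmod (x i))\<^sup>2) \<partial>distr ?M (cvec N) ?enc) \<le> ennreal P" if i: "i < N" for i
  proof -
    have [measurable]: "(\<lambda>x. x i) \<in> borel_measurable (cvec N)" using i by simp
    have sq: "(cmod (?enc s i))\<^sup>2 = ((\<Sum>j<J. s j * r j i) + 0)\<^sup>2" for s
    proof -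
      have "?enc s i = complex_of_real (\<Sum>j<J. s j * r j i)" using i by simp
      then show ?thesis by (simp only: norm_of_real power2_abs add_0_right)
    qed
    have "(\<integral>\<^sup>+x. ennreal ((cmod (x i))\<^sup>2) \<partial>distr ?M (cvec N) ?enc) =
        (\<integral>\<^sup>+s. ennreal ((cmod (?enc s i))\<^sup>2) \<partial>?M)"
      by (rule nn_integral_distr[OF enc]) measurable
    also have "\<dots> = (\<integral>\<^sup>+s. ennreal (((\<Sum>j<J. s j * r j i) + 0)\<^sup>2) \<partial>?M)"
      unfolding sq ..
    also have "\<dots> = ennreal (\<integral>s. ((\<Sum>j<J. s j * r j i) + 0)\<^sup>2 \<partial>?M)"
      by (intro nn_integral_eq_integral integrable_measure_pmf_finite) auto
    also have "(\<integral>s. ((\<Sum>j<J. s j * r j i) + 0)\<^sup>2 \<partial>?M) = (\<Sum>j<J. (r j i)\<^sup>2)"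
      by (subst integral_pmf_of_set) (auto simp only: sum_signs_square card_signs signs_nonempty finite_signs, simp)
    also have "ennreal \<dots> \<le> ennreal P" by (rule ennreal_leI[OF assms[OF i]])
    finally show ?thesis .
  qed
  moreover have "prob_space (distr ?M (cvec N) ?enc)"
    by (rule measure_pmf.prob_space_distr) measurable
  ultimately show ?thesis unfolding admissible_inputs_def by simp
qed

text \<open>A stronger stream also suffers proportionally more from its own later digits, but the
  ratio still grows; hence each stream may be treated as having only the guaranteed gain.\<close>

lemma saturating_mono:
  fixes y z w :: real
  assumes "0 < y" "y \<le> z" "0 < w"
  shows "y / (4 / 3 * y + w) \<le> z / (4 / 3 * z + w)"
proof -
  have "y * (4 / 3 * z + w) \<le> z * (4 / 3 * y + w)"
    using mult_right_mono[OF assms(2), of w] assms(3) by (simp add: algebra_simps)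
  moreover have "0 < 4 / 3 * y + w" "0 < 4 / 3 * z + w" using assms by simp_all
  ultimately show ?thesis
    by (simp only: pos_divide_le_eq pos_le_divide_eq times_divide_eq_left)
qed

text \<open>Sign \<open>k * B + b\<close> is digit \<open>b\<close> of stream
  \<open>n - Suc k\<close>. Streams are decoded from the last to the first, because the filter
  \<open>u j\<close> suppresses the patterns l < j while those with l > j have been cancelled by
  then; within a stream the largest digit goes first. The factor 96 is 8 * 12, the loss in the digit
  sum times the loss for binary inputs.\<close>

lemma capacity_streams_ge:
  fixes u :: "nat \<Rightarrow> nat \<Rightarrow> complex" and e :: "nat \<Rightarrow> nat \<Rightarrow> real" and H :: "nat \<Rightarrow> nat \<Rightarrow> complex"
  assumes cov: "has_covariance N nu S" and pos: "0 < P" "0 < a" "0 < n"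
    and on: "orthonormal N n u" and e: "\<And>j i. e j i \<in> {-1, 1}"
    and ge: "\<And>j. j < n \<Longrightarrow> sqrt a \<le> Re (hdot N (u j) (\<lambda>p. \<Sum>i<N. of_real (e j i) * H p i))"
    and tri: "\<And>j l. j < n \<Longrightarrow> l < j \<Longrightarrow> hdot N (u j) (\<lambda>p. \<Sum>i<N. of_real (e l i) * H p i) = 0"
  shows "ereal (real n / 96 * log 2 (1 + P * a / n / (2 + 2 * Re (mat_trace N S) / n))) \<le> capacity N H nu P"
proof -
  define tr where "tr = Re (mat_trace N S)"
  have tr: "0 \<le> tr" unfolding tr_def by (rule covariance_trace_nonneg[OF cov])
  define sb where "sb = 2 + 2 * tr / n"
  have sb: "0 < sb" using tr by (simp add: sb_def add_pos_nonneg)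
  define A2 where "A2 = P * a / n"
  have A2: "0 < A2" using pos by (simp add: A2_def)
  define x where "x = A2 / sb"
  have x: "0 < x" using A2 sb by (simp add: x_def)
  obtain B where B: "ln (1 + x) / 8 \<le> (\<Sum>b<B. (1 / 4) ^ Suc b * x / (4 / 3 * ((1 / 4) ^ Suc b * x) + 1))"
    using digit_sum_ge_ln[OF x] by blast
  define t where "t l p = (\<Sum>i<N. of_real (e l i) * H p i)" for l p
  define \<kappa> where "\<kappa> j = n - Suc (j div B)" for j
  \<comment> \<open>Each stream has the budget P / n at every antenna; its digits use less than a
    third of it.\<close>
  define r where "r j i = (1 / 2) ^ Suc (j mod B) * sqrt (P / n) * e (\<kappa> j) i" for j i
  define g where "g j i = complex_of_real (r j i)" for j i
  define v where "v j = u (\<kappa> j)" for j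
  define J where "J = n * B"
  define mu where "mu = distr (measure_pmf (pmf_of_set (signs J))) (cvec N)
      (\<lambda>s. \<lambda>p\<in>{..<N}. \<Sum>j<J. of_real (s j) * g j p)"
  define \<alpha> where "\<alpha> j i = Re (\<Sum>p<N. cnj (v j p) * (\<Sum>k<N. H p k * g i k))" for j i
  define quad where "quad k = Re (\<Sum>p<N. \<Sum>q<N. cnj (u k p) * S p q * u k q)" for k
  have quad: "0 \<le> quad k" for k
    unfolding quad_def covariance_quadratic_form(2)[OF cov, symmetric] by simp
  have unit: "(\<Sum>p<N. (cmod (u k p))\<^sup>2) = 1" if "k < n" for k
  proof -
    have "complex_of_real (sqnorm N (u k)) = 1"
      using on that hdot_self[of N "u k"] by (simp add: orthonormal_def)
    then show ?thesis unfolding sqnorm_def of_real_eq_1_iff .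
  qed
  have \<kappa>: "\<kappa> j < n" for j using pos by (simp add: \<kappa>_def)
  have \<sigma>: "2 * Re (\<Sum>p<N. \<Sum>q<N. cnj (v j p) * S p q * v j q) + 2 * (\<Sum>p<N. (cmod (v j p))\<^sup>2) =
      2 * quad (\<kappa> j) + 2" for j
    unfolding v_def quad_def[symmetric] unit[OF \<kappa>] by simp
  have \<alpha>_eq: "\<alpha> j i = (1 / 2) ^ Suc (i mod B) * (sqrt (P / n) * Re (hdot N (u (\<kappa> j)) (t (\<kappa> i))))" for j i
  proof -
    have "(\<Sum>k<N. H p k * g i k) = of_real ((1 / 2) ^ Suc (i mod B) * sqrt (P / n)) * t (\<kappa> i) p" for p
      by (simp add: g_def r_def t_def sum_distrib_left mult_ac)
    then have "\<alpha> j i = Re (of_real ((1 / 2) ^ Suc (i mod B) * sqrt (P / n)) * hdot N (u (\<kappa> j)) (t (\<kappa> i)))"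
      unfolding \<alpha>_def v_def by (simp only: hdot_def[symmetric] hdot_scale_right)
    then show ?thesis by (simp only: times_complex.sel Im_complex_of_real
      Re_complex_of_real mult_zero_left diff_zero mult.assoc)
  qed
  define A where "A k = sqrt (P / n) * Re (hdot N (u k) (t k))" for k
  have A_ge: "sqrt A2 \<le> A k" if "k < n" for k
  proof -
    have "sqrt (P / n) * sqrt a \<le> A k"
      unfolding A_def t_def[abs_def] using ge[OF that] pos by (intro mult_left_mono) auto
    moreover have "sqrt (P / n) * sqrt a = sqrt A2"
      unfolding A2_def real_sqrt_mult[symmetric] by simp
    ultimately show ?thesis by simp
  qed
  have A_pos: "0 < A k" if "k < n" for k using A_ge[OF that] A2 by (smt (verit) real_sqrt_gt_0_iff)
  have block: "\<alpha> (k * B + b) (k * B + c) = (1 / 2) ^ Suc c * A (n - Suc k)"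
    if "k < n" "b < B" "c < B" for k b c
    unfolding \<alpha>_eq \<kappa>_def A_def using that by simp
  have later: "\<alpha> (k * B + b) i = 0" if "k < n" "b < B" "Suc k * B \<le> i" "i < n * B" for k b i
  proof -
    have "0 < B" using that by simp
    then have "Suc k \<le> i div B" "i div B < n"
      using that by (simp_all add: less_eq_div_iff_mult_less_eq div_less_iff_less_mult)
    then have "n - Suc (i div B) < n - Suc k" using that by simp
    then show ?thesis
      unfolding \<alpha>_eq \<kappa>_def using tri[of "n - Suc k" "n - Suc (i div B)"] that by (simp add: t_def[abs_def])
  qed
  have split_index: "\<exists>k b. j = k * B + b \<and> k < n \<and> b < B" if "j < J" for j
  proof -
    have "0 < B" using that by (cases B) (auto simp: J_def)
    then show ?thesis
      using that by (intro exI[of _ "j div B"] exI[of _ "j mod B"]) (simp add: J_def div_less_iff_less_mult)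
  qed
  \<comment> \<open>Halving the amplitudes makes each digit exceed the sum of all later ones of its
    stream, and later blocks do not contribute.\<close>
  have dom: "(\<Sum>i\<in>{j<..<J}. \<bar>\<alpha> j i\<bar>) < \<alpha> j j" if jJ: "j < J" for j
  proof -
    obtain k b where j: "j = k * B + b" "k < n" "b < B" using split_index[OF jJ] by blast
    have A: "0 < A (n - Suc k)" using j by (intro A_pos) simp
    have "{j<..<J} = {k * B + Suc b..<n * B}" by (auto simp: j J_def)
    then have "(\<Sum>i\<in>{j<..<J}. \<bar>\<alpha> j i\<bar>) = (\<Sum>c\<in>{Suc b..<B}. \<bar>\<alpha> j (k * B + c)\<bar>)"
      using j later by (simp only:) (rule sum_block_tail, auto)
    also have "\<dots> = (\<Sum>c\<in>{Suc b..<B}. (1 / 2) ^ Suc c) * A (n - Suc k)"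
      unfolding sum_distrib_right using j A by (intro sum.cong) (auto simp: block)
    also have "\<dots> < 2 * (1 / 2) ^ Suc (Suc b) * A (n - Suc k)"
      using A by (intro mult_strict_right_mono half_power_tail)
    also have "\<dots> = \<alpha> j j" using j by (simp add: block)
    finally show ?thesis .
  qed
  define y where "y b = (1 / 4) ^ Suc b * A2" for b :: nat
  have y: "0 < y b" for b using A2 by (simp add: y_def)
  have term_ge: "y b / (4 / 3 * y b + (2 * quad (n - Suc k) + 2)) \<le>
      (\<alpha> j j)\<^sup>2 / ((\<Sum>i\<in>{j..<J}. (\<alpha> j i)\<^sup>2) + (2 * quad (\<kappa> j) + 2))"
    if j: "j = k * B + b" "k < n" "b < B" for j k b
  proof -
    define z where "z = (1 / 4) ^ Suc b * (A (n - Suc k))\<^sup>2"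
    have half_sq: "((1 / 2 :: real) ^ m)\<^sup>2 = (1 / 4) ^ m" for m
      by (simp add: power2_eq_square power_mult_distrib[symmetric])
    have A_le: "A2 \<le> (A (n - Suc k))\<^sup>2"
    proof -
      have "(sqrt A2)\<^sup>2 \<le> (A (n - Suc k))\<^sup>2"
        using A_ge[of "n - Suc k"] pos A2 by (intro power_mono) auto
      then show ?thesis using A2 by simp
    qed
    then have z: "y b \<le> z" unfolding y_def z_def by (intro mult_left_mono) auto
    have zp: "0 < z" using z y[of b] by simp
    have \<kappa>j: "\<kappa> j = n - Suc k" using j by (simp add: \<kappa>_def)
    have jj: "(\<alpha> j j)\<^sup>2 = z" using j by (simp only: block power_mult_distrib half_sq z_def)
    have "(\<Sum>i\<in>{j..<J}. (\<alpha> j i)\<^sup>2) = (\<Sum>c\<in>{b..<B}. (\<alpha> j (k * B + c))\<^sup>2)"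
      unfolding j(1) J_def by (rule sum_block_tail) (use j later in auto)
    also have "\<dots> = (\<Sum>c\<in>{b..<B}. (1 / 4) ^ Suc c) * (A (n - Suc k))\<^sup>2"
      unfolding sum_distrib_right using j
      by (intro sum.cong refl) (simp only: block power_mult_distrib half_sq atLeastLessThan_iff)
    also have "\<dots> \<le> 4 / 3 * (1 / 4) ^ Suc b * (A (n - Suc k))\<^sup>2"
      by (intro mult_right_mono quarter_power_tail) auto
    also have "\<dots> = 4 / 3 * z" by (simp add: z_def)
    finally have S_le: "(\<Sum>i\<in>{j..<J}. (\<alpha> j i)\<^sup>2) \<le> 4 / 3 * z" .
    have q: "0 < 2 * quad (n - Suc k) + 2" using quad[of "n - Suc k"] by simp
    have "y b / (4 / 3 * y b + (2 * quad (n - Suc k) + 2)) \<le> z / (4 / 3 * z + (2 * quad (n - Suc k) + 2))"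
      using y[of b] z q by (rule saturating_mono)
    also have "\<dots> \<le> z / ((\<Sum>i\<in>{j..<J}. (\<alpha> j i)\<^sup>2) + (2 * quad (n - Suc k) + 2))"
      using S_le zp q quad[of "n - Suc k"] by (intro divide_left_mono mult_pos_pos add_nonneg_pos add_pos_pos sum_nonneg) auto
    finally show ?thesis unfolding jj \<kappa>j .
  qed
  have "real n * ln (1 + x) / 8 \<le> real n * (\<Sum>b<B. (1 / 4) ^ Suc b * x / (4 / 3 * ((1 / 4) ^ Suc b * x) + 1))"
    using mult_left_mono[OF B, of "real n"] by simp
  also have "\<dots> = (\<Sum>b<B. y b * (real n / (4 / 3 * y b + sb)))"
    unfolding sum_distrib_left
  proof (intro sum.cong refl)
    fix b
    have "(1 / 4) ^ Suc b * x = y b / sb" by (simp add: y_def x_def)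
    moreover have "4 / 3 * (y b / sb) + 1 = (4 / 3 * y b + sb) / sb" using sb by (simp add: field_simps)
    ultimately show "real n * ((1 / 4) ^ Suc b * x / (4 / 3 * ((1 / 4) ^ Suc b * x) + 1)) =
        y b * (real n / (4 / 3 * y b + sb))" using sb by simp
  qed
  \<comment> \<open>The noise levels of the single filters are unknown, but their average is at most
    \<open>sb\<close> by the trace bound; convexity allows the average to replace them.\<close>
  also have "\<dots> \<le> (\<Sum>b<B. y b * (\<Sum>k<n. 1 / (4 / 3 * y b + (2 * quad k + 2))))"
  proof (intro sum_mono mult_left_mono sum_inverse_ge)
    fix b
    have "(\<Sum>k<n. 4 / 3 * y b + (2 * quad k + 2)) = real n * (4 / 3 * y b + 2) + 2 * (\<Sum>k<n. quad k)"
      by (simp add: sum.distrib sum_distrib_left algebra_simps)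
    also have "\<dots> \<le> real n * (4 / 3 * y b + 2) + 2 * tr"
      using covariance_trace[OF cov on] by (simp add: quad_def tr_def)
    also have "\<dots> = real n * (4 / 3 * y b + sb)"
      using pos by (simp add: sb_def field_simps)
    finally show "(\<Sum>k<n. 4 / 3 * y b + (2 * quad k + 2)) \<le> real n * (4 / 3 * y b + sb)" .
  next
    fix b k show "0 < 4 / 3 * y b + (2 * quad k + 2)"
      using y[of b] quad[of k] by simp
  qed (use pos y in \<open>auto simp: less_imp_le\<close>)
  also have "\<dots> = (\<Sum>b<B. \<Sum>k<n. y b / (4 / 3 * y b + (2 * quad k + 2)))"
    by (simp add: sum_distrib_left)
  also have "\<dots> = (\<Sum>b<B. \<Sum>k<n. y b / (4 / 3 * y b + (2 * quad (n - Suc k) + 2)))"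
    by (intro sum.cong refl sum.nat_diff_reindex[symmetric])
  also have "\<dots> = (\<Sum>k<n. \<Sum>b<B. y b / (4 / 3 * y b + (2 * quad (n - Suc k) + 2)))"
    by (rule sum.swap)
  also have "\<dots> \<le> (\<Sum>k<n. \<Sum>j\<in>{k * B..<k * B + B}.
      (\<alpha> j j)\<^sup>2 / ((\<Sum>i\<in>{j..<J}. (\<alpha> j i)\<^sup>2) + (2 * quad (\<kappa> j) + 2)))"
  proof (intro sum_mono)
    fix k assume k: "k \<in> {..<n}"
    let ?f = "\<lambda>j. (\<alpha> j j)\<^sup>2 / ((\<Sum>i\<in>{j..<J}. (\<alpha> j i)\<^sup>2) + (2 * quad (\<kappa> j) + 2))"
    have "(\<Sum>b<B. y b / (4 / 3 * y b + (2 * quad (n - Suc k) + 2))) \<le> (\<Sum>b<B. ?f (k * B + b))"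
      using k by (intro sum_mono term_ge[OF refl]) auto
    also have "\<dots> = (\<Sum>j\<in>{k * B..<k * B + B}. ?f j)"
      using sum.shift_bounds_nat_ivl[of ?f 0 "k * B" B] by (simp add: add.commute atLeast0LessThan)
    finally show "(\<Sum>b<B. y b / (4 / 3 * y b + (2 * quad (n - Suc k) + 2))) \<le> (\<Sum>j\<in>{k * B..<k * B + B}. ?f j)" .
  qed
  also have "\<dots> = (\<Sum>j<J. (\<alpha> j j)\<^sup>2 / ((\<Sum>i\<in>{j..<J}. (\<alpha> j i)\<^sup>2) + (2 * quad (\<kappa> j) + 2)))"
    unfolding J_def by (rule sum.nat_group)
  finally have sum_ge: "real n * ln (1 + x) / 8 \<le> \<dots>" .
  have "real n / 96 * log 2 (1 + x) = real n * ln (1 + x) / 8 / (12 * ln 2)"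
    by (simp add: log_def)
  also have "\<dots> \<le> (\<Sum>j<J. (\<alpha> j j)\<^sup>2 / ((\<Sum>i\<in>{j..<J}. (\<alpha> j i)\<^sup>2) + (2 * quad (\<kappa> j) + 2))) / (12 * ln 2)"
    using sum_ge by (intro divide_right_mono) auto
  also have "\<dots> \<le> channel_information N H nu mu"
    using channel_information_binary_ge[OF cov, where v=v and g=g and H=H and J=J] dom
    unfolding \<alpha>_def mu_def \<sigma> by blast
  finally have info: "real n / 96 * log 2 (1 + x) \<le> channel_information N H nu mu" .
  have "mu \<in> admissible_inputs N P"
    unfolding mu_def g_def
  proof (rule admissible_binary_input)
    fix i
    have "(\<Sum>j<J. (r j i)\<^sup>2) = (\<Sum>k<n. \<Sum>j\<in>{k * B..<k * B + B}. (r j i)\<^sup>2)"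
      unfolding J_def by (rule sum.nat_group[symmetric])
    also have "\<dots> = (\<Sum>k<n. \<Sum>b<B. (r (k * B + b) i)\<^sup>2)"
    proof (rule sum.cong[OF refl])
      fix k
      show "(\<Sum>j\<in>{k * B..<k * B + B}. (r j i)\<^sup>2) = (\<Sum>b<B. (r (k * B + b) i)\<^sup>2)"
        using sum.shift_bounds_nat_ivl[of "\<lambda>j. (r j i)\<^sup>2" 0 "k * B" B]
        by (simp add: add.commute atLeast0LessThan)
    qed
    also have "\<dots> = (\<Sum>k<n. \<Sum>b<B. (1 / 4) ^ Suc b * (P / n))"
    proof (intro sum.cong refl)
      fix k b assume "b \<in> {..<B}"
      then have m: "(k * B + b) mod B = b" by simp
      have sq: "((1 / 2 :: real) ^ Suc b)\<^sup>2 = (1 / 4) ^ Suc b"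
        by (simp add: power2_eq_square power_mult_distrib[symmetric])
      have e1: "(e l i)\<^sup>2 = 1" for l using e[of l i] by auto
      have "(sqrt (P / n))\<^sup>2 = P / n" using pos by simp
      then show "(r (k * B + b) i)\<^sup>2 = (1 / 4) ^ Suc b * (P / n)"
        unfolding r_def m power_mult_distrib sq e1 by simp
    qed
    also have "\<dots> = (\<Sum>b\<in>{0..<B}. (1 / 4) ^ Suc b) * P"
      unfolding sum_distrib_right[symmetric] atLeast0LessThan using pos by (simp del: power_Suc)
    also have "\<dots> \<le> (4 / 3 * (1 / 4) ^ Suc 0) * P"
      using pos by (intro mult_right_mono quarter_power_tail) auto
    also have "\<dots> \<le> P" using pos by simp
    finally show "(\<Sum>j<J. (r j i)\<^sup>2) \<le> P" .
  qed
  then have "ereal (channel_information N H nu mu) \<le> capacity N H nu P"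
    unfolding capacity_def by (rule SUP_upper)
  with info show ?thesis
    unfolding x_def A2_def sb_def tr_def by (meson ereal_less_eq(3) order_trans)
qed

text \<open>The energy is at least 2 \<open>a\<close> = N^2 G / (4 L^2), and a^2 = N^4 (G / L^2)^2 /
  64, so a projection of rank at most m / (64 K) captures no more than half of it. The constant
  12288 is 96 * 128: the loss per stream times the loss in the number of streams.\<close>

lemma capacity_ge_of_gram:
  fixes H :: "nat \<Rightarrow> nat \<Rightarrow> complex" and m :: real
  assumes cov: "has_covariance N nu S" and pos: "0 < G" "0 < L" "0 < P" "0 < N" "1 \<le> K"
    and m: "1 \<le> m" "m \<le> N"
    and gain: "\<And>i k. i < N \<Longrightarrow> k < N \<Longrightarrow> G / (4 * L\<^sup>2) \<le> (cmod (H i k))\<^sup>2"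
    and gram: "(\<Sum>p<N. \<Sum>q<N. (cmod (\<Sum>i<N. H p i * cnj (H q i)))\<^sup>2) \<le> K * (G / L\<^sup>2)\<^sup>2 * real N ^ 4 / m"
  defines "s \<equiv> G * P / L\<^sup>2"
  shows "ereal (m / (12288 * K) * log 2 (1 + s * (1 / 16 * real N) / (1 + s * rho1 N L G P S))) \<le> capacity N H nu P"
proof -
  define tr where "tr = Re (mat_trace N S)"
  have tr: "0 \<le> tr" unfolding tr_def by (rule covariance_trace_nonneg[OF cov])
  have s: "0 < s" using pos by (simp add: s_def)
  have tr_eq: "tr = s * N * rho1 N L G P S"
    using pos by (simp add: s_def rho1_def tr_def)
  have \<rho>: "0 \<le> rho1 N L G P S" using tr pos by (simp add: rho1_def tr_def)
  define a where "a = real N ^ 2 * G / (8 * L\<^sup>2)"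
  have a: "0 < a" using pos by (simp add: a_def)
  \<comment> \<open>Only ranks below \<open>n\<close> have to be tested, and rank 0 always passes,
    so one stream exists even when the quotient is less than 1. Rounding down costs at most a factor
    2.\<close>
  define n where "n = max 1 (nat \<lfloor>m / (64 * K)\<rfloor>)"
  have fl: "0 \<le> m / (64 * K)" using m pos by simp
  have n_pos: "0 < n" by (simp add: n_def)
  have n_le: "n \<le> N"
  proof -
    have "m / (64 * K) \<le> m / 1" using m pos by (intro divide_left_mono) auto
    then have "nat \<lfloor>m / (64 * K)\<rfloor> \<le> N" using m by (simp add: nat_le_iff floor_le_iff)
    then show ?thesis using pos by (simp add: n_def)
  qed
  have n_ge: "m / (128 * K) \<le> n"
  proof (cases "m / (64 * K) < 2")
    case True
    then have "m / (128 * K) \<le> 1" using pos by (simp add: field_simps)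
    also have "1 \<le> real n" using n_pos by simp
    finally show ?thesis .
  next
    case False
    then have "m / (64 * K) / 2 \<le> m / (64 * K) - 1" by simp
    also have "\<dots> \<le> of_int \<lfloor>m / (64 * K)\<rfloor>" by linarith
    also have "\<dots> = real (nat \<lfloor>m / (64 * K)\<rfloor>)" using fl by simp
    also have "\<dots> \<le> n" by (simp add: n_def)
    finally show ?thesis by simp
  qed
  have k_le: "real k \<le> m / (64 * K)" if "k < n" for k
  proof (cases "k = 0")
    case False
    with that have "k \<le> nat \<lfloor>m / (64 * K)\<rfloor>" by (auto simp: n_def max_def split: if_splits)
    then have "real k \<le> real (nat \<lfloor>m / (64 * K)\<rfloor>)" by simp
    also have "\<dots> \<le> m / (64 * K)" using fl by simp
    finally show ?thesis .
  qed (use fl in simp)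
  have energy: "2 * a \<le> (\<Sum>i<N. sqnorm N (\<lambda>p. H p i))"
  proof -
    have "2 * a = (\<Sum>i<N. \<Sum>p<N. G / (4 * L\<^sup>2))"
      by (simp add: a_def power2_eq_square)
    also have "\<dots> \<le> (\<Sum>i<N. sqnorm N (\<lambda>p. H p i))"
      unfolding sqnorm_def using gain by (intro sum_mono) auto
    finally show ?thesis .
  qed
  have corr: "real k * (\<Sum>p<N. \<Sum>q<N. (cmod (\<Sum>i<N. H p i * cnj (H q i)))\<^sup>2) \<le> a\<^sup>2" if "k < n" for k
  proof -
    have "real k * (\<Sum>p<N. \<Sum>q<N. (cmod (\<Sum>i<N. H p i * cnj (H q i)))\<^sup>2) \<le>
        (m / (64 * K)) * (K * (G / L\<^sup>2)\<^sup>2 * real N ^ 4 / m)"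
      using k_le[OF that] gram fl by (intro mult_mono sum_nonneg) auto
    also have "\<dots> = a\<^sup>2"
    proof -
      define q where "q = G / L\<^sup>2"
      have "a = real N ^ 2 * q / 8" by (simp add: a_def q_def)
      then have "a\<^sup>2 = real N ^ 4 * q\<^sup>2 / 64"
        by (simp only: power_mult_distrib power_divide power_mult[symmetric]) simp
      then show ?thesis using m pos unfolding q_def[symmetric] by simp
    qed
    finally show ?thesis .
  qed
  have "\<exists>u e. orthonormal N n u \<and> (\<forall>j i. e j i \<in> {-1, 1 :: real}) \<and>
    (\<forall>j<n. sqrt a \<le> Re (hdot N (u j) (\<lambda>p. \<Sum>i<N. of_real (e j i) * H p i))) \<and>
    (\<forall>j<n. \<forall>l<j. hdot N (u j) (\<lambda>p. \<Sum>i<N. of_real (e l i) * H p i) = 0)"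
    by (rule exists_orthogonal_streams[OF energy a corr])
  then obtain u e where ue: "orthonormal N n u \<and> (\<forall>j i. e j i \<in> {-1, 1 :: real}) \<and>
    (\<forall>j<n. sqrt a \<le> Re (hdot N (u j) (\<lambda>p. \<Sum>i<N. of_real (e j i) * H p i))) \<and>
    (\<forall>j<n. \<forall>l<j. hdot N (u j) (\<lambda>p. \<Sum>i<N. of_real (e l i) * H p i) = 0)"
    by (elim exE)
  have cap: "ereal (real n / 96 * log 2 (1 + P * a / n / (2 + 2 * tr / n))) \<le> capacity N H nu P"
    unfolding tr_def
  proof (rule capacity_streams_ge[OF cov \<open>0 < P\<close> a n_pos, where u=u and e=e])
    show "orthonormal N n u" using ue by (rule conjunct1)
  qed (use ue in \<open>simp_all\<close>)
  have arg: "s * (1 / 16 * real N) / (1 + s * rho1 N L G P S) \<le> P * a / n / (2 + 2 * tr / n)"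
  proof -
    have d: "0 < 1 + s * rho1 N L G P S" using s \<rho> by (simp add: add_pos_nonneg)
    have "s * (1 / 16 * real N) / (1 + s * rho1 N L G P S) =
        s * real N ^ 2 / (16 * (real N + tr))"
    proof -
      have "real N + tr = real N * (1 + s * rho1 N L G P S)"
        by (simp add: tr_eq distrib_left mult_ac)
      then show ?thesis using pos d by (simp add: power2_eq_square)
    qed
    \<comment> \<open>Replacing the number of streams by \<open>N\<close> turns the total noise n +
      tr into N + tr, which is \<open>N\<close> times the denominator of the bound.\<close>
    also have "\<dots> \<le> s * real N ^ 2 / (16 * (real n + tr))"
      using s tr n_le n_pos by (intro divide_left_mono mult_left_mono mult_pos_pos add_pos_nonneg) auto
    also have "\<dots> = (s * real N ^ 2 / 8) / (2 * (real n + tr))" by simp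
    also have "s * real N ^ 2 / 8 = P * a" by (simp add: a_def s_def mult_ac)
    also have "P * a / (2 * (real n + tr)) = P * a / n / (2 + 2 * tr / n)"
    proof -
      have "real n * (2 + 2 * tr / n) = 2 * (real n + tr)" using n_pos by (simp add: distrib_left)
      then show ?thesis by (simp only: divide_divide_eq_left)
    qed
    finally show ?thesis .
  qed
  have arg0: "0 \<le> s * (1 / 16 * real N) / (1 + s * rho1 N L G P S)"
    using s \<rho> by simp
  have "m / (12288 * K) * log 2 (1 + s * (1 / 16 * real N) / (1 + s * rho1 N L G P S)) \<le>
      real n / 96 * log 2 (1 + P * a / n / (2 + 2 * tr / n))"
  proof (rule mult_mono)
    show "m / (12288 * K) \<le> real n / 96" using n_ge by simp
    show "log 2 (1 + s * (1 / 16 * real N) / (1 + s * rho1 N L G P S)) \<le> log 2 (1 + P * a / n / (2 + 2 * tr / n))"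
      using arg arg0 by (subst log_le_cancel_iff) linarith+
    show "0 \<le> log 2 (1 + s * (1 / 16 * real N) / (1 + s * rho1 N L G P S))"
      using arg0 by (subst zero_le_log_cancel_iff) linarith+
  qed simp
  with cap show ?thesis by (meson ereal_less_eq(3) order_trans)
qed

section \<open>Reduction of the stated bound to a rate without \<delta>\<close>

lemma rate_bound_le:
  fixes s \<rho>1 \<rho>2 M \<delta> K1 K2 :: real and N :: nat
  assumes pos: "0 < N" "0 < s" "0 \<le> \<rho>1" "0 \<le> \<rho>2" "1 \<le> M" "0 < K1" "0 < K2" and \<delta>: "0 \<le> \<delta>" "\<delta> \<le> 1"
  shows "real N * (\<delta>\<^sup>2 * (\<rho>1 + K1 * real N)\<^sup>2 / (sqrt \<rho>2 + sqrt (K2 * max (real N ^ 2) (real N ^ 3 / M)))\<^sup>2) *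
      log 2 (1 + s * ((1 - \<delta>) * K1 * real N - \<delta> * \<rho>1) / (1 + s * \<rho>1))
    \<le> K1\<^sup>2 / K2 * min (real N) M * log 2 (1 + s * (K1 * real N) / (1 + s * \<rho>1))"
proof -
  define X where "X = K2 * max (real N ^ 2) (real N ^ 3 / M)"
  define b where "b = (1 - \<delta>) * K1 * real N - \<delta> * \<rho>1"
  have d: "0 < 1 + s * \<rho>1" using pos by (simp add: add_pos_nonneg)
  have m: "0 < min (real N) M" using pos by simp
  have X_eq: "X = K2 * real N ^ 3 / min (real N) M"
  proof (cases "real N \<le> M")
    case True
    then have "real N ^ 3 / M \<le> real N ^ 2"
      using pos by (simp add: divide_le_eq power3_eq_cube power2_eq_square mult_left_mono)
    with True pos show ?thesis
      by (simp add: X_def max_def min_def power3_eq_cube power2_eq_square)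
  next
    case False
    then have "real N ^ 2 \<le> real N ^ 3 / M"
      using pos by (simp add: le_divide_eq power3_eq_cube power2_eq_square mult_left_mono)
    with False show ?thesis by (simp add: X_def max_def min_def)
  qed
  have X: "0 < X" using pos m by (simp add: X_eq)
  have "0 \<le> s * (K1 * real N) / (1 + s * \<rho>1)" using pos d by simp
  then have rhs: "0 \<le> log 2 (1 + s * (K1 * real N) / (1 + s * \<rho>1))"
    by (subst zero_le_log_cancel_iff) linarith+
  \<comment> \<open>In this form the argument of the logarithm is visibly positive, even where
    \<open>b\<close> is negative.\<close>
  have arg_eq: "1 + s * b / (1 + s * \<rho>1) = (1 + s * ((1 - \<delta>) * (\<rho>1 + K1 * real N))) / (1 + s * \<rho>1)"
    using d by (simp add: b_def field_simps)
  have "0 \<le> s * ((1 - \<delta>) * (\<rho>1 + K1 * real N))" using pos \<delta> by simp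
  then have arg: "0 < 1 + s * b / (1 + s * \<rho>1)"
    unfolding arg_eq using d by (intro divide_pos_pos) auto
  let ?pre = "real N * (\<delta>\<^sup>2 * (\<rho>1 + K1 * real N)\<^sup>2 / (sqrt \<rho>2 + sqrt X)\<^sup>2)"
  have "?pre * log 2 (1 + s * b / (1 + s * \<rho>1)) \<le>
      K1\<^sup>2 / K2 * min (real N) M * log 2 (1 + s * (K1 * real N) / (1 + s * \<rho>1))"
  proof (cases "0 \<le> b")
    case False
    then have "s * b / (1 + s * \<rho>1) \<le> 0"
      using pos d by (simp add: divide_le_0_iff mult_le_0_iff)
    then have "log 2 (1 + s * b / (1 + s * \<rho>1)) \<le> 0"
      using arg by (subst log_le_zero_cancel_iff) auto
    then have "?pre * log 2 (1 + s * b / (1 + s * \<rho>1)) \<le> 0"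
      by (intro mult_nonneg_nonpos) auto
    also have "0 \<le> K1\<^sup>2 / K2 * min (real N) M * log 2 (1 + s * (K1 * real N) / (1 + s * \<rho>1))"
      using pos m rhs by (intro mult_nonneg_nonneg) auto
    finally show ?thesis .
  next
    case True
    then have \<delta>_le: "\<delta> * (\<rho>1 + K1 * real N) \<le> K1 * real N"
      by (simp add: b_def algebra_simps)
    have "(\<delta> * (\<rho>1 + K1 * real N))\<^sup>2 \<le> (K1 * real N)\<^sup>2"
      using \<delta>_le pos \<delta> by (intro power_mono mult_nonneg_nonneg) auto
    moreover have "X \<le> (sqrt \<rho>2 + sqrt X)\<^sup>2"
    proof -
      have "(sqrt X)\<^sup>2 \<le> (sqrt \<rho>2 + sqrt X)\<^sup>2" using pos X by (intro power_mono) auto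
      then show ?thesis using X by simp
    qed
    ultimately have "\<delta>\<^sup>2 * (\<rho>1 + K1 * real N)\<^sup>2 / (sqrt \<rho>2 + sqrt X)\<^sup>2 \<le> (K1 * real N)\<^sup>2 / X"
      unfolding power_mult_distrib[symmetric] using X by (intro frac_le) auto
    then have "?pre \<le> real N * ((K1 * real N)\<^sup>2 / X)" by (rule mult_left_mono) simp
    also have "\<dots> = K1\<^sup>2 / K2 * min (real N) M"
      using pos m by (simp add: X_eq field_simps power2_eq_square power3_eq_cube)
    finally have pre: "?pre \<le> K1\<^sup>2 / K2 * min (real N) M" .
    have "b \<le> K1 * real N"
    proof -
      have "b = K1 * real N - \<delta> * (\<rho>1 + K1 * real N)" by (simp add: b_def algebra_simps)
      moreover have "0 \<le> \<delta> * (\<rho>1 + K1 * real N)" using pos \<delta> by simp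
      ultimately show ?thesis by simp
    qed
    then have "s * b / (1 + s * \<rho>1) \<le> s * (K1 * real N) / (1 + s * \<rho>1)"
      using pos d by (intro divide_right_mono mult_left_mono) auto
    then have log_le: "log 2 (1 + s * b / (1 + s * \<rho>1)) \<le> log 2 (1 + s * (K1 * real N) / (1 + s * \<rho>1))"
      using arg by (subst log_le_cancel_iff) linarith+
    have "0 \<le> s * b / (1 + s * \<rho>1)" using True pos d by simp
    then have "0 \<le> log 2 (1 + s * b / (1 + s * \<rho>1))"
      by (subst zero_le_log_cancel_iff) linarith+
    moreover have "0 \<le> K1\<^sup>2 / K2 * min (real N) M" using pos m by simp
    ultimately show ?thesis by (intro mult_mono[OF pre log_le])
  qed
  then show ?thesis unfolding X_def b_def .
qed

text \<open>A covariance matrix is Hermitian, so the trace of its square is its squared Frobenius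
  norm.\<close>

lemma rho2_nonneg:
  assumes cov: "has_covariance N nu S"
  shows "0 \<le> rho2 N L G P S"
proof -
  have herm: "S l i = cnj (S i l)" if "i < N" "l < N" for i l
  proof -
    let ?d = "\<lambda>i w. w i - (\<integral>v. v i \<partial>nu)"
    have "S l i = (\<integral>w. ?d l w * cnj (?d i w) \<partial>nu)"
      using cov that by (simp add: has_covariance_def)
    also have "\<dots> = (\<integral>w. cnj (?d i w * cnj (?d l w)) \<partial>nu)"
      by (simp only: complex_cnj_mult complex_cnj_cnj mult.commute)
    also have "\<dots> = cnj (\<integral>w. ?d i w * cnj (?d l w) \<partial>nu)"
      by (rule Bochner_Integration.integral_cnj)
    also have "(\<integral>w. ?d i w * cnj (?d l w) \<partial>nu) = S i l"
      using cov that by (simp add: has_covariance_def)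
    finally show ?thesis .
  qed
  have "Re (mat_trace N (mat_prod N S S)) = (\<Sum>i<N. \<Sum>l<N. (cmod (S i l))\<^sup>2)"
    unfolding mat_trace_def mat_prod_def Re_sum
  proof (intro sum.cong refl)
    fix i l assume "i \<in> {..<N}" "l \<in> {..<N}"
    then have "S i l * S l i = complex_of_real ((cmod (S i l))\<^sup>2)"
      using herm[of i l] by (simp add: complex_norm_square del: of_real_power)
    then show "Re (S i l * S l i) = (cmod (S i l))\<^sup>2" by simp
  qed
  then have "0 \<le> Re (mat_trace N (mat_prod N S S))" by (simp add: sum_nonneg)
  then show ?thesis unfolding rho2_def by simp
qed

section \<open>Oscillatory integrals along the receiving square\<close>

text \<open>
  A quantitative nonstationary phase estimate. Along the line, the derivative of the path
  difference \<open>d1 - d2\<close> is \<open>l / (d1 * d2 * V)\<close> with \<open>l\<close> affine and \<open>V\<close> slowly varying;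
  integrating by parts against \<open>l / (l\<^sup>2 + \<tau>\<^sup>2)\<close> instead of \<open>1 / l\<close> avoids cutting out the
  stationary point.
\<close>

lemma path_difference_integral_bound:
  fixes X1 X2 y1 y2 L D k \<tau> R lo hi A T :: real
  assumes L: "0 < L" and D: "0 < D" "2 * D \<le> L" and hi: "hi = lo + D" and k: "k \<noteq> 0"
    and X: "L / 2 \<le> X1" "X1 \<le> 3 / 2 * L" "L / 2 \<le> X2" "X2 \<le> 3 / 2 * L"
    and y: "\<And>u. u \<in> {lo..hi} \<Longrightarrow> \<bar>u - y1\<bar> \<le> D" "\<And>u. u \<in> {lo..hi} \<Longrightarrow> \<bar>u - y2\<bar> \<le> D"
  defines "d1 \<equiv> \<lambda>u. sqrt (X1\<^sup>2 + (u - y1)\<^sup>2)" and "d2 \<equiv> \<lambda>u. sqrt (X2\<^sup>2 + (u - y2)\<^sup>2)"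
    and "l \<equiv> \<lambda>u. (u - y1) * X2 - (u - y2) * X1"
  defines "w \<equiv> \<lambda>u. (l u)\<^sup>2 + \<tau>\<^sup>2"
  assumes w: "\<And>u. u \<in> {lo..hi} \<Longrightarrow> 0 < w u"
    and R: "\<And>u. u \<in> {lo..hi} \<Longrightarrow> \<bar>l u\<bar> / w u \<le> R"
    and A: "integral {lo..hi} (\<lambda>u. \<bar>X2 - X1\<bar> / w u) \<le> A"
    and T: "integral {lo..hi} (\<lambda>u. \<tau>\<^sup>2 / w u) \<le> T"
  shows "norm (integral {lo..hi} (\<lambda>u. of_real (L\<^sup>2 / (d1 u * d2 u)) * exp (\<i> * of_real (k * (d1 u - d2 u)))))
    \<le> L\<^sup>2 / \<bar>k\<bar> * (8 * R + 12 * D * R / L + 4 * A) + 4 * T"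
proof -
  define s where "s = (if k > 0 then 1 else -1 :: real)"
  \<comment> \<open>Let \<theta>1 have sine (u - y1) / d1 and cosine X1 / d1, and \<theta>2
    likewise. The derivative of the path difference is sin \<theta>1 - sin \<theta>2, whereas l /
    (d1 d2) = sin (\<theta>1 - \<theta>2). The second divided by the first is \<open>V\<close>, that
    is (1 + cos (\<theta>1 - \<theta>2)) / (cos \<theta>1 + cos \<theta>2), which stays regular at
    stationary points.\<close>
  define num where "num u = d1 u * d2 u + X1 * X2 + (u - y1) * (u - y2)" for u
  define den where "den u = X1 * d2 u + X2 * d1 u" for u
  define V where "V u = num u / den u" for u
  define num' where "num' u = (u - y1) / d1 u * d2 u + d1 u * ((u - y2) / d2 u) + ((u - y1) + (u - y2))" for u
  define den' where "den' u = X1 * ((u - y2) / d2 u) + X2 * ((u - y1) / d1 u)" for u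
  define V' where "V' u = num' u / den u - V u * (den' u / den u)" for u
  define \<rho> where "\<rho> u = l u / w u" for u
  define \<rho>' where "\<rho>' u = (X2 - X1) * (\<tau>\<^sup>2 - (l u)\<^sup>2) / (w u)\<^sup>2" for u
  define \<phi> where "\<phi> u = d1 u - d2 u" for u
  define \<phi>' where "\<phi>' u = (u - y1) / d1 u - (u - y2) / d2 u" for u
  define e where "e u = exp (\<i> * of_real (k * \<phi> u))" for u :: real
  define g where "g u = L\<^sup>2 / (d1 u * d2 u)" for u
  \<comment> \<open>The usual integration by parts would take g e / (\<i> k \<phi>'), which equals
    L^2 V e / (\<i> k l). Here l / w replaces 1 / l; the price is the error term g \<tau>^2 /
    w.\<close>
  define \<Psi> where "\<Psi> u = of_real (V u * \<rho> u) * e u * (of_real (L\<^sup>2) / (\<i> * of_real k))" for u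
  define \<Psi>' where "\<Psi>' u = (of_real (V u * \<rho> u) * (\<i> * of_real (k * \<phi>' u) * e u)
      + of_real (V' u * \<rho> u + V u * \<rho>' u) * e u) * (of_real (L\<^sup>2) / (\<i> * of_real k))" for u
  have X0: "0 < X1" "0 < X2" using X L by auto
  have d1_pos: "0 < d1 u" and d2_pos: "0 < d2 u" for u
    unfolding d1_def d2_def using X0 by (auto intro!: add_pos_nonneg)
  have d1_sq: "(d1 u)\<^sup>2 = X1\<^sup>2 + (u - y1)\<^sup>2" and d2_sq: "(d2 u)\<^sup>2 = X2\<^sup>2 + (u - y2)\<^sup>2" for u
    unfolding d1_def d2_def by auto
  have X_le: "X1 \<le> d1 u" "X2 \<le> d2 u" for u
    unfolding d1_def d2_def using X0 by (auto intro!: real_le_rsqrt)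
  have u_le: "\<bar>u - y1\<bar> \<le> d1 u" "\<bar>u - y2\<bar> \<le> d2 u" for u
    unfolding d1_def d2_def by (auto intro!: real_le_rsqrt)
  have d_upper: "d1 u \<le> 2 * L" "d2 u \<le> 2 * L" if "u \<in> {lo..hi}" for u
  proof -
    have "d1 u \<le> X1 + \<bar>u - y1\<bar>" "d2 u \<le> X2 + \<bar>u - y2\<bar>"
      unfolding d1_def d2_def using sqrt_sum_squares_le_sum_abs[of X1 "u - y1"]
        sqrt_sum_squares_le_sum_abs[of X2 "u - y2"] X0 by simp_all
    then show "d1 u \<le> 2 * L" "d2 u \<le> 2 * L" using y[OF that] X D by linarith+
  qed
  have den_ge: "L / 2 * (d1 u + d2 u) \<le> den u" for u
  proof -
    have "L / 2 * d2 u \<le> X1 * d2 u" "L / 2 * d1 u \<le> X2 * d1 u"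
      using X d1_pos[of u] d2_pos[of u] by (auto intro!: mult_right_mono)
    then show ?thesis by (simp add: den_def distrib_left)
  qed
  have den_pos: "0 < den u" for u
    using den_ge[of u] L d1_pos[of u] d2_pos[of u]
    by (smt (verit) half_gt_zero mult_pos_pos add_pos_pos)
  have key: "\<phi>' u * V u = l u / (d1 u * d2 u)" for u
  proof -
    have "((u - y1) * d2 u - (u - y2) * d1 u) * num u = l u * den u"
    proof -
      define a b p q where "a = u - y1" and "b = u - y2" and "p = d1 u" and "q = d2 u"
      have pq: "p * p = X1 * X1 + a * a" "q * q = X2 * X2 + b * b"
        using d1_sq[of u] d2_sq[of u] by (simp_all add: a_def b_def p_def q_def power2_eq_square)
      have "(a * q - b * p) * (p * q + X1 * X2 + a * b) =
          a * p * (q * q) - b * q * (p * p) + a * q * X1 * X2 + a * a * b * q - b * p * X1 * X2 - a * b * b * p"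
        by (simp add: algebra_simps)
      also have "\<dots> = (a * X2 - b * X1) * (X1 * q + X2 * p)"
        unfolding pq by (simp add: algebra_simps)
      finally show ?thesis
        unfolding num_def den_def l_def a_def b_def p_def q_def .
    qed
    moreover have "\<phi>' u = ((u - y1) * d2 u - (u - y2) * d1 u) / (d1 u * d2 u)"
      using d1_pos[of u] d2_pos[of u] by (simp add: \<phi>'_def diff_divide_distrib)
    ultimately show ?thesis
      using den_pos[of u] by (simp only: V_def times_divide_times_eq) simp
  qed
  have V_le: "\<bar>V u\<bar> \<le> 4" if "u \<in> {lo..hi}" for u
  proof -
    have "\<bar>X1 * X2 + (u - y1) * (u - y2)\<bar> \<le> d1 u * d2 u"
    proof -
      have "(X1 * X2 + (u - y1) * (u - y2))\<^sup>2 \<le> (d1 u * d2 u)\<^sup>2"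
        unfolding power_mult_distrib d1_sq d2_sq
        using zero_le_power2[of "X1 * (u - y2) - X2 * (u - y1)"] by (simp add: power2_eq_square algebra_simps)
      then show ?thesis using d1_pos[of u] d2_pos[of u] by (simp add: power2_le_iff_abs_le)
    qed
    then have "\<bar>num u\<bar> \<le> 2 * (d1 u * d2 u)"
      using d1_pos[of u] d2_pos[of u] unfolding num_def
      by (smt (verit) mult_pos_pos)
    also have "\<dots> \<le> 4 * (L / 2 * (d1 u + d2 u))"
    proof -
      have "4 * (d1 u * d2 u) \<le> (d1 u + d2 u) * (d1 u + d2 u)"
        using zero_le_power2[of "d1 u - d2 u"] by (simp add: power2_eq_square algebra_simps)
      also have "\<dots> \<le> (4 * L) * (d1 u + d2 u)"
        using d_upper[OF that] d1_pos[of u] d2_pos[of u] by (intro mult_right_mono) auto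
      finally show ?thesis by simp
    qed
    also have "\<dots> \<le> 4 * den u" using den_ge[of u] by simp
    finally show ?thesis using den_pos[of u] by (simp add: V_def pos_divide_le_eq)
  qed
  have V'_le: "\<bar>V' u\<bar> \<le> 12 / L" if "u \<in> {lo..hi}" for u
  proof -
    have q: "\<bar>(u - y1) / d1 u\<bar> \<le> 1" "\<bar>(u - y2) / d2 u\<bar> \<le> 1"
      using u_le[of u] d1_pos[of u] d2_pos[of u] by simp_all
    have abs4: "\<bar>a + b + (c + d)\<bar> \<le> 2 * (p + q)"
      if "\<bar>a\<bar> \<le> q" "\<bar>b\<bar> \<le> p" "\<bar>c\<bar> \<le> p" "\<bar>d\<bar> \<le> q" for a b c d p q :: real
      using that by (simp add: abs_le_iff)
    have shrink: "\<bar>c * p\<bar> \<le> c" if "\<bar>p\<bar> \<le> 1" "0 \<le> c" for c p :: real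
      using mult_left_mono[OF that] that by (simp add: abs_mult)
    have "\<bar>(u - y1) / d1 u * d2 u\<bar> \<le> d2 u" "\<bar>d1 u * ((u - y2) / d2 u)\<bar> \<le> d1 u"
      using shrink[OF q(1), of "d2 u"] shrink[OF q(2), of "d1 u"] d1_pos[of u] d2_pos[of u]
      by (simp_all only: mult.commute less_imp_le)
    then have "\<bar>num' u\<bar> \<le> 2 * (d1 u + d2 u)"
      unfolding num'_def using u_le[of u] by (rule abs4)
    also have "\<dots> \<le> 4 / L * den u"
      using mult_left_mono[OF den_ge[of u], of "4 / L"] L by simp
    finally have 1: "\<bar>num' u / den u\<bar> \<le> 4 / L"
      using den_pos[of u] by (simp add: pos_divide_le_eq)
    have "\<bar>X1 * ((u - y2) / d2 u)\<bar> \<le> X1" "\<bar>X2 * ((u - y1) / d1 u)\<bar> \<le> X2"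
      using shrink[OF q(2), of X1] shrink[OF q(1), of X2] X0 by simp_all
    then have "\<bar>den' u\<bar> \<le> d1 u + d2 u"
      unfolding den'_def using X_le[of u]
      by (intro order_trans[OF abs_triangle_ineq]) (intro add_mono; erule order_trans)
    also have "\<dots> \<le> 2 / L * den u"
      using mult_left_mono[OF den_ge[of u], of "2 / L"] L by simp
    finally have "\<bar>den' u / den u\<bar> \<le> 2 / L"
      using den_pos[of u] by (simp add: pos_divide_le_eq)
    then have "\<bar>V u * (den' u / den u)\<bar> \<le> 4 * (2 / L)"
      unfolding abs_mult using V_le[OF that] by (intro mult_mono) auto
    with 1 have "\<bar>V' u\<bar> \<le> 4 / L + 4 * (2 / L)"
      unfolding V'_def by (intro order_trans[OF abs_triangle_ineq4] add_mono)
    then show ?thesis by simp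
  qed
  have \<rho>_le: "\<bar>\<rho> u\<bar> \<le> R" if "u \<in> {lo..hi}" for u
    using R[OF that] w[OF that] by (simp add: \<rho>_def)
  have \<rho>'_le: "\<bar>\<rho>' u\<bar> \<le> \<bar>X2 - X1\<bar> / w u" if "u \<in> {lo..hi}" for u
  proof -
    have "\<bar>\<tau>\<^sup>2 - (l u)\<^sup>2\<bar> \<le> w u" unfolding w_def by (simp add: abs_le_iff)
    then have "\<bar>X2 - X1\<bar> * \<bar>\<tau>\<^sup>2 - (l u)\<^sup>2\<bar> / (w u)\<^sup>2 \<le> \<bar>X2 - X1\<bar> * w u / (w u)\<^sup>2"
      by (intro divide_right_mono mult_left_mono) auto
    also have "\<dots> = \<bar>X2 - X1\<bar> / w u" using w[OF that] by (simp add: power2_eq_square)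
    finally show ?thesis by (simp add: \<rho>'_def abs_mult)
  qed
  have g_le: "0 \<le> g u" "g u \<le> 4" for u
  proof -
    have "L / 2 * (L / 2) \<le> d1 u * d2 u"
      using X_le[of u] X L by (intro mult_mono) auto
    then show "g u \<le> 4" "0 \<le> g u" using d1_pos[of u] d2_pos[of u]
      by (simp_all add: g_def divide_le_eq power2_eq_square less_imp_le)
  qed
  have half_cancel: "inverse s / 2 * (2 * z) = z / s" for s z :: real
    by (simp add: inverse_eq_divide)
  have dd1: "(d1 has_real_derivative (u - y1) / d1 u) (at u)" for u
  proof -
    have sq: "((\<lambda>u. X1\<^sup>2 + (u - y1)\<^sup>2) has_real_derivative 2 * (u - y1)) (at u)"
      by (auto intro!: derivative_eq_intros)
    have "((\<lambda>u. sqrt (X1\<^sup>2 + (u - y1)\<^sup>2)) has_real_derivative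
        inverse (sqrt (X1\<^sup>2 + (u - y1)\<^sup>2)) / 2 * (2 * (u - y1))) (at u)"
      by (rule DERIV_chain2[where f=sqrt, OF DERIV_real_sqrt sq]) (use d1_pos[of u] in \<open>simp add: d1_def\<close>)
    then show ?thesis unfolding d1_def half_cancel .
  qed
  have dd2: "(d2 has_real_derivative (u - y2) / d2 u) (at u)" for u
  proof -
    have sq: "((\<lambda>u. X2\<^sup>2 + (u - y2)\<^sup>2) has_real_derivative 2 * (u - y2)) (at u)"
      by (auto intro!: derivative_eq_intros)
    have "((\<lambda>u. sqrt (X2\<^sup>2 + (u - y2)\<^sup>2)) has_real_derivative
        inverse (sqrt (X2\<^sup>2 + (u - y2)\<^sup>2)) / 2 * (2 * (u - y2))) (at u)"
      by (rule DERIV_chain2[where f=sqrt, OF DERIV_real_sqrt sq]) (use d2_pos[of u] in \<open>simp add: d2_def\<close>)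
    then show ?thesis unfolding d2_def half_cancel .
  qed
  have dV: "(V has_real_derivative V' u) (at u)" for u
  proof -
    have n: "(num has_real_derivative num' u) (at u)"
      unfolding num_def num'_def by (auto intro!: derivative_eq_intros dd1 dd2)
    have d: "(den has_real_derivative den' u) (at u)"
      unfolding den_def den'_def by (auto intro!: derivative_eq_intros dd1 dd2 simp: mult.commute)
    have "((\<lambda>u. num u / den u) has_real_derivative (num' u * den u - num u * den' u) / (den u * den u)) (at u)"
      using DERIV_divide[OF n d] den_pos[of u] by simp
    moreover have "(num' u * den u - num u * den' u) / (den u * den u) = V' u"
      using den_pos[of u] by (simp add: V'_def V_def field_simps)
    ultimately show ?thesis unfolding V_def[abs_def] by simp
  qed
  have d\<rho>: "(\<rho> has_real_derivative \<rho>' u) (at u)" if "u \<in> {lo..hi}" for u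
  proof -
    have l: "(l has_real_derivative (X2 - X1)) (at u)"
      unfolding l_def by (auto intro!: derivative_eq_intros)
    have ww: "(w has_real_derivative 2 * l u * (X2 - X1)) (at u)"
      unfolding w_def by (auto intro!: derivative_eq_intros l)
    have "((\<lambda>u. l u / w u) has_real_derivative ((X2 - X1) * w u - l u * (2 * l u * (X2 - X1))) / (w u * w u)) (at u)"
      using DERIV_divide[OF l ww] w[OF that] by simp
    moreover have "((X2 - X1) * w u - l u * (2 * l u * (X2 - X1))) / (w u * w u) = \<rho>' u"
      unfolding \<rho>'_def power2_eq_square[of "w u"]
      by (rule arg_cong2[where f="(/)"]) (simp_all add: w_def power2_eq_square algebra_simps)
    ultimately show ?thesis unfolding \<rho>_def[abs_def] by simp
  qed
  have de: "(e has_vector_derivative (\<i> * of_real (k * \<phi>' u) * e u)) (at u)" for u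
  proof -
    have r: "((\<lambda>u. k * \<phi> u) has_real_derivative k * \<phi>' u) (at u)"
      unfolding \<phi>_def \<phi>'_def by (auto intro!: derivative_eq_intros dd1 dd2)
    have "((\<lambda>u. \<i> * of_real (k * \<phi> u)) has_vector_derivative \<i> * of_real (k * \<phi>' u)) (at u)"
      using r by (intro has_vector_derivative_mult_right has_vector_derivative_of_real)
    from field_vector_diff_chain_at[OF this DERIV_exp]
    show ?thesis by (simp add: comp_def e_def[abs_def] mult_ac)
  qed
  have d\<Psi>: "(\<Psi> has_vector_derivative \<Psi>' u) (at u)" if "u \<in> {lo..hi}" for u
  proof -
    have "((\<lambda>u. V u * \<rho> u) has_real_derivative V' u * \<rho> u + V u * \<rho>' u) (at u)"
      using DERIV_mult[OF dV d\<rho>[OF that]] by (simp add: mult.commute)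
    then have 1: "((\<lambda>u. complex_of_real (V u * \<rho> u)) has_vector_derivative of_real (V' u * \<rho> u + V u * \<rho>' u)) (at u)"
      by (rule has_vector_derivative_of_real)
    have "((\<lambda>u. complex_of_real (V u * \<rho> u) * e u) has_vector_derivative
        of_real (V u * \<rho> u) * (\<i> * of_real (k * \<phi>' u) * e u) + of_real (V' u * \<rho> u + V u * \<rho>' u) * e u) (at u)"
      by (rule has_vector_derivative_mult[OF 1 de])
    from has_vector_derivative_mult_left[OF this, of "of_real (L\<^sup>2) / (\<i> * of_real k)"]
    show ?thesis unfolding \<Psi>_def[abs_def] \<Psi>'_def .
  qed
  have lohi: "lo \<le> hi" using hi D by simp
  have int\<Psi>: "(\<Psi>' has_integral (\<Psi> hi - \<Psi> lo)) {lo..hi}"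
    by (rule fundamental_theorem_of_calculus[OF lohi has_vector_derivative_at_within[OF d\<Psi>]])
  have cont: "continuous_on {lo..hi} d1" "continuous_on {lo..hi} d2"
    unfolding d1_def d2_def by (intro continuous_intros)+
  have intf: "(\<lambda>u. of_real (g u) * e u) integrable_on {lo..hi}"
    unfolding g_def e_def \<phi>_def using d1_pos d2_pos
    by (intro integrable_continuous_interval continuous_intros cont) (simp_all add: less_imp_neq[THEN not_sym])
  have contw: "continuous_on {lo..hi} w" unfolding w_def l_def by (intro continuous_intros)
  have w0: "\<forall>u\<in>{lo..hi}. w u \<noteq> 0" using w by force
  \<comment> \<open>The three terms stem from g \<tau>^2 / w, from V' \<rho> and from V \<rho>'. The
    two boundary values of \<open>\<Psi>\<close> later add 8 R.\<close>
  define bd where "bd u = 4 * (\<tau>\<^sup>2 / w u) + L\<^sup>2 / \<bar>k\<bar> * (12 / L * R + 4 * (\<bar>X2 - X1\<bar> / w u))" for u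
  have i1: "(\<lambda>u. \<tau>\<^sup>2 / w u) integrable_on {lo..hi}" and i2: "(\<lambda>u. \<bar>X2 - X1\<bar> / w u) integrable_on {lo..hi}"
    using w0 by (intro integrable_continuous_interval continuous_intros contw; simp)+
  have intbd: "(bd has_integral (4 * integral {lo..hi} (\<lambda>u. \<tau>\<^sup>2 / w u) +
      L\<^sup>2 / \<bar>k\<bar> * (12 / L * R * D + 4 * integral {lo..hi} (\<lambda>u. \<bar>X2 - X1\<bar> / w u)))) {lo..hi}"
  proof -
    have c: "((\<lambda>u. 12 / L * R) has_integral (12 / L * R * D)) {lo..hi}"
      using has_integral_const_real[of "12 / L * R" lo hi] hi D by (simp add: mult.commute)
    show ?thesis unfolding bd_def
      by (intro has_integral_add has_integral_mult_right c integrable_integral i1 i2)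
  qed
  have diff_le: "norm (of_real (g u) * e u - \<Psi>' u) \<le> bd u" if u: "u \<in> {lo..hi}" for u
  proof -
    have "of_real (V u * \<rho> u) * (\<i> * of_real (k * \<phi>' u) * e u) * (of_real (L\<^sup>2) / (\<i> * of_real k)) =
        of_real (L\<^sup>2 * (\<phi>' u * V u) * \<rho> u) * e u"
      using k by (simp add: field_simps)
    also have "L\<^sup>2 * (\<phi>' u * V u) * \<rho> u = g u * ((l u)\<^sup>2 / w u)"
      by (simp add: key g_def \<rho>_def power2_eq_square)
    finally have "of_real (g u) * e u - \<Psi>' u = of_real (g u * (1 - (l u)\<^sup>2 / w u)) * e u -
        of_real (V' u * \<rho> u + V u * \<rho>' u) * e u * (of_real (L\<^sup>2) / (\<i> * of_real k))"
      unfolding \<Psi>'_def distrib_right by (simp add: algebra_simps)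
    also have "1 - (l u)\<^sup>2 / w u = \<tau>\<^sup>2 / w u"
    proof -
      have "1 - (l u)\<^sup>2 / w u = (w u - (l u)\<^sup>2) / w u" using w[OF u] by (simp add: diff_divide_distrib)
      then show ?thesis by (simp add: w_def)
    qed
    finally have "norm (of_real (g u) * e u - \<Psi>' u) \<le> norm (of_real (g u * (\<tau>\<^sup>2 / w u)) * e u) +
        norm (of_real (V' u * \<rho> u + V u * \<rho>' u) * e u * (of_real (L\<^sup>2) / (\<i> * of_real k)))"
      by (simp only: norm_triangle_ineq4)
    also have "\<dots> = g u * (\<tau>\<^sup>2 / w u) + \<bar>V' u * \<rho> u + V u * \<rho>' u\<bar> * (L\<^sup>2 / \<bar>k\<bar>)"
    proof -
      have "norm (e u) = 1" unfolding e_def by simp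
      then show ?thesis using g_le[of u] w[OF u]
        by (simp only: norm_mult norm_divide norm_of_real norm_ii mult_1_left mult_1_right)
           (simp add: abs_mult)
    qed
    also have "\<dots> \<le> 4 * (\<tau>\<^sup>2 / w u) + (12 / L * R + 4 * (\<bar>X2 - X1\<bar> / w u)) * (L\<^sup>2 / \<bar>k\<bar>)"
    proof (intro add_mono mult_right_mono)
      have "\<bar>V' u * \<rho> u\<bar> \<le> 12 / L * R" "\<bar>V u * \<rho>' u\<bar> \<le> 4 * (\<bar>X2 - X1\<bar> / w u)"
        unfolding abs_mult using V'_le[OF u] \<rho>_le[OF u] V_le[OF u] \<rho>'_le[OF u] L
        by (intro mult_mono; simp)+
      then show "\<bar>V' u * \<rho> u + V u * \<rho>' u\<bar> \<le> 12 / L * R + 4 * (\<bar>X2 - X1\<bar> / w u)"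
        by (intro order_trans[OF abs_triangle_ineq] add_mono)
    qed (use g_le w[OF u] in auto)
    finally show ?thesis by (simp add: bd_def mult.commute)
  qed
  have \<Psi>_le: "norm (\<Psi> u) \<le> L\<^sup>2 / \<bar>k\<bar> * (4 * R)" if "u \<in> {lo..hi}" for u
  proof -
    have "norm (\<Psi> u) = \<bar>V u\<bar> * \<bar>\<rho> u\<bar> * (L\<^sup>2 / \<bar>k\<bar>)"
    proof -
      have "norm (e u) = 1" unfolding e_def by simp
      then show ?thesis unfolding \<Psi>_def
        by (simp only: norm_mult norm_divide norm_of_real norm_ii mult_1_left mult_1_right)
           (simp add: abs_mult)
    qed
    also have "\<dots> \<le> 4 * R * (L\<^sup>2 / \<bar>k\<bar>)"
      using V_le[OF that] \<rho>_le[OF that] by (intro mult_right_mono mult_mono) auto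
    finally show ?thesis by (simp add: mult.commute)
  qed
  have diff_int: "((\<lambda>u. of_real (g u) * e u - \<Psi>' u) has_integral
      (integral {lo..hi} (\<lambda>u. of_real (g u) * e u) - (\<Psi> hi - \<Psi> lo))) {lo..hi}"
    by (intro has_integral_diff integrable_integral intf int\<Psi>)
  have "norm (integral {lo..hi} (\<lambda>u. of_real (g u) * e u) - (\<Psi> hi - \<Psi> lo)) \<le>
      4 * integral {lo..hi} (\<lambda>u. \<tau>\<^sup>2 / w u) +
      L\<^sup>2 / \<bar>k\<bar> * (12 / L * R * D + 4 * integral {lo..hi} (\<lambda>u. \<bar>X2 - X1\<bar> / w u))"
    using integral_norm_bound_integral[OF has_integral_integrable[OF diff_int] has_integral_integrable[OF intbd] diff_le]
    unfolding integral_unique[OF diff_int] integral_unique[OF intbd] .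
  also have "\<dots> \<le> 4 * T + L\<^sup>2 / \<bar>k\<bar> * (12 / L * R * D + 4 * A)"
  proof -
    have "12 / L * R * D + 4 * integral {lo..hi} (\<lambda>u. \<bar>X2 - X1\<bar> / w u) \<le> 12 / L * R * D + 4 * A"
      using A by simp
    then have "L\<^sup>2 / \<bar>k\<bar> * (12 / L * R * D + 4 * integral {lo..hi} (\<lambda>u. \<bar>X2 - X1\<bar> / w u)) \<le>
        L\<^sup>2 / \<bar>k\<bar> * (12 / L * R * D + 4 * A)"
      by (rule mult_left_mono) simp
    with T show ?thesis by (intro add_mono) auto
  qed
  finally have "norm (integral {lo..hi} (\<lambda>u. of_real (g u) * e u)) \<le>
      4 * T + L\<^sup>2 / \<bar>k\<bar> * (12 / L * R * D + 4 * A) + (norm (\<Psi> hi) + norm (\<Psi> lo))"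
    by (smt (verit) norm_triangle_ineq4 norm_triangle_sub)
  also have "norm (\<Psi> hi) + norm (\<Psi> lo) \<le> L\<^sup>2 / \<bar>k\<bar> * (4 * R) + L\<^sup>2 / \<bar>k\<bar> * (4 * R)"
    using lohi by (intro add_mono \<Psi>_le) auto
  finally show ?thesis
    unfolding g_def e_def \<phi>_def by (simp add: algebra_simps)
qed

text \<open>The antiderivative is an arctangent, which increases by at most \<pi> in total; hence
  the bound does not depend on the interval.\<close>

lemma integral_inverse_quadratic_le:
  fixes c b \<tau> lo hi :: real
  assumes "c \<noteq> 0" "0 < \<tau>" "lo \<le> hi"
  shows "integral {lo..hi} (\<lambda>u. 1 / ((c * u + b)\<^sup>2 + \<tau>\<^sup>2)) \<le> pi / (\<bar>c\<bar> * \<tau>)"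
proof -
  have cancel: "(inverse (q / \<tau>\<^sup>2) * (c / \<tau>)) / (c * \<tau>) = 1 / q" for q
    using assms by (simp add: power2_eq_square)
  have d: "((\<lambda>u. arctan ((c * u + b) / \<tau>) / (c * \<tau>)) has_real_derivative 1 / ((c * u + b)\<^sup>2 + \<tau>\<^sup>2)) (at u)" for u
  proof -
    have deriv: "((\<lambda>u. arctan ((c * u + b) / \<tau>) / (c * \<tau>)) has_real_derivative
        (inverse (1 + ((c * u + b) / \<tau>)\<^sup>2) * (c / \<tau>)) / (c * \<tau>)) (at u)"
      using assms by (auto intro!: derivative_eq_intros)
    have eq: "(inverse (1 + ((c * u + b) / \<tau>)\<^sup>2) * (c / \<tau>)) / (c * \<tau>) = 1 / ((c * u + b)\<^sup>2 + \<tau>\<^sup>2)"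
    proof -
      have "1 + ((c * u + b) / \<tau>)\<^sup>2 = ((c * u + b)\<^sup>2 + \<tau>\<^sup>2) / \<tau>\<^sup>2"
        unfolding power_divide using assms by (simp add: add_divide_distrib)
      then show ?thesis by (simp only: cancel)
    qed
    show ?thesis using deriv unfolding eq .
  qed
  have H: "((\<lambda>u. 1 / ((c * u + b)\<^sup>2 + \<tau>\<^sup>2)) has_integral
      (arctan ((c * hi + b) / \<tau>) / (c * \<tau>) - arctan ((c * lo + b) / \<tau>) / (c * \<tau>))) {lo..hi}"
    by (rule fundamental_theorem_of_calculus[OF assms(3) has_vector_derivative_at_within])
       (rule d[unfolded has_real_derivative_iff_has_vector_derivative])
  have "integral {lo..hi} (\<lambda>u. 1 / ((c * u + b)\<^sup>2 + \<tau>\<^sup>2)) =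
      (arctan ((c * hi + b) / \<tau>) - arctan ((c * lo + b) / \<tau>)) / (c * \<tau>)"
    unfolding integral_unique[OF H] diff_divide_distrib ..
  also have "\<dots> \<le> \<bar>arctan ((c * hi + b) / \<tau>) - arctan ((c * lo + b) / \<tau>)\<bar> / (\<bar>c\<bar> * \<tau>)"
    by (rule order_trans[OF abs_ge_self]) (use assms in \<open>simp only: abs_divide abs_mult abs_of_pos order_refl\<close>)
  also have "\<dots> \<le> pi / (\<bar>c\<bar> * \<tau>)"
  proof (intro divide_right_mono)
    show "\<bar>arctan ((c * hi + b) / \<tau>) - arctan ((c * lo + b) / \<tau>)\<bar> \<le> pi"
      using arctan_bounded[of "(c * hi + b) / \<tau>"] arctan_bounded[of "(c * lo + b) / \<tau>"]
      by (simp add: abs_le_iff)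
  qed (use assms in auto)
  finally show ?thesis .
qed

text \<open>The vertical offset dominates: \<open>l\<close> keeps a modulus of at least L |y2 - y1|
  / 4, so there is no stationary point and \<tau> = 0 is admissible. The constant is 72 = 4 (8 + 6 +
  4).\<close>

lemma path_difference_integral_steep:
  fixes X1 X2 y1 y2 L D k lo hi :: real
  assumes L: "0 < L" and D: "0 < D" "2 * D \<le> L" and hi: "hi = lo + D" and k: "k \<noteq> 0"
    and X: "L / 2 \<le> X1" "X1 \<le> 3 / 2 * L" "L / 2 \<le> X2" "X2 \<le> 3 / 2 * L"
    and y: "\<And>u. u \<in> {lo..hi} \<Longrightarrow> \<bar>u - y1\<bar> \<le> D" "\<And>u. u \<in> {lo..hi} \<Longrightarrow> \<bar>u - y2\<bar> \<le> D"
    and steep: "4 * D * \<bar>X2 - X1\<bar> \<le> L * \<bar>y2 - y1\<bar>" and ne: "y1 \<noteq> y2"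
  shows "norm (integral {lo..hi} (\<lambda>u. of_real (L\<^sup>2 / (sqrt (X1\<^sup>2 + (u - y1)\<^sup>2) * sqrt (X2\<^sup>2 + (u - y2)\<^sup>2))) *
      exp (\<i> * of_real (k * (sqrt (X1\<^sup>2 + (u - y1)\<^sup>2) - sqrt (X2\<^sup>2 + (u - y2)\<^sup>2))))))
    \<le> 72 * L / (\<bar>k\<bar> * \<bar>y2 - y1\<bar>)"
proof -
  define l where "l u = (u - y1) * X2 - (u - y2) * X1" for u
  define l0 where "l0 = L * \<bar>y2 - y1\<bar> / 4"
  have l0: "0 < l0" using L ne by (simp add: l0_def)
  have Dl0: "D * \<bar>X2 - X1\<bar> \<le> l0" using steep by (simp add: l0_def)
  have l_ge: "l0 \<le> \<bar>l u\<bar>" if "u \<in> {lo..hi}" for u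
  proof -
    have "l u = (y2 - y1) * X2 + (u - y2) * (X2 - X1)" by (simp add: l_def algebra_simps)
    then have "\<bar>(y2 - y1) * X2\<bar> - \<bar>(u - y2) * (X2 - X1)\<bar> \<le> \<bar>l u\<bar>" by linarith
    moreover have "L / 2 * \<bar>y2 - y1\<bar> \<le> \<bar>(y2 - y1) * X2\<bar>"
      unfolding abs_mult using X L by (subst mult.commute) (intro mult_left_mono, auto)
    moreover have "\<bar>(u - y2) * (X2 - X1)\<bar> \<le> D * \<bar>X2 - X1\<bar>"
      unfolding abs_mult using y(2)[OF that] by (intro mult_right_mono) auto
    ultimately show ?thesis using Dl0 unfolding l0_def by simp
  qed
  have w_ge: "l0\<^sup>2 \<le> (l u)\<^sup>2 + 0\<^sup>2" if "u \<in> {lo..hi}" for u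
    using l_ge[OF that] l0 power_mono[of l0 "\<bar>l u\<bar>" 2] by simp
  have lohi: "lo \<le> hi" using hi D by simp
  have "norm (integral {lo..hi} (\<lambda>u. of_real (L\<^sup>2 / (sqrt (X1\<^sup>2 + (u - y1)\<^sup>2) * sqrt (X2\<^sup>2 + (u - y2)\<^sup>2))) *
      exp (\<i> * of_real (k * (sqrt (X1\<^sup>2 + (u - y1)\<^sup>2) - sqrt (X2\<^sup>2 + (u - y2)\<^sup>2))))))
    \<le> L\<^sup>2 / \<bar>k\<bar> * (8 * (1 / l0) + 12 * D * (1 / l0) / L + 4 * (1 / l0)) + 4 * 0"
  proof (rule path_difference_integral_bound[OF L D hi k X y, where \<tau>=0], simp_all only: l_def[symmetric])
    fix u assume u: "u \<in> {lo..hi}"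
    have "0 < l0\<^sup>2" using l0 by simp
    then show pos: "0 < (l u)\<^sup>2 + 0\<^sup>2" using w_ge[OF u] by linarith
    have "\<bar>l u\<bar> / ((l u)\<^sup>2 + 0\<^sup>2) = 1 / \<bar>l u\<bar>"
      using pos by (simp add: power2_eq_square divide_simps flip: abs_mult)
    also have "\<dots> \<le> 1 / l0" using l_ge[OF u] l0 by (intro divide_left_mono) auto
    finally show "\<bar>l u\<bar> / ((l u)\<^sup>2 + 0\<^sup>2) \<le> 1 / l0" .
  next
    have cont: "continuous_on {lo..hi} (\<lambda>u. \<bar>X2 - X1\<bar> / ((l u)\<^sup>2 + 0\<^sup>2))"
    proof (intro continuous_intros)
      show "continuous_on {lo..hi} l" unfolding l_def by (intro continuous_intros)
      show "\<forall>u\<in>{lo..hi}. (l u)\<^sup>2 + 0\<^sup>2 \<noteq> 0" using l_ge l0 by fastforce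
    qed
    have "integral {lo..hi} (\<lambda>u. \<bar>X2 - X1\<bar> / ((l u)\<^sup>2 + 0\<^sup>2)) \<le> integral {lo..hi} (\<lambda>u. \<bar>X2 - X1\<bar> / l0\<^sup>2)"
    proof (rule integral_le[OF integrable_continuous_interval[OF cont] integrable_const_ivl])
      fix u assume u: "u \<in> {lo..hi}"
      have "0 < l0\<^sup>2" using l0 by simp
      then show "\<bar>X2 - X1\<bar> / ((l u)\<^sup>2 + 0\<^sup>2) \<le> \<bar>X2 - X1\<bar> / l0\<^sup>2"
        using w_ge[OF u] by (intro divide_left_mono mult_pos_pos) auto
    qed
    also have "\<dots> = D * \<bar>X2 - X1\<bar> / l0\<^sup>2" using hi D by simp
    also have "\<dots> \<le> l0 / l0\<^sup>2" using Dl0 by (intro divide_right_mono) auto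
    also have "\<dots> = 1 / l0" using l0 by (simp add: power2_eq_square)
    finally show "integral {lo..hi} (\<lambda>u. \<bar>X2 - X1\<bar> / ((l u)\<^sup>2 + 0\<^sup>2)) \<le> 1 / l0" .
  qed simp_all
  also have "\<dots> \<le> L\<^sup>2 / \<bar>k\<bar> * (18 / l0)"
  proof -
    have "12 * D * (1 / l0) / L \<le> 6 / l0"
      using D L l0 by (simp add: field_simps)
    then show ?thesis by (simp only: mult_zero_right add_0_right) (intro mult_left_mono; simp add: field_simps)
  qed
  also have "\<dots> = 72 * L / (\<bar>k\<bar> * \<bar>y2 - y1\<bar>)"
    using L by (simp add: l0_def power2_eq_square)
  finally show ?thesis .
qed

text \<open>A stationary point may lie on the line. The choice of \<open>\<tau>\<close> balances the
  terms of order L^2 / (|k| \<tau>) from integrating by parts against the contribution of order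
  \<tau> / |X2 - X1| near that point; the result has the square-root decay of stationary
  phase.\<close>

lemma path_difference_integral_flat:
  fixes X1 X2 y1 y2 L D k lo hi :: real
  assumes L: "0 < L" and D: "0 < D" "2 * D \<le> L" and hi: "hi = lo + D" and k: "k \<noteq> 0"
    and X: "L / 2 \<le> X1" "X1 \<le> 3 / 2 * L" "L / 2 \<le> X2" "X2 \<le> 3 / 2 * L"
    and y: "\<And>u. u \<in> {lo..hi} \<Longrightarrow> \<bar>u - y1\<bar> \<le> D" "\<And>u. u \<in> {lo..hi} \<Longrightarrow> \<bar>u - y2\<bar> \<le> D"
    and ne: "X1 \<noteq> X2"
  shows "norm (integral {lo..hi} (\<lambda>u. of_real (L\<^sup>2 / (sqrt (X1\<^sup>2 + (u - y1)\<^sup>2) * sqrt (X2\<^sup>2 + (u - y2)\<^sup>2))) *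
      exp (\<i> * of_real (k * (sqrt (X1\<^sup>2 + (u - y1)\<^sup>2) - sqrt (X2\<^sup>2 + (u - y2)\<^sup>2))))))
    \<le> 40 * L / sqrt (\<bar>k\<bar> * \<bar>X2 - X1\<bar>)"
proof -
  define l where "l u = (u - y1) * X2 - (u - y2) * X1" for u
  define \<beta> where "\<beta> = \<bar>X2 - X1\<bar>"
  define \<tau> where "\<tau> = L * sqrt (\<beta> / \<bar>k\<bar>)"
  have \<beta>: "0 < \<beta>" using ne by (simp add: \<beta>_def)
  have \<tau>: "0 < \<tau>" using L \<beta> k by (simp add: \<tau>_def)
  have l_eq: "l u = (X2 - X1) * u + (y2 * X1 - y1 * X2)" for u by (simp add: l_def algebra_simps)
  have lohi: "lo \<le> hi" using hi D by simp
  have int: "integral {lo..hi} (\<lambda>u. 1 / ((l u)\<^sup>2 + \<tau>\<^sup>2)) \<le> pi / (\<beta> * \<tau>)"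
    unfolding l_eq \<beta>_def using ne \<tau> lohi by (intro integral_inverse_quadratic_le) auto
  have "norm (integral {lo..hi} (\<lambda>u. of_real (L\<^sup>2 / (sqrt (X1\<^sup>2 + (u - y1)\<^sup>2) * sqrt (X2\<^sup>2 + (u - y2)\<^sup>2))) *
      exp (\<i> * of_real (k * (sqrt (X1\<^sup>2 + (u - y1)\<^sup>2) - sqrt (X2\<^sup>2 + (u - y2)\<^sup>2))))))
    \<le> L\<^sup>2 / \<bar>k\<bar> * (8 * (1 / (2 * \<tau>)) + 12 * D * (1 / (2 * \<tau>)) / L + 4 * (pi / \<tau>)) + 4 * (pi * \<tau> / \<beta>)"
  proof (rule path_difference_integral_bound[OF L D hi k X y, where \<tau>=\<tau>], simp_all only: l_def[symmetric])
    fix u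
    show pos: "0 < (l u)\<^sup>2 + \<tau>\<^sup>2" using \<tau> by (simp add: add_nonneg_pos)
    have "2 * \<tau> * \<bar>l u\<bar> \<le> (l u)\<^sup>2 + \<tau>\<^sup>2"
      using zero_le_power2[of "\<bar>l u\<bar> - \<tau>"] by (simp add: power2_eq_square algebra_simps)
    then have "\<bar>l u\<bar> * (2 * \<tau>) \<le> 1 * ((l u)\<^sup>2 + \<tau>\<^sup>2)" by (simp add: mult_ac)
    then show "\<bar>l u\<bar> / ((l u)\<^sup>2 + \<tau>\<^sup>2) \<le> 1 / (2 * \<tau>)"
      using pos \<tau> by (simp only: pos_divide_le_eq pos_le_divide_eq times_divide_eq_left mult_pos_pos zero_less_numeral)
  next
    have "integral {lo..hi} (\<lambda>u. \<bar>X2 - X1\<bar> / ((l u)\<^sup>2 + \<tau>\<^sup>2)) = \<beta> * integral {lo..hi} (\<lambda>u. 1 / ((l u)\<^sup>2 + \<tau>\<^sup>2))"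
      unfolding \<beta>_def by (subst integral_mult_right[symmetric]) simp
    also have "\<dots> \<le> \<beta> * (pi / (\<beta> * \<tau>))" using int \<beta> by (intro mult_left_mono) auto
    also have "\<dots> = pi / \<tau>" using \<beta> by simp
    finally show "integral {lo..hi} (\<lambda>u. \<bar>X2 - X1\<bar> / ((l u)\<^sup>2 + \<tau>\<^sup>2)) \<le> pi / \<tau>" .
  next
    have "integral {lo..hi} (\<lambda>u. \<tau>\<^sup>2 / ((l u)\<^sup>2 + \<tau>\<^sup>2)) = \<tau>\<^sup>2 * integral {lo..hi} (\<lambda>u. 1 / ((l u)\<^sup>2 + \<tau>\<^sup>2))"
      by (subst integral_mult_right[symmetric]) simp
    also have "\<dots> \<le> \<tau>\<^sup>2 * (pi / (\<beta> * \<tau>))" using int by (intro mult_left_mono) auto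
    also have "\<dots> = pi * \<tau> / \<beta>" using \<beta> \<tau> by (simp add: power2_eq_square)
    finally show "integral {lo..hi} (\<lambda>u. \<tau>\<^sup>2 / ((l u)\<^sup>2 + \<tau>\<^sup>2)) \<le> pi * \<tau> / \<beta>" .
  qed
  also have "\<dots> \<le> 40 * (\<tau> / \<beta>)"
  proof -
    have "12 * D * (1 / (2 * \<tau>)) / L \<le> 3 / \<tau>"
      using D L \<tau> by (simp add: field_simps)
    moreover have "pi / \<tau> \<le> 3.2 / \<tau>"
      using pi_approx \<tau> by (intro divide_right_mono) auto
    ultimately have "8 * (1 / (2 * \<tau>)) + 12 * D * (1 / (2 * \<tau>)) / L + 4 * (pi / \<tau>) \<le> 4 / \<tau> + 3 / \<tau> + 4 * (3.2 / \<tau>)"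
      by (intro add_mono mult_left_mono) auto
    also have "\<dots> = 19.8 / \<tau>" by (simp add: field_simps)
    finally have "L\<^sup>2 / \<bar>k\<bar> * (8 * (1 / (2 * \<tau>)) + 12 * D * (1 / (2 * \<tau>)) / L + 4 * (pi / \<tau>)) \<le> L\<^sup>2 / \<bar>k\<bar> * (19.8 / \<tau>)"
      by (intro mult_left_mono) auto
    also have "\<dots> = 19.8 * (\<tau> / \<beta>)"
    proof -
      have "\<tau> * \<tau> = L\<^sup>2 * (\<beta> / \<bar>k\<bar>)"
        using \<beta> by (simp add: \<tau>_def power2_eq_square[symmetric] power_mult_distrib)
      then have "L\<^sup>2 / \<bar>k\<bar> = \<tau> * \<tau> / \<beta>" using \<beta> by simp
      then show ?thesis using \<tau> by simp
    qed
    finally have 1: "L\<^sup>2 / \<bar>k\<bar> * (8 * (1 / (2 * \<tau>)) + 12 * D * (1 / (2 * \<tau>)) / L + 4 * (pi / \<tau>)) \<le> 19.8 * (\<tau> / \<beta>)" .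
    have "pi * (\<tau> / \<beta>) \<le> 3.2 * (\<tau> / \<beta>)"
      using pi_approx \<tau> \<beta> by (intro mult_right_mono) auto
    then have 2: "4 * (pi * \<tau> / \<beta>) \<le> 12.8 * (\<tau> / \<beta>)" by simp
    have "0 \<le> \<tau> / \<beta>" using \<tau> \<beta> by simp
    with add_mono[OF 1 2] show ?thesis by simp
  qed
  also have "40 * (\<tau> / \<beta>) = 40 * L / sqrt (\<bar>k\<bar> * \<bar>X2 - X1\<bar>)"
  proof -
    have "sqrt (\<beta> / \<bar>k\<bar>) / \<beta> = 1 / sqrt (\<bar>k\<bar> * \<beta>)"
    proof -
      have "sqrt \<beta> * sqrt \<beta> = \<beta>" using \<beta> by simp
      then have "sqrt \<beta> / \<beta> = 1 / sqrt \<beta>" using \<beta> by (simp add: field_simps)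
      moreover have "sqrt (\<beta> / \<bar>k\<bar>) / \<beta> = sqrt \<beta> / \<beta> / sqrt \<bar>k\<bar>"
        by (simp add: real_sqrt_divide mult.commute)
      ultimately show ?thesis by (simp add: real_sqrt_mult mult.commute)
    qed
    moreover have "40 * (\<tau> / \<beta>) = 40 * L * (sqrt (\<beta> / \<bar>k\<bar>) / \<beta>)" by (simp add: \<tau>_def)
    ultimately show ?thesis by (simp add: \<beta>_def)
  qed
  finally show ?thesis .
qed

section \<open>Correlation of the channel vectors of two nodes\<close>

abbreviation uniform_square :: "real \<times> real \<Rightarrow> real \<Rightarrow> (real \<times> real) measure" where
  "uniform_square c D \<equiv> uniform_measure lborel (square c D)"

lemma square_eq: "square (a, b) D = {a - D / 2..a + D / 2} \<times> {b - D / 2..b + D / 2}"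
  by (simp add: square_def cbox_Pair_eq)

lemma square_measurable [measurable]: "square c D \<in> sets borel"
  by (simp add: square_def)

lemma emeasure_square:
  assumes "0 < D"
  shows "emeasure lborel (square c D) = ennreal (D\<^sup>2)"
proof -
  obtain a b where c: "c = (a, b)" by (cases c)
  have "emeasure (lborel \<Otimes>\<^sub>M lborel) (square c D) =
      emeasure lborel {a - D / 2..a + D / 2} * emeasure lborel {b - D / 2..b + D / 2}"
    unfolding c square_eq by (rule lborel.emeasure_pair_measure_Times) auto
  then show ?thesis
    using assms unfolding lborel_prod by (simp add: ennreal_mult[symmetric] power2_eq_square)
qed

lemma prob_space_uniform_square:
  assumes "0 < D"
  shows "prob_space (uniform_square c D)"
  by (rule prob_space_uniform_measure) (use assms in \<open>auto simp: emeasure_square\<close>)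

lemma integral_uniform_square:
  fixes f :: "real \<times> real \<Rightarrow> complex"
  assumes D: "0 < D" and f[measurable]: "f \<in> borel_measurable borel"
    and B: "\<And>z. norm (f z) \<le> B" and supp: "\<And>z. z \<notin> square c D \<Longrightarrow> f z = 0"
  shows "(\<integral>z. f z \<partial>uniform_square c D) = (\<integral>x. (\<integral>y. f (x, y) \<partial>lborel) \<partial>lborel) / of_real (D\<^sup>2)"
proof -
  have eq: "uniform_square c D = density lborel (\<lambda>z. ennreal (indicator (square c D) z / D\<^sup>2))"
    unfolding uniform_measure_def emeasure_square[OF D]
    using divide_ennreal[of 1 "D\<^sup>2"] D by (intro density_cong) (auto simp: indicator_def)
  have int: "integrable (lborel \<Otimes>\<^sub>M lborel) f"
    unfolding lborel_prod
    by (rule integrableI_bounded_set[where A="square c D" and B=B])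
       (use B supp emeasure_square[OF D] in auto)
  have "(\<integral>z. f z \<partial>uniform_square c D) = (\<integral>z. (indicator (square c D) z / D\<^sup>2) *\<^sub>R f z \<partial>lborel)"
    unfolding eq by (rule integral_density) auto
  also have "\<dots> = (\<integral>z. f z / of_real (D\<^sup>2) \<partial>lborel)"
    using supp by (intro Bochner_Integration.integral_cong) (auto simp: indicator_def scaleR_conv_of_real)
  also have "\<dots> = (\<integral>z. f z \<partial>lborel) / of_real (D\<^sup>2)" by simp
  also have "(\<integral>z. f z \<partial>lborel) = (\<integral>z. f z \<partial>(lborel \<Otimes>\<^sub>M lborel))" by (simp add: lborel_prod)
  also have "\<dots> = (\<integral>x. (\<integral>y. f (x, y) \<partial>lborel) \<partial>lborel)"
    by (rule lborel_pair.integral_fst'[OF int, symmetric])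
  finally show ?thesis .
qed

text \<open>
  The channel coefficient divided by its order of magnitude \<open>sqrt G / L\<close>, extended by 0 so that
  the bounds hold at all positions.
\<close>

definition wave :: "real \<Rightarrow> real \<Rightarrow> real \<Rightarrow> real \<times> real \<Rightarrow> real \<times> real \<Rightarrow> complex" where
  "wave D L lam r t = (if r \<in> square (L, 0) D \<and> t \<in> square (0, 0) D
     then of_real (L / dist r t) * exp (- \<i> * of_real (2 * pi / lam * dist r t)) else 0)"

lemma wave_measurable [measurable]:
  "(\<lambda>(r, t). wave D L lam r t) \<in> borel_measurable (borel \<Otimes>\<^sub>M borel)"
proof -
  have [measurable]: "(exp :: complex \<Rightarrow> complex) \<in> borel_measurable borel"
    by (intro borel_measurable_continuous_onI continuous_intros)
  show ?thesis unfolding wave_def by measurable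
qed

text \<open>The separation of at least 2 D keeps all horizontal offsets between L / 2 and 3 L / 2,
  so every channel coefficient has the order sqrt G / L.\<close>

lemma dist_squares:
  assumes "0 < D" "2 * D \<le> L" "r \<in> square (L, 0) D" "t \<in> square (0, 0) D"
  shows "L / 2 \<le> dist r t" "dist r t \<le> 2 * L"
proof -
  obtain x y u v where r: "r = (x, y)" and t: "t = (u, v)" by (cases r, cases t) blast
  have m: "\<bar>x - L\<bar> \<le> D / 2" "\<bar>y\<bar> \<le> D / 2" "\<bar>u\<bar> \<le> D / 2" "\<bar>v\<bar> \<le> D / 2"
    using assms(3,4) unfolding r t square_eq abs_le_iff by auto
  have "L / 2 \<le> x - u" using m assms by linarith
  also have "\<dots> \<le> dist x u" by (simp add: dist_real_def)
  also have "\<dots> \<le> dist r t" by (simp add: r t dist_Pair_Pair)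
  finally show "L / 2 \<le> dist r t" .
  have "dist r t \<le> dist x u + dist y v"
    unfolding r t dist_Pair_Pair by (rule sqrt_sum_squares_le_sum) auto
  also have "\<dots> \<le> 2 * L" using m assms unfolding dist_real_def by linarith
  finally show "dist r t \<le> 2 * L" .
qed

lemma norm_wave_in:
  assumes "0 < D" "2 * D \<le> L" "r \<in> square (L, 0) D" "t \<in> square (0, 0) D"
  shows "1 / 2 \<le> cmod (wave D L lam r t)" "cmod (wave D L lam r t) \<le> 2"
proof -
  have L: "0 < L" using assms by simp
  have p: "0 < dist r t" using dist_squares(1)[OF assms] L by linarith
  have "cmod (wave D L lam r t) = L / dist r t"
  proof -
    have e: "cmod (exp (- \<i> * of_real a)) = 1" for a by (simp add: norm_exp_eq_Re)
    have "wave D L lam r t = of_real (L / dist r t) * exp (- \<i> * of_real (2 * pi / lam * dist r t))"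
      using assms by (simp add: wave_def)
    then show ?thesis using L by (simp only: norm_mult e norm_of_real) simp
  qed
  then show "1 / 2 \<le> cmod (wave D L lam r t)" "cmod (wave D L lam r t) \<le> 2"
    using dist_squares[OF assms] p by (simp_all add: pos_divide_le_eq pos_le_divide_eq)
qed

lemma norm_wave_le:
  assumes "0 < D" "2 * D \<le> L"
  shows "cmod (wave D L lam r t) \<le> 2"
  using norm_wave_in(2)[OF assms] by (cases "r \<in> square (L, 0) D \<and> t \<in> square (0, 0) D") (auto simp: wave_def)

text \<open>By the law of large numbers, the normalised inner product of the channel vectors of two
  transmitters tends to this number as the receivers become many.\<close>

definition correlation :: "real \<Rightarrow> real \<Rightarrow> real \<Rightarrow> real \<times> real \<Rightarrow> real \<times> real \<Rightarrow> complex" where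
  "correlation D L lam t1 t2 =
     (\<integral>r. wave D L lam r t1 * cnj (wave D L lam r t2) \<partial>uniform_square (L, 0) D)"

lemma correlation_measurable [measurable]:
  assumes "0 < D"
  shows "(\<lambda>(t1, t2). correlation D L lam t1 t2) \<in> borel_measurable (borel \<Otimes>\<^sub>M borel)"
proof -
  interpret prob_space "uniform_square (L, 0) D" by (rule prob_space_uniform_square[OF assms])
  have s[measurable_cong]: "sets (uniform_square (L, 0) D) = sets borel" by simp
  have "(\<lambda>(t, r). wave D L lam r (fst t) * cnj (wave D L lam r (snd t)))
      \<in> borel_measurable ((borel \<Otimes>\<^sub>M borel) \<Otimes>\<^sub>M uniform_square (L, 0) D)" by measurable
  from borel_measurable_lebesgue_integral[OF this] show ?thesis
    unfolding correlation_def by (simp add: case_prod_unfold)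
qed

lemma norm_wave_product_le:
  assumes "0 < D" "2 * D \<le> L"
  shows "cmod (wave D L lam r t * cnj (wave D L lam r t')) \<le> 4"
  using mult_mono[OF norm_wave_le[OF assms, of lam r t] norm_wave_le[OF assms, of lam r t']]
  by (simp add: norm_mult)

lemma norm_correlation_le:
  assumes "0 < D" "2 * D \<le> L"
  shows "cmod (correlation D L lam t1 t2) \<le> 4"
proof -
  interpret prob_space "uniform_square (L, 0) D" by (rule prob_space_uniform_square[OF assms(1)])
  have "cmod (correlation D L lam t1 t2) \<le>
      (\<integral>r. cmod (wave D L lam r t1 * cnj (wave D L lam r t2)) \<partial>uniform_square (L, 0) D)"
    unfolding correlation_def by (rule integral_norm_bound)
  also have "\<dots> \<le> (\<integral>r. 4 \<partial>uniform_square (L, 0) D)"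
    using norm_wave_product_le[OF assms] by (intro integral_mono') auto
  also have "\<dots> = 4" using prob_space by simp
  finally show ?thesis .
qed

text \<open>Fubini's theorem over vertical lines: the area is D^2 and D is the range of the
  horizontal coordinate, so a bound \<open>B\<close> for each line becomes B / D.\<close>

lemma norm_correlation_le_line:
  fixes x1 y1 x2 y2 :: real
  assumes D: "0 < D" "2 * D \<le> L"
    and t: "(x1, y1) \<in> square (0, 0) D" "(x2, y2) \<in> square (0, 0) D"
    and B: "\<And>x. x \<in> {L - D / 2..L + D / 2} \<Longrightarrow>
      norm (integral {- D / 2..D / 2} (\<lambda>u. of_real (L\<^sup>2 / (sqrt ((x - x1)\<^sup>2 + (u - y1)\<^sup>2) * sqrt ((x - x2)\<^sup>2 + (u - y2)\<^sup>2))) *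
      exp (\<i> * of_real (- (2 * pi / lam) * (sqrt ((x - x1)\<^sup>2 + (u - y1)\<^sup>2) - sqrt ((x - x2)\<^sup>2 + (u - y2)\<^sup>2)))))) \<le> B"
  shows "cmod (correlation D L lam (x1, y1) (x2, y2)) \<le> B / D"
proof -
  define f where "f r = wave D L lam r (x1, y1) * cnj (wave D L lam r (x2, y2))" for r
  define F where "F x u = of_real (L\<^sup>2 / (sqrt ((x - x1)\<^sup>2 + (u - y1)\<^sup>2) * sqrt ((x - x2)\<^sup>2 + (u - y2)\<^sup>2))) *
      exp (\<i> * of_real (- (2 * pi / lam) * (sqrt ((x - x1)\<^sup>2 + (u - y1)\<^sup>2) - sqrt ((x - x2)\<^sup>2 + (u - y2)\<^sup>2))))"
    for x u
  let ?I = "{L - D / 2..L + D / 2}" and ?J = "{- D / 2..D / 2}"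
  have L: "0 < L" using D by simp
  have [measurable]: "f \<in> borel_measurable borel" unfolding f_def by measurable
  have f_eq: "f (x, u) = (if x \<in> ?I then indicator ?J u *\<^sub>R F x u else 0)" for x u
  proof (cases "(x, u) \<in> square (L, 0) D")
    case True
    have "exp (- \<i> * of_real (2 * pi / lam * dist (x, u) (x1, y1))) * cnj (exp (- \<i> * of_real (2 * pi / lam * dist (x, u) (x2, y2)))) =
        exp (\<i> * of_real (- (2 * pi / lam) * (dist (x, u) (x1, y1) - dist (x, u) (x2, y2))))"
      unfolding exp_cnj mult_exp_exp by (rule arg_cong[where f=exp]) (simp add: algebra_simps)
    then have "f (x, u) = of_real (L\<^sup>2 / (dist (x, u) (x1, y1) * dist (x, u) (x2, y2))) *
        exp (\<i> * of_real (- (2 * pi / lam) * (dist (x, u) (x1, y1) - dist (x, u) (x2, y2))))"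
      using True t by (simp add: f_def wave_def power2_eq_square mult_ac)
    moreover have "x \<in> ?I" "u \<in> ?J" using True by (auto simp: square_eq)
    ultimately show ?thesis by (simp add: F_def dist_Pair_Pair dist_real_def)
  next
    case False
    then show ?thesis by (auto simp: f_def wave_def square_eq indicator_def)
  qed
  have inner: "(\<integral>u. f (x, u) \<partial>lborel) = (if x \<in> ?I then integral ?J (F x) else 0)" for x
  proof (cases "x \<in> ?I")
    case True
    have "\<bar>x - L\<bar> \<le> D / 2" "\<bar>x1\<bar> \<le> D / 2" "\<bar>x2\<bar> \<le> D / 2"
      using True t unfolding square_eq abs_le_iff by auto
    then have "x - x1 \<noteq> 0" "x - x2 \<noteq> 0" using D by (auto simp: abs_le_iff)
    then have "0 < (x - x1)\<^sup>2" "0 < (x - x2)\<^sup>2" by simp_all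
    then have "0 < (x - x1)\<^sup>2 + (u - y1)\<^sup>2" "0 < (x - x2)\<^sup>2 + (u - y2)\<^sup>2" for u
      by (simp_all add: add_pos_nonneg)
    then have ne: "sqrt ((x - x1)\<^sup>2 + (u - y1)\<^sup>2) * sqrt ((x - x2)\<^sup>2 + (u - y2)\<^sup>2) \<noteq> 0" for u
      by (metis less_irrefl mult_eq_0_iff real_sqrt_gt_zero)
    have "continuous_on ?J (F x)"
      unfolding F_def[abs_def] by (intro continuous_intros) (use ne in blast)
    then have "set_integrable lborel ?J (F x)" by (rule borel_integrable_atLeastAtMost')
    from set_borel_integral_eq_integral(2)[OF this] True show ?thesis
      by (simp add: f_eq set_lebesgue_integral_def)
  next
    case False
    show ?thesis unfolding f_eq if_not_P[OF False] by simp
  qed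
  have B0: "0 \<le> B" using B[of L] D by (auto intro: order_trans[OF norm_ge_zero])
  have "cmod (correlation D L lam (x1, y1) (x2, y2)) =
      cmod ((\<integral>x. (\<integral>u. f (x, u) \<partial>lborel) \<partial>lborel) / of_real (D\<^sup>2))"
    unfolding correlation_def f_def[symmetric]
    by (subst integral_uniform_square[where B=4])
       (use D norm_wave_product_le[OF D] in \<open>auto simp: f_def wave_def\<close>)
  also have "\<dots> = cmod (\<integral>x. (\<integral>u. f (x, u) \<partial>lborel) \<partial>lborel) / D\<^sup>2"
    by (simp add: norm_divide norm_power)
  also have "cmod (\<integral>x. (\<integral>u. f (x, u) \<partial>lborel) \<partial>lborel) \<le> (\<integral>x. cmod (\<integral>u. f (x, u) \<partial>lborel) \<partial>lborel)"
    by (rule integral_norm_bound)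
  also have "\<dots> \<le> (\<integral>x. indicator ?I x * B \<partial>lborel)"
  proof (rule integral_mono')
    show "integrable lborel (\<lambda>x. indicator ?I x * B)"
      using D by (intro integrable_mult_left integrable_real_indicator) auto
    show "cmod (\<integral>u. f (x, u) \<partial>lborel) \<le> indicator ?I x * B" for x
      unfolding inner using B[of x] by (auto simp: F_def[abs_def])
  qed (use B0 in auto)
  also have "\<dots> = D * B" using D by simp
  finally show ?thesis using D by (simp add: power2_eq_square field_simps)
qed

text \<open>On the line at abscissa x the phase estimates apply with horizontal offsets x - x1 and x
  - x2, whose difference does not depend on x; this makes the bounds uniform over the receiving
  square.\<close>

lemma norm_correlation_cases:
  assumes D: "0 < D" "2 * D \<le> L" and lam: "0 < lam"
    and t: "(x1, y1) \<in> square (0, 0) D" "(x2, y2) \<in> square (0, 0) D"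
  shows "4 * D * \<bar>x1 - x2\<bar> \<le> L * \<bar>y2 - y1\<bar> \<Longrightarrow> y1 \<noteq> y2 \<Longrightarrow>
      cmod (correlation D L lam (x1, y1) (x2, y2)) \<le> 72 * L / (2 * pi / lam * \<bar>y2 - y1\<bar>) / D"
    and "x1 \<noteq> x2 \<Longrightarrow>
      cmod (correlation D L lam (x1, y1) (x2, y2)) \<le> 40 * L / sqrt (2 * pi / lam * \<bar>x1 - x2\<bar>) / D"
proof -
  have k: "- (2 * pi / lam) \<noteq> 0" "\<bar>- (2 * pi / lam)\<bar> = 2 * pi / lam" using lam by auto
  have L: "0 < L" using D by simp
  have hi: "D / 2 = - D / 2 + D" by simp
  have tt: "\<bar>x1\<bar> \<le> D / 2" "\<bar>x2\<bar> \<le> D / 2" "\<bar>y1\<bar> \<le> D / 2" "\<bar>y2\<bar> \<le> D / 2"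
    using t unfolding square_eq abs_le_iff by auto
  have y: "\<bar>u - y1\<bar> \<le> D" "\<bar>u - y2\<bar> \<le> D" if "u \<in> {- D / 2..D / 2}" for u
    using that tt unfolding abs_le_iff by auto
  have X: "L / 2 \<le> x - x1" "x - x1 \<le> 3 / 2 * L" "L / 2 \<le> x - x2" "x - x2 \<le> 3 / 2 * L"
    if "x \<in> {L - D / 2..L + D / 2}" for x
    using that tt D unfolding abs_le_iff by auto
  have dx: "x - x2 - (x - x1) = x1 - x2" for x by simp
  show "cmod (correlation D L lam (x1, y1) (x2, y2)) \<le> 72 * L / (2 * pi / lam * \<bar>y2 - y1\<bar>) / D"
    if "4 * D * \<bar>x1 - x2\<bar> \<le> L * \<bar>y2 - y1\<bar>" "y1 \<noteq> y2"
  proof (rule norm_correlation_le_line[OF D t])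
    fix x assume x: "x \<in> {L - D / 2..L + D / 2}"
    show "norm (integral {- D / 2..D / 2} (\<lambda>u. of_real (L\<^sup>2 / (sqrt ((x - x1)\<^sup>2 + (u - y1)\<^sup>2) * sqrt ((x - x2)\<^sup>2 + (u - y2)\<^sup>2))) *
      exp (\<i> * of_real (- (2 * pi / lam) * (sqrt ((x - x1)\<^sup>2 + (u - y1)\<^sup>2) - sqrt ((x - x2)\<^sup>2 + (u - y2)\<^sup>2))))))
      \<le> 72 * L / (2 * pi / lam * \<bar>y2 - y1\<bar>)"
      using path_difference_integral_steep[OF L D hi k(1) X[OF x] y, unfolded dx, OF _ _ that]
      unfolding k(2) .
  qed
  show "cmod (correlation D L lam (x1, y1) (x2, y2)) \<le> 40 * L / sqrt (2 * pi / lam * \<bar>x1 - x2\<bar>) / D"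
    if "x1 \<noteq> x2"
  proof (rule norm_correlation_le_line[OF D t])
    fix x assume x: "x \<in> {L - D / 2..L + D / 2}"
    have "x - x1 \<noteq> x - x2" using that by simp
    from path_difference_integral_flat[OF L D hi k(1) X[OF x] y this]
    show "norm (integral {- D / 2..D / 2} (\<lambda>u. of_real (L\<^sup>2 / (sqrt ((x - x1)\<^sup>2 + (u - y1)\<^sup>2) * sqrt ((x - x2)\<^sup>2 + (u - y2)\<^sup>2))) *
      exp (\<i> * of_real (- (2 * pi / lam) * (sqrt ((x - x1)\<^sup>2 + (u - y1)\<^sup>2) - sqrt ((x - x2)\<^sup>2 + (u - y2)\<^sup>2))))))
      \<le> 40 * L / sqrt (2 * pi / lam * \<bar>x1 - x2\<bar>)"
      unfolding k(2) dx .
  qed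
qed

text \<open>The positions of the second transmitter are divided by a cone around the first. Where
  the vertical offset wins, the squared correlation decays like (b / |y - y1|)^2, which is
  integrable in y beyond the scale \<open>b\<close>. In the remaining cone the bound c / |x - x1| is
  singular, but the cone has height 8 D |x - x1| / L at abscissa x, and the two factors cancel; so
  no logarithm arises.\<close>

lemma correlation_mean_square:
  assumes D: "0 < D" "2 * D \<le> L" and lam: "0 < lam" and t1: "t1 \<in> square (0, 0) D"
  shows "(\<integral>t2. (cmod (correlation D L lam t1 t2))\<^sup>2 \<partial>uniform_square (0, 0) D) \<le> 3000 * (lam * L / D\<^sup>2)"
proof -
  have L: "0 < L" using D by simp
  obtain x1 y1 where t1_eq: "t1 = (x1, y1)" by (cases t1)
  let ?I = "{- D / 2..D / 2}"
  have I: "x1 \<in> ?I" "y1 \<in> ?I" using t1 by (auto simp: t1_eq square_eq)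
  \<comment> \<open>At the vertical offset \<open>b\<close> the steep estimate 4 b / |y - y1| meets
    the trivial bound 4. The constant \<open>c\<close> is the square of the flat estimate times |x -
    x1|.\<close>
  define b where "b = 9 * lam * L / (pi * D)"
  define c where "c = 800 * L\<^sup>2 * lam / (pi * D\<^sup>2)"
  have b: "0 < b" and c: "0 < c" using D L lam by (simp_all add: b_def c_def)
  \<comment> \<open>A rational majorant of both 16 (for |y - y1| \<le> b) and 16 (b / |y - y1|)^2
    (beyond), which integrates to an arctangent.\<close>
  define f where "f y = 32 * b\<^sup>2 * (1 / ((1 * y + (- y1))\<^sup>2 + b\<^sup>2))" for y
  define h where "h x y = (if x \<noteq> x1 \<and> \<bar>y - y1\<bar> \<le> 4 * D / L * \<bar>x - x1\<bar> then c / \<bar>x - x1\<bar> else 0)" for x y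
  have f0: "0 \<le> f y" for y by (simp add: f_def)
  have h0: "0 \<le> h x y" for x y using c by (simp add: h_def)
  have [measurable]: "f \<in> borel_measurable borel" unfolding f_def by measurable
  have [measurable]: "(\<lambda>(x, y). h x y) \<in> borel_measurable (borel \<Otimes>\<^sub>M borel)" unfolding h_def by measurable
  have [measurable]: "(\<lambda>t. correlation D L lam t1 t) \<in> borel_measurable borel"
  proof -
    have "Pair t1 \<in> measurable borel (borel \<Otimes>\<^sub>M borel)" by simp
    from measurable_compose[OF this correlation_measurable[OF D(1)]] show ?thesis by simp
  qed
  have pointwise: "(cmod (correlation D L lam t1 (x, y)))\<^sup>2 \<le> f y + h x y" if t2: "(x, y) \<in> square (0, 0) D" for x y
  proof (cases "4 * D * \<bar>x1 - x\<bar> \<le> L * \<bar>y - y1\<bar>")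
    case True
    have le4: "(cmod (correlation D L lam t1 (x, y)))\<^sup>2 \<le> 16"
      using power_mono[OF norm_correlation_le[OF D, of lam t1 "(x, y)"], of 2] by simp
    have "(cmod (correlation D L lam t1 (x, y)))\<^sup>2 \<le> f y"
    proof (cases "\<bar>y - y1\<bar> \<le> b")
      case True
      then have "(y - y1)\<^sup>2 \<le> b\<^sup>2" using b by (simp add: abs_le_square_iff[symmetric])
      then have "16 * ((y - y1)\<^sup>2 + b\<^sup>2) \<le> 32 * b\<^sup>2" by simp
      moreover have "0 < (y - y1)\<^sup>2 + b\<^sup>2" using b by (simp add: add_nonneg_pos)
      ultimately have "16 \<le> 32 * b\<^sup>2 / ((y - y1)\<^sup>2 + b\<^sup>2)" by (simp only: pos_le_divide_eq)
      then show ?thesis using le4 by (simp add: f_def)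
    next
      case False
      then have ne: "y1 \<noteq> y" using b by auto
      define \<eta> where "\<eta> = \<bar>y - y1\<bar>"
      have \<eta>: "b < \<eta>" "0 < \<eta>" using False b by (simp_all add: \<eta>_def)
      have "cmod (correlation D L lam t1 (x, y)) \<le> 72 * L / (2 * pi / lam * \<eta>) / D"
        using norm_correlation_cases(1)[OF D lam t1[unfolded t1_eq] t2 True ne] by (simp add: t1_eq \<eta>_def)
      also have "\<dots> = 4 * (b / \<eta>)"
        using D L lam \<eta> by (simp add: b_def field_simps)
      finally have "(cmod (correlation D L lam t1 (x, y)))\<^sup>2 \<le> (4 * (b / \<eta>))\<^sup>2"
        by (intro power_mono) auto
      also have "\<dots> = 32 * b\<^sup>2 / (2 * \<eta>\<^sup>2)" by (simp add: power_mult_distrib power_divide)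
      also have "\<dots> \<le> 32 * b\<^sup>2 / (\<eta>\<^sup>2 + b\<^sup>2)"
      proof (rule divide_left_mono)
        have "b\<^sup>2 \<le> \<eta>\<^sup>2" using \<eta> b by (intro power_mono) auto
        then show "\<eta>\<^sup>2 + b\<^sup>2 \<le> 2 * \<eta>\<^sup>2" by simp
        show "0 < 2 * \<eta>\<^sup>2 * (\<eta>\<^sup>2 + b\<^sup>2)" using \<eta> b by (intro mult_pos_pos add_pos_pos) auto
      qed simp
      finally show ?thesis by (simp add: f_def \<eta>_def)
    qed
    then show ?thesis using h0[of x y] by simp
  next
    case False
    have ne: "x1 \<noteq> x"
    proof
      assume "x1 = x"
      then have "4 * D * \<bar>x1 - x\<bar> \<le> L * \<bar>y - y1\<bar>" using L by simp
      with False show False by simp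
    qed
    define \<xi> where "\<xi> = \<bar>x1 - x\<bar>"
    have \<xi>: "0 < \<xi>" "\<bar>x - x1\<bar> = \<xi>" using ne by (auto simp: \<xi>_def)
    have "cmod (correlation D L lam t1 (x, y)) \<le> 40 * L / sqrt (2 * pi / lam * \<xi>) / D"
      using norm_correlation_cases(2)[OF D lam t1[unfolded t1_eq] t2 ne] by (simp add: t1_eq \<xi>_def)
    then have "(cmod (correlation D L lam t1 (x, y)))\<^sup>2 \<le> (40 * L / sqrt (2 * pi / lam * \<xi>) / D)\<^sup>2"
      by (intro power_mono) auto
    also have "\<dots> = (40 * L)\<^sup>2 / (2 * pi / lam * \<xi>) / D\<^sup>2"
      unfolding power_divide using lam \<xi> by simp
    also have "\<dots> = c / \<xi>"
      using D L lam \<xi> by (simp add: c_def power_mult_distrib mult_ac)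
    also have "\<dots> = h x y"
    proof -
      have "\<bar>y - y1\<bar> \<le> 4 * D / L * \<xi>"
        using False L by (simp add: \<xi>_def pos_le_divide_eq mult.commute)
      then show ?thesis using ne \<xi> by (simp add: h_def)
    qed
    finally show ?thesis using f0[of y] by simp
  qed
  define W where "W = 32 * pi * b + 8 * c * D / L"
  have W: "0 \<le> W" using b c D L by (simp add: W_def)
  have int_f: "(\<integral>\<^sup>+y. ennreal (f y) * indicator ?I y \<partial>lborel) \<le> ennreal (32 * pi * b)"
  proof -
    have pos: "(1 * y + - y1)\<^sup>2 + b\<^sup>2 \<noteq> 0" for y
      using b add_nonneg_pos[of "(1 * y + - y1)\<^sup>2" "b\<^sup>2"] by simp
    have cont: "continuous_on ?I f"
      unfolding f_def[abs_def] by (intro continuous_intros) (use pos in blast)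
    then have si: "set_integrable lborel ?I f" by (rule borel_integrable_atLeastAtMost')
    have "(\<integral>\<^sup>+y. ennreal (f y) * indicator ?I y \<partial>lborel) = (\<integral>\<^sup>+y. ennreal (indicator ?I y *\<^sub>R f y) \<partial>lborel)"
      by (intro nn_integral_cong) (auto simp: indicator_def)
    also have "\<dots> = ennreal (LINT y:?I|lborel. f y)"
      unfolding set_lebesgue_integral_def using si f0
      by (intro nn_integral_eq_integral) (auto simp: set_integrable_def indicator_def)
    also have "(LINT y:?I|lborel. f y) = integral ?I f"
      by (rule set_borel_integral_eq_integral(2)[OF si])
    also have "\<dots> = 32 * b\<^sup>2 * integral ?I (\<lambda>y. 1 / ((1 * y + (- y1))\<^sup>2 + b\<^sup>2))"
      unfolding f_def[abs_def] by (rule integral_mult_right)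
    also have "\<dots> \<le> 32 * b\<^sup>2 * (pi / (\<bar>1\<bar> * b))"
      using b D by (intro mult_left_mono integral_inverse_quadratic_le) auto
    also have "\<dots> = 32 * pi * b" using b by (simp add: power2_eq_square)
    finally show ?thesis by (simp add: ennreal_leI)
  qed
  have int_h: "(\<integral>\<^sup>+y. ennreal (h x y) \<partial>lborel) \<le> ennreal (8 * c * D / L)" for x
  proof (cases "x = x1")
    case False
    define r where "r = 4 * D / L * \<bar>x - x1\<bar>"
    have r: "0 \<le> r" using D L by (simp add: r_def)
    have "(\<integral>\<^sup>+y. ennreal (h x y) \<partial>lborel) = (\<integral>\<^sup>+y. ennreal (c / \<bar>x - x1\<bar>) * indicator {y1 - r..y1 + r} y \<partial>lborel)"
      using False by (intro nn_integral_cong) (auto simp: h_def r_def indicator_def abs_le_iff)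
    also have "\<dots> = ennreal (c / \<bar>x - x1\<bar>) * ennreal (2 * r)"
      using r by (simp add: nn_integral_cmult_indicator)
    also have "\<dots> = ennreal (c / \<bar>x - x1\<bar> * (2 * r))"
      using r c by (intro ennreal_mult[symmetric]) auto
    also have "c / \<bar>x - x1\<bar> * (2 * r) = 8 * c * D / L"
      using False by (simp add: r_def)
    finally show ?thesis by simp
  qed (simp add: h_def)
  interpret U: prob_space "uniform_square (0, 0) D" by (rule prob_space_uniform_square[OF D(1)])
  have "(\<integral>\<^sup>+t2. ennreal ((cmod (correlation D L lam t1 t2))\<^sup>2) * indicator (square (0, 0) D) t2 \<partial>lborel) \<le>
      (\<integral>\<^sup>+t. (ennreal (f (snd t)) * indicator ?I (snd t) + ennreal (h (fst t) (snd t))) * indicator ?I (fst t)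
        \<partial>(lborel \<Otimes>\<^sub>M lborel))"
    unfolding lborel_prod
  proof (rule nn_integral_mono)
    fix t :: "real \<times> real"
    obtain x y where t: "t = (x, y)" by (cases t)
    show "ennreal ((cmod (correlation D L lam t1 t))\<^sup>2) * indicator (square (0, 0) D) t \<le>
      (ennreal (f (snd t)) * indicator ?I (snd t) + ennreal (h (fst t) (snd t))) * indicator ?I (fst t)"
    proof (cases "t \<in> square (0, 0) D")
      case True
      then have "x \<in> ?I" "y \<in> ?I" by (auto simp: t square_eq)
      then show ?thesis
        using pointwise[of x y] True f0[of y] h0[of x y]
        by (simp add: t ennreal_plus[symmetric] ennreal_leI del: ennreal_plus)
    qed simp
  qed
  also have "\<dots> = (\<integral>\<^sup>+x. \<integral>\<^sup>+y. (ennreal (f y) * indicator ?I y + ennreal (h x y)) * indicator ?I x \<partial>lborel \<partial>lborel)"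
    by (subst lborel.nn_integral_fst[symmetric]) simp_all
  also have "\<dots> = (\<integral>\<^sup>+x. ((\<integral>\<^sup>+y. ennreal (f y) * indicator ?I y \<partial>lborel) + (\<integral>\<^sup>+y. ennreal (h x y) \<partial>lborel)) * indicator ?I x \<partial>lborel)"
    by (intro nn_integral_cong) (simp add: nn_integral_multc nn_integral_add)
  also have "\<dots> \<le> (\<integral>\<^sup>+x. ennreal W * indicator ?I x \<partial>lborel)"
  proof (intro nn_integral_mono mult_right_mono)
    fix x
    have "(\<integral>\<^sup>+y. ennreal (f y) * indicator ?I y \<partial>lborel) + (\<integral>\<^sup>+y. ennreal (h x y) \<partial>lborel) \<le>
        ennreal (32 * pi * b) + ennreal (8 * c * D / L)"
      by (intro add_mono int_f int_h)
    also have "\<dots> = ennreal W" using b c D L by (simp add: W_def ennreal_plus)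
    finally show "(\<integral>\<^sup>+y. ennreal (f y) * indicator ?I y \<partial>lborel) + (\<integral>\<^sup>+y. ennreal (h x y) \<partial>lborel) \<le> ennreal W" .
  qed simp
  also have "\<dots> = ennreal (W * D)"
    using D W by (simp add: nn_integral_cmult_indicator ennreal_mult)
  finally have total: "(\<integral>\<^sup>+t2. ennreal ((cmod (correlation D L lam t1 t2))\<^sup>2) * indicator (square (0, 0) D) t2 \<partial>lborel)
      \<le> ennreal (W * D)" .
  have "(\<integral>\<^sup>+t2. ennreal ((cmod (correlation D L lam t1 t2))\<^sup>2) \<partial>uniform_square (0, 0) D) =
      (\<integral>\<^sup>+t2. ennreal ((cmod (correlation D L lam t1 t2))\<^sup>2) * indicator (square (0, 0) D) t2 \<partial>lborel) / ennreal (D\<^sup>2)"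
    by (subst nn_integral_uniform_measure) (simp_all add: emeasure_square[OF D(1)])
  also have "\<dots> \<le> ennreal (W * D) / ennreal (D\<^sup>2)"
    by (rule divide_right_mono_ennreal[OF total])
  also have "\<dots> = ennreal (W / D)"
    using D W by (subst divide_ennreal) (simp_all add: power2_eq_square)
  also have "\<dots> \<le> ennreal (3000 * (lam * L / D\<^sup>2))"
  proof (rule ennreal_leI)
    have "W / D = 288 * (lam * L / D\<^sup>2) + 6400 / pi * (lam * L / D\<^sup>2)"
      using D L by (simp add: W_def b_def c_def power2_eq_square add_divide_distrib mult_ac)
    also have "\<dots> \<le> 288 * (lam * L / D\<^sup>2) + 6400 / 3 * (lam * L / D\<^sup>2)"
      using D L lam pi_gt3 by (intro add_left_mono mult_right_mono divide_left_mono) auto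
    also have "\<dots> \<le> 3000 * (lam * L / D\<^sup>2)"
    proof -
      have lin: "288 * z + 6400 / 3 * z \<le> 3000 * z" if "0 \<le> z" for z :: real
        using that by simp
      show ?thesis by (rule lin) (use lam L in simp)
    qed
    finally show "W / D \<le> 3000 * (lam * L / D\<^sup>2)" .
  qed
  finally show ?thesis
    using L lam by (intro integral_real_bounded) auto
qed

text \<open>The logarithmic factor is at most 1, so \<open>spatial_dof\<close> is at most the
  maximum of 1 and D^2 / (lam L). The trivial bound 16 covers the value 1, the oscillatory estimate
  the other.\<close>

lemma correlation_mean_square_dof:
  assumes D: "0 < D" "2 * D \<le> L" and lam: "0 < lam" and t1: "t1 \<in> square (0, 0) D"
  shows "(\<integral>t2. (cmod (correlation D L lam t1 t2))\<^sup>2 \<partial>uniform_square (0, 0) D) \<le> 3000 / spatial_dof D L lam"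
proof -
  interpret U: prob_space "uniform_square (0, 0) D" by (rule prob_space_uniform_square[OF D(1)])
  have L: "0 < L" using D by simp
  define a where "a = D\<^sup>2 / (lam * L)"
  have a: "0 < a" using D L lam by (simp add: a_def)
  have one: "(\<integral>t2. (cmod (correlation D L lam t1 t2))\<^sup>2 \<partial>uniform_square (0, 0) D) \<le> 3000 / 1"
  proof -
    have "(\<integral>t2. (cmod (correlation D L lam t1 t2))\<^sup>2 \<partial>uniform_square (0, 0) D) \<le> (\<integral>t2. 16 \<partial>uniform_square (0, 0) D)"
      using power_mono[OF norm_correlation_le[OF D, of lam t1], of _ 2] by (intro integral_mono') auto
    also have "\<dots> = 16" using U.prob_space by simp
    finally show ?thesis by simp
  qed
  have two: "(\<integral>t2. (cmod (correlation D L lam t1 t2))\<^sup>2 \<partial>uniform_square (0, 0) D) \<le> 3000 / a"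
    using correlation_mean_square[OF D lam t1] by (simp add: a_def)
  have "a * inverse (1 + max 0 (log 2 a)) \<le> a * 1"
    using a by (intro mult_left_mono) (auto simp: inverse_le_1_iff)
  then have "spatial_dof D L lam \<le> max 1 a" by (auto simp: spatial_dof_def a_def[symmetric])
  moreover have "1 \<le> spatial_dof D L lam" by (simp add: spatial_dof_def)
  ultimately have "3000 / max 1 a \<le> 3000 / spatial_dof D L lam"
    by (intro divide_left_mono) auto
  moreover have "(\<integral>t2. (cmod (correlation D L lam t1 t2))\<^sup>2 \<partial>uniform_square (0, 0) D) \<le> 3000 / max 1 a"
    using one two by (cases "a \<le> 1") (simp_all add: max_def)
  ultimately show ?thesis by linarith
qed

section \<open>Concentration of the Gram matrix\<close>

text \<open>Independence in the form used below: overwriting one coordinate by a fresh copy leaves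
  the expectation unchanged. One node at a time can thus be integrated out on a fixed index
  set.\<close>

lemma (in prob_space) integral_PiM_resample:
  fixes F :: "('i \<Rightarrow> 'a) \<Rightarrow> real"
  assumes I: "finite I" "i \<in> I" and F[measurable]: "F \<in> borel_measurable (PiM I (\<lambda>_. M))"
    and b: "\<And>x. x \<in> space (PiM I (\<lambda>_. M)) \<Longrightarrow> \<bar>F x\<bar> \<le> B"
  shows "(\<integral>x. F x \<partial>PiM I (\<lambda>_. M)) = (\<integral>x. (\<integral>y. F (x(i := y)) \<partial>M) \<partial>PiM I (\<lambda>_. M))"
proof -
  have pM: "prob_space M" by (rule prob_space_axioms)
  note measurable_integral = borel_measurable_lebesgue_integral
    and const_bound = integrable_const_bound and total = prob_space
  interpret product_prob_space "\<lambda>_. M" I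
    by (intro product_prob_spaceI pM)
  define K where "K = I - {i}"
  have K: "finite K" "i \<notin> K" and I_eq: "I = insert i K" using I by (auto simp: K_def)
  interpret K: prob_space "PiM K (\<lambda>_. M)" by (rule prob_space_PiM) (rule pM)
  have upd[measurable]: "(\<lambda>(x, y). x(i := y)) \<in> measurable (PiM I (\<lambda>_. M) \<Otimes>\<^sub>M M) (PiM I (\<lambda>_. M))"
    using measurable_add_dim[of i I "\<lambda>_. M"] I by (simp add: insert_absorb)
  have Gm: "(\<lambda>x. \<integral>y. F (x(i := y)) \<partial>M) \<in> borel_measurable (PiM I (\<lambda>_. M))"
  proof -
    have "(\<lambda>(x, y). F (x(i := y))) \<in> borel_measurable (PiM I (\<lambda>_. M) \<Otimes>\<^sub>M M)"
      using measurable_compose[OF upd F] by (simp add: case_prod_unfold)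
    then show ?thesis by (rule measurable_integral)
  qed
  have Fi: "integrable (PiM I (\<lambda>_. M)) F"
    by (rule P.integrable_const_bound[where B=B]) (use b in auto)
  have G_bound: "\<bar>\<integral>y. F (x(i := y)) \<partial>M\<bar> \<le> B" if x: "x \<in> space (PiM I (\<lambda>_. M))" for x
  proof -
    have sp: "x(i := y) \<in> space (PiM I (\<lambda>_. M))" if "y \<in> space M" for y
      using x that I by (auto simp: space_PiM PiE_iff extensional_def)
    have m: "(\<lambda>y. F (x(i := y))) \<in> borel_measurable M"
      using measurable_compose[OF measurable_Pair1'[OF x] measurable_compose[OF upd F]] by simp
    have int: "integrable M (\<lambda>y. F (x(i := y)))"
      by (rule const_bound[where B=B]) (use b sp m in auto)
    have "\<bar>\<integral>y. F (x(i := y)) \<partial>M\<bar> \<le> (\<integral>y. \<bar>F (x(i := y))\<bar> \<partial>M)"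
      by (rule integral_abs_bound)
    also have "\<dots> \<le> (\<integral>y. B \<partial>M)"
      using int b sp by (intro integral_mono) auto
    finally show ?thesis by (simp add: total)
  qed
  have Gi: "integrable (PiM I (\<lambda>_. M)) (\<lambda>x. \<integral>y. F (x(i := y)) \<partial>M)"
    by (rule P.integrable_const_bound[where B=B]) (use G_bound Gm in auto)
  have "(\<integral>x. (\<integral>y. F (x(i := y)) \<partial>M) \<partial>PiM I (\<lambda>_. M)) =
      (\<integral>x. (\<integral>z. (\<integral>y. F ((x(i := z))(i := y)) \<partial>M) \<partial>M) \<partial>PiM K (\<lambda>_. M))"
    using product_integral_insert[OF K, of "\<lambda>x. \<integral>y. F (x(i := y)) \<partial>M"] Gi unfolding I_eq[symmetric] by simp
  \<comment> \<open>The fresh value overwrites the coordinate \<open>z\<close>, so the integral over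
    \<open>z\<close> is that of a constant.\<close>
  also have "\<dots> = (\<integral>x. (\<integral>y. F (x(i := y)) \<partial>M) \<partial>PiM K (\<lambda>_. M))"
    by (simp add: total)
  also have "\<dots> = (\<integral>x. F x \<partial>PiM I (\<lambda>_. M))"
    using product_integral_insert[OF K, of F] Fi unfolding I_eq[symmetric] by simp
  finally show ?thesis by simp
qed

text \<open>Chebyshev's inequality for a sum over ordered pairs. Disjoint pairs are independent;
  pairs with one common index are controlled by the conditional mean \<open>\<beta>\<close>, pairs
  on the same two indices by the supremum \<open>B\<close>. It is applied to the transmitters, and
  then to the receivers with the transmitters fixed.\<close>

lemma (in prob_space) pair_statistic_tail:
  fixes \<psi> :: "'a \<Rightarrow> 'a \<Rightarrow> real" and N :: nat
  assumes \<psi>[measurable]: "(\<lambda>(x, y). \<psi> x y) \<in> borel_measurable (M \<Otimes>\<^sub>M M)"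
    and nn: "\<And>x y. 0 \<le> \<psi> x y" and B: "\<And>x y. \<psi> x y \<le> B" and sym: "\<And>x y. \<psi> x y = \<psi> y x"
    and \<beta>: "\<And>x. x \<in> space M \<Longrightarrow> (\<integral>y. \<psi> x y \<partial>M) \<le> \<beta>"
    and \<kappa>: "(\<integral>x. (\<integral>y. \<psi> x y \<partial>M) \<partial>M) \<le> \<kappa>" "0 < \<kappa>" and N: "0 < N"
  shows "measure (PiM {..<N} (\<lambda>_. M))
      {x \<in> space (PiM {..<N} (\<lambda>_. M)). 2 * real N ^ 2 * \<kappa> \<le> (\<Sum>i<N. \<Sum>k<N. if i = k then 0 else \<psi> (x i) (x k))}
    \<le> (4 * real N * \<beta> + 4 * B) / (real N ^ 2 * \<kappa>)"
proof -
  let ?P = "PiM {..<N} (\<lambda>_. M)"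
  have pM: "prob_space M" by (rule prob_space_axioms)
  interpret P: prob_space ?P by (rule prob_space_PiM) (rule pM)
  define \<kappa>0 where "\<kappa>0 = (\<integral>x. (\<integral>y. \<psi> x y \<partial>M) \<partial>M)"
  define f where "f i k x = (if i = k then 0 else \<psi> (x i) (x k))" for i k :: nat and x
  have B0: "0 \<le> B" using nn B order_trans by blast
  have comp[measurable]: "(\<lambda>x. x i) \<in> measurable ?P M" if "i < N" for i
    using that by simp
  have [measurable]: "(\<lambda>x. \<psi> (x i) (x k)) \<in> borel_measurable ?P" if "i < N" "k < N" for i k
    using measurable_compose[OF measurable_Pair[OF comp[OF that(1)] comp[OF that(2)]] \<psi>] by simp
  have fm[measurable]: "f i k \<in> borel_measurable ?P" if "i < N" "k < N" for i k
    unfolding f_def[abs_def] using that by (cases "i = k") simp_all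
  have f0: "0 \<le> f i k x" and fB: "f i k x \<le> B" for i k x
    using nn B B0 by (auto simp: f_def)
  have fsym: "f i k = f k i" for i k
    using sym by (auto simp: f_def fun_eq_iff)
  have \<psi>m[measurable]: "(\<lambda>y. \<psi> x y) \<in> borel_measurable M" if "x \<in> space M" for x
    using measurable_compose[OF measurable_Pair1'[OF that] \<psi>] by simp
  have \<psi>i: "integrable M (\<lambda>y. \<psi> x y)" if "x \<in> space M" for x
    by (rule integrable_const_bound[where B=B]) (use nn B \<psi>m[OF that] in auto)
  define p where "p x = (\<integral>y. \<psi> x y \<partial>M)" for x
  have pm[measurable]: "p \<in> borel_measurable M"
    unfolding p_def using borel_measurable_lebesgue_integral[OF \<psi>] by simp
  have p0: "0 \<le> p x" for x unfolding p_def using nn by simp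
  have \<kappa>0: "0 \<le> \<kappa>0" unfolding \<kappa>0_def using nn by simp
  have \<beta>0: "0 \<le> \<beta>"
    using p0 \<beta> not_empty unfolding p_def by (metis ex_in_conv order_trans)
  have p\<beta>: "p x \<le> \<beta>" if "x \<in> space M" for x using \<beta>[OF that] by (simp add: p_def)
  have int: "integrable ?P g" if "g \<in> borel_measurable ?P" "\<And>x. x \<in> space ?P \<Longrightarrow> \<bar>g x\<bar> \<le> C" for g :: "_ \<Rightarrow> real" and C
    by (rule P.integrable_const_bound[where B=C]) (use that in auto)
  have sp: "x i \<in> space M" if "x \<in> space ?P" "i < N" for x i
    using that by (auto simp: space_PiM)
  have resample_p: "(\<integral>x. p (x i) \<partial>?P) = \<kappa>0" if "i < N" for i
  proof -
    have "(\<integral>x. p (x i) \<partial>?P) = (\<integral>x. (\<integral>y. p ((x(i := y)) i) \<partial>M) \<partial>?P)"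
      using that p0 p\<beta> sp by (intro integral_PiM_resample[where B=\<beta>]) auto
    also have "\<dots> = \<kappa>0" by (simp add: p_def \<kappa>0_def P.prob_space)
    finally show ?thesis .
  qed
  have mean: "(\<integral>x. f i k x \<partial>?P) = \<kappa>0" if "i < N" "k < N" "i \<noteq> k" for i k
  proof -
    have "(\<integral>x. f i k x \<partial>?P) = (\<integral>x. (\<integral>y. f i k (x(k := y)) \<partial>M) \<partial>?P)"
      using that f0 fB by (intro integral_PiM_resample[where B=B]) (auto simp: abs_le_iff intro: order_trans[of _ 0])
    also have "\<dots> = (\<integral>x. p (x i) \<partial>?P)" using that by (simp add: f_def p_def)
    finally show ?thesis using resample_p that by simp
  qed
  have prod_int: "integrable ?P (\<lambda>x. f i k x * f j l x)" if "i < N" "k < N" "j < N" "l < N" for i k j l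
    using that f0 fB B0 by (intro int[of _ "B * B"]) (auto simp: abs_mult intro!: mult_mono)
  have f_int: "integrable ?P (f i k)" if "i < N" "k < N" for i k
    using that f0 fB by (intro int[of _ B]) auto
  \<comment> \<open>The index \<open>l\<close> occurs in the second factor only; resampling it
    replaces that factor by its conditional mean.\<close>
  have free: "(\<integral>x. f i k x * f j l x \<partial>?P) = (\<integral>x. f i k x * p (x j) \<partial>?P)"
    if "i < N" "k < N" "j < N" "l < N" "j \<noteq> l" "l \<noteq> i" "l \<noteq> k" for i k j l
  proof -
    have "(\<integral>x. f i k x * f j l x \<partial>?P) = (\<integral>x. (\<integral>y. f i k (x(l := y)) * f j l (x(l := y)) \<partial>M) \<partial>?P)"
      using that f0 fB B0 by (intro integral_PiM_resample[where B="B * B"]) (auto simp: abs_mult intro!: mult_mono)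
    also have "\<dots> = (\<integral>x. f i k x * p (x j) \<partial>?P)"
      using that that(6,7)[symmetric] by (cases "i = k") (simp_all add: f_def p_def)
    finally show ?thesis .
  qed
  have fp_int: "integrable ?P (\<lambda>x. f i k x * p (x j))" if "i < N" "k < N" "j < N" for i k j
    using that f0 fB B0 p0 p\<beta> sp \<beta>0
    by (intro int[of _ "B * \<beta>"]) (auto simp: abs_mult intro!: mult_mono)
  have share: "(\<integral>x. f i k x * f j l x \<partial>?P) \<le> \<beta> * \<kappa>0"
    if "i < N" "k < N" "j < N" "l < N" "i \<noteq> k" "j \<noteq> l" "l \<noteq> i" "l \<noteq> k" for i k j l
  proof -
    have "(\<integral>x. f i k x * p (x j) \<partial>?P) \<le> (\<integral>x. \<beta> * f i k x \<partial>?P)"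
      using that fp_int f_int f0 p\<beta> sp by (intro integral_mono) (auto simp: mult.commute intro!: mult_right_mono)
    also have "\<dots> = \<beta> * \<kappa>0" using mean that by simp
    finally show ?thesis using free that by simp
  qed
  \<comment> \<open>One inequality for all coincidence patterns, written with separate indicators of
    \<open>j\<close> and \<open>l\<close> so that the sums over both indices factor.\<close>
  have bound: "(\<integral>x. f i k x * f j l x \<partial>?P) \<le>
      \<kappa>0\<^sup>2 * (if j = l then 0 else 1) + \<beta> * \<kappa>0 * (if j \<in> {i, k} then 1 else 0)
        + \<beta> * \<kappa>0 * (if l \<in> {i, k} then 1 else 0)
        + B * \<kappa>0 * ((if j \<in> {i, k} then 1 else 0) * (if l \<in> {i, k} then 1 else 0))"
    if ik: "i < N" "k < N" "i \<noteq> k" and jl: "j < N" "l < N" for i k j l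
  proof -
    have nonneg: "0 \<le> \<beta> * \<kappa>0" "0 \<le> B * \<kappa>0" "0 \<le> \<kappa>0\<^sup>2" using \<beta>0 \<kappa>0 B0 by auto
    consider "j = l" | "j \<noteq> l" "l \<notin> {i, k}" "j \<notin> {i, k}" | "j \<noteq> l" "l \<notin> {i, k}" "j \<in> {i, k}"
      | "j \<noteq> l" "l \<in> {i, k}" "j \<notin> {i, k}" | "j \<noteq> l" "l \<in> {i, k}" "j \<in> {i, k}" by blast
    then show ?thesis
    proof cases
      case 1
      then show ?thesis using nonneg by (simp add: f_def)
    next
      case 2
      have "(\<integral>x. f i k x * f j l x \<partial>?P) = (\<integral>x. f i k x * p (x j) \<partial>?P)"
        using free ik jl 2 by simp
      also have "\<dots> = (\<integral>x. (\<integral>y. f i k (x(j := y)) * p ((x(j := y)) j) \<partial>M) \<partial>?P)"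
        using ik jl f0 fB B0 p0 p\<beta> sp \<beta>0
        by (intro integral_PiM_resample[where B="B * \<beta>"]) (auto simp: abs_mult intro!: mult_mono)
      also have "\<dots> = (\<integral>x. f i k x * \<kappa>0 \<partial>?P)"
        using ik jl 2 by (simp add: f_def \<kappa>0_def p_def[symmetric])
      also have "\<dots> = \<kappa>0\<^sup>2" using mean ik by (simp add: power2_eq_square)
      finally show ?thesis using 2 nonneg by simp
    next
      case 3
      then have "(\<integral>x. f i k x * f j l x \<partial>?P) \<le> \<beta> * \<kappa>0"
        using ik jl by (intro share) auto
      then have "(\<integral>x. f i k x * f j l x \<partial>?P) \<le> \<kappa>0\<^sup>2 + \<beta> * \<kappa>0"
        using nonneg(3) by linarith
      then show ?thesis using 3 by simp
    next
      case 4
      then have "(\<integral>x. f i k x * f j l x \<partial>?P) \<le> \<beta> * \<kappa>0"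
        unfolding fsym[of j l] using ik jl by (intro share) auto
      then have "(\<integral>x. f i k x * f j l x \<partial>?P) \<le> \<kappa>0\<^sup>2 + \<beta> * \<kappa>0"
        using nonneg(3) by linarith
      then show ?thesis using 4 by simp
    next
      case 5
      have "(\<integral>x. f i k x * f j l x \<partial>?P) \<le> (\<integral>x. f i k x * B \<partial>?P)"
        using ik jl prod_int f_int f0 fB by (intro integral_mono) (auto intro!: mult_left_mono)
      also have "\<dots> = B * \<kappa>0" using mean ik by simp
      finally have "(\<integral>x. f i k x * f j l x \<partial>?P) \<le> \<kappa>0\<^sup>2 + \<beta> * \<kappa>0 + \<beta> * \<kappa>0 + B * \<kappa>0"
        using nonneg by linarith
      then show ?thesis using 5 by simp
    qed
  qed
  define U where "U x = (\<Sum>i<N. \<Sum>k<N. f i k x)" for x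
  have Um[measurable]: "U \<in> borel_measurable ?P" unfolding U_def[abs_def] by (intro borel_measurable_sum fm) auto
  have cnt1: "(\<Sum>j<N. (if j \<in> {i, k} then 1 else 0 :: real)) = 2" if "i < N" "k < N" "i \<noteq> k" for i k
  proof -
    have "(\<Sum>j<N. (if j \<in> {i, k} then 1 else 0 :: real)) = (\<Sum>j\<in>{i, k}. 1)"
      using that by (intro sum.mono_neutral_cong_right) auto
    then show ?thesis using that by simp
  qed
  have cnt2: "(\<Sum>j<N. \<Sum>l<N. (if j = l then 0 else 1 :: real)) = real N * (real N - 1)"
  proof -
    have "(\<Sum>l<N. (if j = l then 0 else 1 :: real)) = real N - 1" if "j < N" for j
    proof -
      have "(\<Sum>l<N. (if j = l then 0 else 1 :: real)) = (\<Sum>l\<in>{..<N} - {j}. 1)"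
        by (intro sum.mono_neutral_cong_right) auto
      then show ?thesis using that N by (simp add: of_nat_diff)
    qed
    then show ?thesis by simp
  qed
  have EU: "(\<integral>x. U x \<partial>?P) = real N * (real N - 1) * \<kappa>0"
  proof -
    have "(\<integral>x. U x \<partial>?P) = (\<Sum>i<N. \<Sum>k<N. \<integral>x. f i k x \<partial>?P)"
      unfolding U_def
      by (subst Bochner_Integration.integral_sum)
         (auto intro!: Bochner_Integration.integrable_sum f_int sum.cong Bochner_Integration.integral_sum)
    also have "\<dots> = (\<Sum>i<N. \<Sum>k<N. \<kappa>0 * (if i = k then 0 else 1))"
      using mean by (intro sum.cong refl) (auto simp: f_def)
    finally show ?thesis using cnt2 by (simp add: sum_distrib_left[symmetric])
  qed
  have Usq: "(U x)\<^sup>2 = (\<Sum>i<N. \<Sum>k<N. \<Sum>j<N. \<Sum>l<N. f i k x * f j l x)" for x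
    unfolding U_def power2_eq_square by (simp add: sum_product sum_distrib_left sum_distrib_right)
      (simp only: mult.commute)
  have EU2: "(\<integral>x. (U x)\<^sup>2 \<partial>?P) \<le> (real N * (real N - 1) * \<kappa>0)\<^sup>2 + real N ^ 2 * (4 * real N * \<beta> + 4 * B) * \<kappa>0"
  proof -
    have "(\<integral>x. (U x)\<^sup>2 \<partial>?P) = (\<Sum>i<N. \<Sum>k<N. \<Sum>j<N. \<Sum>l<N. \<integral>x. f i k x * f j l x \<partial>?P)"
      unfolding Usq
      by (subst Bochner_Integration.integral_sum, force intro!: Bochner_Integration.integrable_sum prod_int,
          rule sum.cong[OF refl])+ (rule refl)
    also have "\<dots> \<le> (\<Sum>i<N. \<Sum>k<N. (if i = k then 0 else
        real N * (real N - 1) * \<kappa>0\<^sup>2 + (4 * real N * \<beta> + 4 * B) * \<kappa>0))"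
    proof (intro sum_mono)
      fix i k assume "i \<in> {..<N}" "k \<in> {..<N}"
      then have ik: "i < N" "k < N" by auto
      show "(\<Sum>j<N. \<Sum>l<N. \<integral>x. f i k x * f j l x \<partial>?P) \<le> (if i = k then 0 else
        real N * (real N - 1) * \<kappa>0\<^sup>2 + (4 * real N * \<beta> + 4 * B) * \<kappa>0)"
      proof (cases "i = k")
        case True
        then show ?thesis by (simp add: f_def)
      next
        case False
        have "(\<Sum>j<N. \<Sum>l<N. \<integral>x. f i k x * f j l x \<partial>?P) \<le>
          (\<Sum>j<N. \<Sum>l<N. \<kappa>0\<^sup>2 * (if j = l then 0 else 1) + \<beta> * \<kappa>0 * (if j \<in> {i, k} then 1 else 0)
            + \<beta> * \<kappa>0 * (if l \<in> {i, k} then 1 else 0)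
            + B * \<kappa>0 * ((if j \<in> {i, k} then 1 else 0) * (if l \<in> {i, k} then 1 else 0)))"
          using ik False by (intro sum_mono bound) auto
        also have "\<dots> = \<kappa>0\<^sup>2 * (real N * (real N - 1)) + \<beta> * \<kappa>0 * (real N * 2)
            + \<beta> * \<kappa>0 * (real N * 2) + B * \<kappa>0 * (2 * 2)"
        proof -
          have c: "(\<Sum>j<N. (if j \<in> {i, k} then 1 else 0 :: real)) = 2" using cnt1 ik False by blast
          show ?thesis
            unfolding sum.distrib sum_distrib_left[symmetric] cnt2 c sum_constant
            by (simp only: sum_distrib_right[symmetric] c card_lessThan)
        qed
        finally show ?thesis using False by (simp add: algebra_simps)
      qed
    qed
    \<comment> \<open>Only N (N - 1) ordered pairs contribute, so the leading term is exactly the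
      squared mean and cancels in the variance.\<close>
    also have "\<dots> = (real N * (real N - 1)) * (real N * (real N - 1) * \<kappa>0\<^sup>2 + (4 * real N * \<beta> + 4 * B) * \<kappa>0)"
    proof -
      have "(\<Sum>i<N. \<Sum>k<N. (if i = k then 0 else c)) = c * (\<Sum>i<N. \<Sum>k<N. (if i = k then 0 else 1))"
        for c :: real
        unfolding sum_distrib_left by (intro sum.cong refl) auto
      then show ?thesis unfolding cnt2 by (simp only: mult.commute)
    qed
    also have "\<dots> = (real N * (real N - 1) * \<kappa>0)\<^sup>2 + (real N * (real N - 1)) * ((4 * real N * \<beta> + 4 * B) * \<kappa>0)"
      by (simp add: power2_eq_square algebra_simps)
    also have "\<dots> \<le> (real N * (real N - 1) * \<kappa>0)\<^sup>2 + real N ^ 2 * ((4 * real N * \<beta> + 4 * B) * \<kappa>0)"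
      using \<beta>0 B0 \<kappa>0 by (intro add_left_mono mult_right_mono) (auto simp: power2_eq_square intro!: mult_left_mono)
    finally show ?thesis by (simp add: mult.assoc)
  qed
  have U_bound: "\<bar>U x\<bar> \<le> real N * (real N * B)" for x
  proof -
    have "0 \<le> U x" unfolding U_def using f0 by (intro sum_nonneg)
    moreover have "U x \<le> (\<Sum>i<N. \<Sum>k<N. B)" unfolding U_def using fB by (intro sum_mono)
    ultimately show ?thesis by simp
  qed
  have Ui: "integrable ?P U" using U_bound by (intro int[of _ "real N * (real N * B)"]) auto
  have U2i: "integrable ?P (\<lambda>x. (U x)\<^sup>2)"
  proof (rule int[of _ "(real N * (real N * B))\<^sup>2"])
    fix x show "\<bar>(U x)\<^sup>2\<bar> \<le> (real N * (real N * B))\<^sup>2"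
      using U_bound[of x] power_mono[of "\<bar>U x\<bar>" _ 2] by simp
  qed measurable
  have var: "P.variance U \<le> real N ^ 2 * (4 * real N * \<beta> + 4 * B) * \<kappa>0"
    using P.variance_eq[OF Ui U2i] EU EU2 by simp
  have pos: "0 < real N ^ 2 * \<kappa>" using N \<kappa> by simp
  have "P.prob {x \<in> space ?P. 2 * real N ^ 2 * \<kappa> \<le> U x} \<le>
      P.prob {x \<in> space ?P. real N ^ 2 * \<kappa> \<le> \<bar>U x - P.expectation U\<bar>}"
  proof (rule P.finite_measure_mono)
    \<comment> \<open>The mean is at most N^2 \<kappa>, so reaching twice this value requires a
      deviation of N^2 \<kappa>.\<close>
    have "real N * (real N - 1) * \<kappa>0 \<le> real N ^ 2 * \<kappa>"
      using \<kappa> \<kappa>0 N unfolding \<kappa>0_def[symmetric]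
      by (intro mult_mono) (auto simp: power2_eq_square)
    then show "{x \<in> space ?P. 2 * real N ^ 2 * \<kappa> \<le> U x} \<subseteq>
        {x \<in> space ?P. real N ^ 2 * \<kappa> \<le> \<bar>U x - P.expectation U\<bar>}"
      unfolding EU by auto
  qed measurable
  also have "\<dots> \<le> P.variance U / (real N ^ 2 * \<kappa>)\<^sup>2"
    using P.Chebyshev_inequality[OF Um U2i pos] .
  also have "\<dots> \<le> (real N ^ 2 * (4 * real N * \<beta> + 4 * B) * \<kappa>) / (real N ^ 2 * \<kappa>)\<^sup>2"
  proof (rule divide_right_mono)
    have "real N ^ 2 * (4 * real N * \<beta> + 4 * B) * \<kappa>0 \<le> real N ^ 2 * (4 * real N * \<beta> + 4 * B) * \<kappa>"
      using \<kappa> \<beta>0 B0 unfolding \<kappa>0_def[symmetric] by (intro mult_left_mono) auto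
    with var show "P.variance U \<le> real N ^ 2 * (4 * real N * \<beta> + 4 * B) * \<kappa>" by linarith
  qed simp
  also have "\<dots> = (4 * real N * \<beta> + 4 * B) / (real N ^ 2 * \<kappa>)"
    using pos \<kappa> N by (simp add: power2_eq_square)
  finally show ?thesis unfolding U_def f_def .
qed

lemma correlation_swap: "correlation D L lam t2 t1 = cnj (correlation D L lam t1 t2)"
  unfolding correlation_def Bochner_Integration.integral_cnj[symmetric] by (simp add: mult.commute)

lemma spatial_dof_ge_1: "1 \<le> spatial_dof D L lam"
  by (simp add: spatial_dof_def)

text \<open>A squared correlation is at most 16 and its conditional mean at most 3000 / m for every
  transmitter. The failure probability is therefore 4 / N plus a multiple of m / N^2, and m \<le>
  N.\<close>

lemma correlation_tail:
  fixes N :: nat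
  assumes D: "0 < D" "2 * D \<le> L" and lam: "0 < lam" and N: "0 < N"
  defines "m \<equiv> min (real N) (spatial_dof D L lam)"
  shows "measure (PiM {..<N} (\<lambda>_. uniform_square (0, 0) D))
      {t \<in> space (PiM {..<N} (\<lambda>_. uniform_square (0, 0) D)). 2 * real N ^ 2 * (3000 / m) \<le>
        (\<Sum>i<N. \<Sum>k<N. if i = k then 0 else (cmod (correlation D L lam (t i) (t k)))\<^sup>2)} \<le> 5 / real N"
proof -
  interpret U: prob_space "uniform_square (0, 0) D" by (rule prob_space_uniform_square[OF D(1)])
  have m: "1 \<le> m" "m \<le> N" "m \<le> spatial_dof D L lam"
    using N spatial_dof_ge_1[of D L lam] by (auto simp: m_def)
  let ?\<psi> = "\<lambda>t t'. (cmod (correlation D L lam t t'))\<^sup>2"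
  have mean: "(\<integral>t'. ?\<psi> t t' \<partial>uniform_square (0, 0) D) \<le> 3000 / m" for t
  proof (cases "t \<in> square (0, 0) D")
    case True
    have "(\<integral>t'. ?\<psi> t t' \<partial>uniform_square (0, 0) D) \<le> 3000 / spatial_dof D L lam"
      by (rule correlation_mean_square_dof[OF D lam True])
    also have "\<dots> \<le> 3000 / m" using m by (intro divide_left_mono) auto
    finally show ?thesis .
  next
    case False
    then have "correlation D L lam t t' = 0" for t' by (simp add: correlation_def wave_def)
    then show ?thesis using m by simp
  qed
  have [measurable]: "(\<lambda>(t, t'). correlation D L lam t t') \<in> borel_measurable (borel \<Otimes>\<^sub>M borel)"
    by (rule correlation_measurable[OF D(1)])
  have "measure (PiM {..<N} (\<lambda>_. uniform_square (0, 0) D))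
      {t \<in> space (PiM {..<N} (\<lambda>_. uniform_square (0, 0) D)). 2 * real N ^ 2 * (3000 / m) \<le>
        (\<Sum>i<N. \<Sum>k<N. if i = k then 0 else ?\<psi> (t i) (t k))}
      \<le> (4 * real N * (3000 / m) + 4 * 16) / (real N ^ 2 * (3000 / m))"
  proof (rule U.pair_statistic_tail)
    show "(\<lambda>(t, t'). ?\<psi> t t') \<in> borel_measurable (uniform_square (0, 0) D \<Otimes>\<^sub>M uniform_square (0, 0) D)"
      by measurable
    show "?\<psi> t t' \<le> 16" for t t'
      using power_mono[OF norm_correlation_le[OF D, of lam t t'], of 2] by simp
    show "?\<psi> t t' = ?\<psi> t' t" for t t'
      using correlation_swap[of D L lam t t'] by simp
    have "(\<integral>t. (\<integral>t'. ?\<psi> t t' \<partial>uniform_square (0, 0) D) \<partial>uniform_square (0, 0) D) \<le>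
        (\<integral>t. 3000 / m \<partial>uniform_square (0, 0) D)"
      using mean m by (intro integral_mono') auto
    also have "\<dots> = 3000 / m" using U.prob_space by simp
    finally show "(\<integral>t. (\<integral>t'. ?\<psi> t t' \<partial>uniform_square (0, 0) D) \<partial>uniform_square (0, 0) D) \<le> 3000 / m" .
  qed (use mean m N in auto)
  also have "\<dots> = 4 / real N + 64 / 3000 * (m / real N ^ 2)"
  proof -
    have "4 * real N * (3000 / m) / (real N ^ 2 * (3000 / m)) = 4 / real N"
      using m by (simp add: power2_eq_square)
    moreover have "4 * 16 / (real N ^ 2 * (3000 / m)) = 64 / 3000 * (m / real N ^ 2)"
      using m by simp
    ultimately show ?thesis by (simp only: add_divide_distrib)
  qed
  also have "m / real N ^ 2 \<le> real N / real N ^ 2"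
    using m by (intro divide_right_mono) auto
  also have "4 / real N + 64 / 3000 * (real N / real N ^ 2) \<le> 5 / real N"
    using N by (simp add: power2_eq_square divide_simps)
  finally show ?thesis by simp
qed

text \<open>Expanding the square exchanges the two sides of the channel: for two random receivers,
  the mean squared inner product equals the sum of the squared correlations over all pairs of
  transmitters. Given one receiver, the conditional mean is bounded by 4 times the sum of the
  moduli, of order N^2 / sqrt m by Cauchy-Schwarz; this produces the rate 1 / sqrt N.\<close>

lemma gram_tail:
  fixes N :: nat and t :: "nat \<Rightarrow> real \<times> real"
  assumes D: "0 < D" "2 * D \<le> L" and N: "0 < N" and m: "1 \<le> m" "m \<le> real N"
    and corr: "(\<Sum>i<N. \<Sum>k<N. (cmod (correlation D L lam (t i) (t k)))\<^sup>2) \<le> 6016 * real N ^ 2 / m"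
  shows "measure (PiM {..<N} (\<lambda>_. uniform_square (L, 0) D))
      {r \<in> space (PiM {..<N} (\<lambda>_. uniform_square (L, 0) D)). 2 * real N ^ 2 * (6016 * real N ^ 2 / m) \<le>
        (\<Sum>p<N. \<Sum>q<N. if p = q then 0 else
          (cmod (\<Sum>i<N. wave D L lam (r p) (t i) * cnj (wave D L lam (r q) (t i))))\<^sup>2)} \<le> 1 / sqrt (real N)"
proof -
  interpret U: prob_space "uniform_square (L, 0) D" by (rule prob_space_uniform_square[OF D(1)])
  let ?U = "uniform_square (L, 0) D"
  define a where "a r i = wave D L lam r (t i)" for r i
  define C where "C i k = correlation D L lam (t i) (t k)" for i k
  define \<psi> where "\<psi> r r' = (cmod (\<Sum>i<N. a r i * cnj (a r' i)))\<^sup>2" for r r'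
  have [measurable]: "(\<lambda>r. a r i) \<in> borel_measurable borel" for i
    unfolding a_def by measurable
  have a2: "cmod (a r i) \<le> 2" for r i unfolding a_def by (rule norm_wave_le[OF D])
  have aa: "cmod (a r i * cnj (a r' k)) \<le> 4" for r r' i k
    using mult_mono[OF a2[of r i] a2[of r' k]] by (simp add: norm_mult)
  have iaa: "integrable ?U (\<lambda>r. a r i * cnj (a r k))" for i k
    by (rule U.integrable_const_bound[where B=4]) (use aa in auto)
  have C_eq: "(\<integral>r. a r i * cnj (a r k) \<partial>?U) = C i k" for i k
    by (simp add: a_def C_def correlation_def)
  have \<psi>_eq: "complex_of_real (\<psi> r r') = (\<Sum>i<N. \<Sum>k<N. (a r i * cnj (a r k)) * (a r' k * cnj (a r' i)))" for r r'
    unfolding \<psi>_def complex_norm_square cnj_sum sum_product by (intro sum.cong refl) (simp add: mult_ac)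
  have inner: "complex_of_real (\<integral>r'. \<psi> r r' \<partial>?U) = (\<Sum>i<N. \<Sum>k<N. (a r i * cnj (a r k)) * C k i)" for r
  proof -
    have "complex_of_real (\<integral>r'. \<psi> r r' \<partial>?U) =
        (\<integral>r'. (\<Sum>i<N. \<Sum>k<N. (a r i * cnj (a r k)) * (a r' k * cnj (a r' i))) \<partial>?U)"
      unfolding \<psi>_eq[symmetric] by (rule integral_complex_of_real[symmetric])
    also have "\<dots> = (\<Sum>i<N. \<integral>r'. (\<Sum>k<N. (a r i * cnj (a r k)) * (a r' k * cnj (a r' i))) \<partial>?U)"
      by (intro Bochner_Integration.integral_sum Bochner_Integration.integrable_sum integrable_mult_right iaa)
    also have "\<dots> = (\<Sum>i<N. \<Sum>k<N. \<integral>r'. (a r i * cnj (a r k)) * (a r' k * cnj (a r' i)) \<partial>?U)"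
      by (intro sum.cong refl Bochner_Integration.integral_sum integrable_mult_right iaa)
    also have "\<dots> = (\<Sum>i<N. \<Sum>k<N. (a r i * cnj (a r k)) * C k i)"
      by (simp add: C_eq)
    finally show ?thesis .
  qed
  have outer: "(\<integral>r. (\<integral>r'. \<psi> r r' \<partial>?U) \<partial>?U) = (\<Sum>i<N. \<Sum>k<N. (cmod (C i k))\<^sup>2)"
  proof -
    have "complex_of_real (\<integral>r. (\<integral>r'. \<psi> r r' \<partial>?U) \<partial>?U) =
        (\<integral>r. (\<Sum>i<N. \<Sum>k<N. (a r i * cnj (a r k)) * C k i) \<partial>?U)"
      unfolding inner[symmetric] by (rule integral_complex_of_real[symmetric])
    also have "\<dots> = (\<Sum>i<N. \<integral>r. (\<Sum>k<N. (a r i * cnj (a r k)) * C k i) \<partial>?U)"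
      by (intro Bochner_Integration.integral_sum Bochner_Integration.integrable_sum integrable_mult_left iaa)
    also have "\<dots> = (\<Sum>i<N. \<Sum>k<N. \<integral>r. (a r i * cnj (a r k)) * C k i \<partial>?U)"
      by (intro sum.cong refl Bochner_Integration.integral_sum integrable_mult_left iaa)
    also have "\<dots> = (\<Sum>i<N. \<Sum>k<N. complex_of_real ((cmod (C i k))\<^sup>2))"
    proof (intro sum.cong refl)
      fix i k
      have "C k i = cnj (C i k)" unfolding C_def by (rule correlation_swap)
      then show "(\<integral>r. (a r i * cnj (a r k)) * C k i \<partial>?U) = complex_of_real ((cmod (C i k))\<^sup>2)"
        by (simp add: C_eq complex_norm_square del: of_real_power)
    qed
    finally show ?thesis by (simp only: of_real_sum[symmetric] of_real_eq_iff)
  qed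
  have m0: "0 < m" using m by simp
  \<comment> \<open>78 is the least integer whose square exceeds 6016.\<close>
  have sumC: "(\<Sum>i<N. \<Sum>k<N. cmod (C k i)) \<le> 78 * real N ^ 2 / sqrt m"
  proof -
    let ?A = "{..<N} \<times> {..<N}"
    have "(\<Sum>(i, k)\<in>?A. 1 * cmod (C k i))\<^sup>2 \<le> (\<Sum>(i, k)\<in>?A. 1\<^sup>2) * (\<Sum>(i, k)\<in>?A. (cmod (C k i))\<^sup>2)"
      using Cauchy_Schwarz_ineq_sum[of "\<lambda>_. 1" "\<lambda>(i, k). cmod (C k i)" ?A]
      by (simp add: case_prod_unfold)
    then have "(\<Sum>i<N. \<Sum>k<N. cmod (C k i))\<^sup>2 \<le> real N ^ 2 * (\<Sum>i<N. \<Sum>k<N. (cmod (C k i))\<^sup>2)"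
      by (simp add: sum.cartesian_product[symmetric] power2_eq_square[of "real N"])
    also have "(\<Sum>i<N. \<Sum>k<N. (cmod (C k i))\<^sup>2) = (\<Sum>i<N. \<Sum>k<N. (cmod (C i k))\<^sup>2)"
      by (rule sum.swap)
    also have "real N ^ 2 * \<dots> \<le> real N ^ 2 * (78\<^sup>2 * real N ^ 2 / m)"
    proof (rule mult_left_mono)
      have "6016 * real N ^ 2 / m \<le> 78\<^sup>2 * real N ^ 2 / m"
        using m0 by (intro divide_right_mono mult_right_mono) auto
      with corr show "(\<Sum>i<N. \<Sum>k<N. (cmod (C i k))\<^sup>2) \<le> 78\<^sup>2 * real N ^ 2 / m"
        unfolding C_def by linarith
    qed simp
    also have "\<dots> = (78 * real N ^ 2 / sqrt m)\<^sup>2"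
      using m0 by (simp add: power_divide power_mult_distrib power2_eq_square)
    finally show ?thesis
      by (rule power2_le_imp_le) (use m0 in simp)
  qed
  define \<beta> where "\<beta> = 312 * real N ^ 2 / sqrt m"
  have \<psi>_mean: "(\<integral>r'. \<psi> r r' \<partial>?U) \<le> \<beta>" for r
  proof -
    have "(\<integral>r'. \<psi> r r' \<partial>?U) \<le> cmod (complex_of_real (\<integral>r'. \<psi> r r' \<partial>?U))" by simp
    also have "\<dots> \<le> (\<Sum>i<N. \<Sum>k<N. cmod ((a r i * cnj (a r k)) * C k i))"
      unfolding inner by (rule order_trans[OF norm_sum]) (intro sum_mono norm_sum)
    also have "\<dots> \<le> (\<Sum>i<N. \<Sum>k<N. 4 * cmod (C k i))"
      unfolding norm_mult[of "_ * _" "C _ _"] using aa by (intro sum_mono mult_right_mono) auto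
    also have "\<dots> = 4 * (\<Sum>i<N. \<Sum>k<N. cmod (C k i))" by (simp add: sum_distrib_left)
    also have "\<dots> \<le> 4 * (78 * real N ^ 2 / sqrt m)" using sumC by simp
    finally show ?thesis by (simp add: \<beta>_def)
  qed
  have \<psi>_le: "\<psi> r r' \<le> 16 * real N ^ 2" for r r'
  proof -
    have "cmod (\<Sum>i<N. a r i * cnj (a r' i)) \<le> (\<Sum>i<N. 4)"
      using aa by (intro order_trans[OF norm_sum] sum_mono)
    then have "\<psi> r r' \<le> (4 * real N)\<^sup>2" unfolding \<psi>_def by (intro power_mono) auto
    then show ?thesis by (simp add: power_mult_distrib)
  qed
  have "measure (PiM {..<N} (\<lambda>_. ?U))
      {r \<in> space (PiM {..<N} (\<lambda>_. ?U)). 2 * real N ^ 2 * (6016 * real N ^ 2 / m) \<le>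
        (\<Sum>p<N. \<Sum>q<N. if p = q then 0 else \<psi> (r p) (r q))}
      \<le> (4 * real N * \<beta> + 4 * (16 * real N ^ 2)) / (real N ^ 2 * (6016 * real N ^ 2 / m))"
  proof (rule U.pair_statistic_tail)
    show "(\<lambda>(r, r'). \<psi> r r') \<in> borel_measurable (?U \<Otimes>\<^sub>M ?U)"
      unfolding \<psi>_def by measurable
    show "\<psi> r r' = \<psi> r' r" for r r'
    proof -
      have "(\<Sum>i<N. a r' i * cnj (a r i)) = cnj (\<Sum>i<N. a r i * cnj (a r' i))"
        by (simp add: mult.commute)
      then show ?thesis unfolding \<psi>_def by (simp only: complex_mod_cnj)
    qed
    show "(\<integral>r. (\<integral>r'. \<psi> r r' \<partial>?U) \<partial>?U) \<le> 6016 * real N ^ 2 / m"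
      unfolding outer C_def by (rule corr)
  qed (use \<psi>_mean \<psi>_le m N in \<open>auto simp: \<psi>_def[symmetric]\<close>, simp add: \<psi>_def)
  also have "\<dots> \<le> 1 / sqrt (real N)"
  proof -
    define n where "n = real N"
    have n: "1 \<le> n" using N by (simp add: n_def)
    define s where "s = sqrt m"
    have s: "0 < s" "m = s * s" "s \<le> sqrt n" using m m0 by (simp_all add: s_def n_def)
    have "(4 * n * \<beta> + 4 * (16 * n ^ 2)) / (n ^ 2 * (6016 * n ^ 2 / m)) = 1248 / 6016 * (s / n) + 64 / 6016 * (m / n ^ 2)"
    proof -
      have "4 * n * \<beta> / (n ^ 2 * (6016 * n ^ 2 / m)) = 1248 / 6016 * (s / n)"
        using n s(1) by (simp add: \<beta>_def n_def[symmetric] s_def[symmetric] s(2) power2_eq_square)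
      moreover have "4 * (16 * n ^ 2) / (n ^ 2 * (6016 * n ^ 2 / m)) = 64 / 6016 * (m / n ^ 2)"
        using n s(1) by (simp add: s(2) power2_eq_square)
      ultimately show ?thesis by (simp only: add_divide_distrib)
    qed
    also have "s / n \<le> sqrt n / n" using s n by (intro divide_right_mono) auto
    also have "sqrt n / n = 1 / sqrt n" using n sqrt_divide_self_eq[of n] by (simp add: inverse_eq_divide)
    also have "m / n ^ 2 \<le> n / n ^ 2" using m by (intro divide_right_mono) (auto simp: n_def)
    also have "n / n ^ 2 = 1 / n" by (simp add: power2_eq_square)
    also have "1 / n \<le> 1 / sqrt n"
    proof -
      have "sqrt n \<le> n" using n real_sqrt_le_mono[of n "n\<^sup>2"] by (simp add: power2_eq_square)
      then show ?thesis using n by (intro divide_left_mono) auto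
    qed
    finally have "(4 * n * \<beta> + 4 * (16 * n ^ 2)) / (n ^ 2 * (6016 * n ^ 2 / m)) \<le>
        1248 / 6016 * (1 / sqrt n) + 64 / 6016 * (1 / sqrt n)" by simp
    also have "\<dots> \<le> 1 / sqrt n"
    proof -
      have "0 \<le> 1 / sqrt n" using n by simp
      then show ?thesis by linarith
    qed
    finally show ?thesis unfolding n_def .
  qed
  finally show ?thesis unfolding \<psi>_def a_def .
qed

section \<open>The favourable event for both placements\<close>

lemma AE_uniform_squares:
  fixes N :: nat
  assumes "0 < D"
  shows "AE x in PiM {..<N} (\<lambda>_. uniform_square c D). \<forall>i\<in>{..<N}. x i \<in> square c D"
proof (rule AE_finite_allI)
  fix i assume i: "i \<in> {..<N}"
  have "AE x in uniform_square c D. x \<in> square c D"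
    by (rule AE_uniform_measureI) auto
  then show "AE x in PiM {..<N} (\<lambda>_. uniform_square c D). x i \<in> square c D"
    by (intro AE_PiM_component prob_space_uniform_square assms i)
qed simp

text \<open>For a good placement of the transmitters the section of the event has probability at
  least 1 - 1 / sqrt N, and Fubini's theorem combines the two. The diagonal sums, at most 16 N and
  16 N^3, are absorbed by m \<le> N; this gives 6016 = 2 * 3000 + 16 and 12048 = 2 * 6016 +
  16.\<close>

lemma placement_gram_event:
  fixes N :: nat
  assumes D: "0 < D" "2 * D \<le> L" and lam: "0 < lam" and N: "0 < N"
  defines "m \<equiv> min (real N) (spatial_dof D L lam)"
  shows "\<exists>E\<in>sets (placement D L N).
    (\<forall>(t, r)\<in>E. (\<forall>i<N. t i \<in> square (0, 0) D) \<and> (\<forall>p<N. r p \<in> square (L, 0) D) \<and>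
      (\<Sum>p<N. \<Sum>q<N. (cmod (\<Sum>i<N. wave D L lam (r p) (t i) * cnj (wave D L lam (r q) (t i))))\<^sup>2)
        \<le> 12048 * real N ^ 4 / m) \<and>
    (1 - 1 / sqrt (real N)) * (1 - 5 / real N) \<le> measure (placement D L N) E"
proof -
  define T where "T = PiM {..<N} (\<lambda>_. uniform_square (0, 0) D)"
  define R where "R = PiM {..<N} (\<lambda>_. uniform_square (L, 0) D)"
  interpret T: prob_space T unfolding T_def by (intro prob_space_PiM prob_space_uniform_square D)
  interpret R: prob_space R unfolding R_def by (intro prob_space_PiM prob_space_uniform_square D)
  interpret TR: pair_prob_space T R ..
  have place: "placement D L N = T \<Otimes>\<^sub>M R" by (simp add: placement_def T_def R_def)
  have m: "1 \<le> m" "m \<le> real N"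
    using N spatial_dof_ge_1[of D L lam] by (auto simp: m_def)
  have [measurable]: "(\<lambda>t. t i) \<in> measurable T borel" "(\<lambda>r. r i) \<in> measurable R borel" if "i < N" for i
  proof -
    have "(\<lambda>t. t i) \<in> measurable T (uniform_square (0, 0) D)" "(\<lambda>r. r i) \<in> measurable R (uniform_square (L, 0) D)"
      unfolding T_def R_def using that by (auto intro!: measurable_component_singleton)
    moreover have "measurable T (uniform_square (0, 0) D) = measurable T borel"
      "measurable R (uniform_square (L, 0) D) = measurable R borel"
      by (intro measurable_cong_sets; simp)+
    ultimately show "(\<lambda>t. t i) \<in> measurable T borel" "(\<lambda>r. r i) \<in> measurable R borel" by simp_all
  qed
  define \<psi> where "\<psi> t p q r = (cmod (\<Sum>i<N. wave D L lam (r p) (t i) * cnj (wave D L lam (r q) (t i))))\<^sup>2"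
    for t r :: "nat \<Rightarrow> real \<times> real" and p q :: nat
  \<comment> \<open>Membership in the squares is almost sure, but it is required pointwise:
    \<open>wave\<close> is the scaled channel coefficient only there.\<close>
  define E where "E = {x \<in> space (T \<Otimes>\<^sub>M R). (\<forall>i\<in>{..<N}. fst x i \<in> square (0, 0) D) \<and>
      (\<forall>p\<in>{..<N}. snd x p \<in> square (L, 0) D) \<and>
      (\<Sum>p<N. \<Sum>q<N. \<psi> (fst x) p q (snd x)) \<le> 12048 * real N ^ 4 / m}"
  have [measurable]: "(\<lambda>x. \<psi> (fst x) p q (snd x)) \<in> borel_measurable (T \<Otimes>\<^sub>M R)" if "p < N" "q < N" for p q
    unfolding \<psi>_def using that
    by (intro borel_measurable_power borel_measurable_norm[THEN measurable_compose[rotated]] borel_measurable_sum) measurable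
  have E[measurable]: "E \<in> sets (T \<Otimes>\<^sub>M R)"
    unfolding E_def by measurable
  define BT where "BT = {t \<in> space T. 2 * real N ^ 2 * (3000 / m) \<le>
        (\<Sum>i<N. \<Sum>k<N. if i = k then 0 else (cmod (correlation D L lam (t i) (t k)))\<^sup>2)}"
  define BR where "BR t = {r \<in> space R. 2 * real N ^ 2 * (6016 * real N ^ 2 / m) \<le>
        (\<Sum>p<N. \<Sum>q<N. if p = q then 0 else \<psi> t p q r)}" for t
  have BT: "T.prob BT \<le> 5 / real N"
    unfolding BT_def T_def m_def by (rule correlation_tail[OF D lam N])
  have [measurable]: "(\<lambda>t. correlation D L lam (t i) (t k)) \<in> borel_measurable T" if "i < N" "k < N" for i k
    using measurable_compose[OF measurable_Pair correlation_measurable[OF D(1), of L lam], of "\<lambda>t. t i" T "\<lambda>t. t k"] that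
    by simp
  have mBT[measurable]: "BT \<in> sets T"
    unfolding BT_def by measurable
  have mBR[measurable]: "BR t \<in> sets R" for t
    unfolding BR_def \<psi>_def by measurable
  have sec_ge: "1 - 1 / sqrt (real N) \<le> R.prob (Pair t -` E)"
    if t: "t \<in> space T" "t \<notin> BT" "\<forall>i\<in>{..<N}. t i \<in> square (0, 0) D" for t
  proof -
    let ?c = "\<lambda>i k. (cmod (correlation D L lam (t i) (t k)))\<^sup>2"
    have c16: "?c i k \<le> 16" for i k
      using power_mono[OF norm_correlation_le[OF D, of lam "t i" "t k"], of 2] by simp
    have "(\<Sum>i<N. \<Sum>k<N. ?c i k) = (\<Sum>i<N. \<Sum>k<N. if i = k then 0 else ?c i k) + (\<Sum>i<N. ?c i i)"
      unfolding sum.distrib[symmetric] by (intro sum.cong refl) (simp add: sum.remove[of "{..<N}"])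
    also have "\<dots> \<le> 2 * real N ^ 2 * (3000 / m) + (\<Sum>i<N. 16)"
      using t(1,2) c16 by (intro add_mono sum_mono) (auto simp: BT_def)
    also have "\<dots> \<le> 6016 * real N ^ 2 / m"
    proof -
      have "16 * real N * m \<le> 16 * real N * real N" using m by (intro mult_left_mono) auto
      then have "16 * real N \<le> 16 * real N ^ 2 / m"
        using m by (simp add: pos_le_divide_eq power2_eq_square)
      moreover have "2 * real N ^ 2 * (3000 / m) + 16 * real N ^ 2 / m = 6016 * real N ^ 2 / m"
        by (simp add: add_divide_distrib[symmetric])
      ultimately show ?thesis by simp
    qed
    finally have corr: "(\<Sum>i<N. \<Sum>k<N. ?c i k) \<le> 6016 * real N ^ 2 / m" .
    have BRt: "R.prob (BR t) \<le> 1 / sqrt (real N)"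
      unfolding BR_def R_def \<psi>_def by (rule gram_tail[OF D N m corr])
    have \<psi>16: "\<psi> t p p r \<le> 16 * real N ^ 2" for p r
    proof -
      have "cmod (\<Sum>i<N. wave D L lam (r p) (t i) * cnj (wave D L lam (r p) (t i))) \<le> (\<Sum>i<N. 4)"
        by (rule order_trans[OF norm_sum]) (intro sum_mono norm_wave_product_le[OF D])
      then have "\<psi> t p p r \<le> (4 * real N)\<^sup>2" unfolding \<psi>_def by (intro power_mono) auto
      then show ?thesis by (simp add: power_mult_distrib)
    qed
    have good: "r \<in> Pair t -` E" if r: "r \<in> space R" "r \<notin> BR t" "\<forall>p\<in>{..<N}. r p \<in> square (L, 0) D" for r
    proof -
      have "(\<Sum>p<N. \<Sum>q<N. \<psi> t p q r) = (\<Sum>p<N. \<Sum>q<N. if p = q then 0 else \<psi> t p q r) + (\<Sum>p<N. \<psi> t p p r)"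
        unfolding sum.distrib[symmetric] by (intro sum.cong refl) (simp add: sum.remove[of "{..<N}"])
      also have "\<dots> \<le> 2 * real N ^ 2 * (6016 * real N ^ 2 / m) + (\<Sum>p<N. 16 * real N ^ 2)"
        using r(1,2) \<psi>16 by (intro add_mono sum_mono) (auto simp: BR_def)
      also have "\<dots> \<le> 12048 * real N ^ 4 / m"
      proof -
        have "16 * real N ^ 3 * m \<le> 16 * real N ^ 3 * real N" using m by (intro mult_left_mono) auto
        then have "16 * real N ^ 3 \<le> 16 * real N ^ 4 / m"
          using m by (simp add: pos_le_divide_eq power3_eq_cube power4_eq_xxxx mult.assoc)
        moreover have "2 * real N ^ 2 * (6016 * real N ^ 2 / m) + 16 * real N ^ 4 / m = 12048 * real N ^ 4 / m"
          by (simp add: add_divide_distrib[symmetric] power2_eq_square power4_eq_xxxx mult.assoc)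
        moreover have "(\<Sum>p<N. 16 * real N ^ 2) = 16 * real N ^ 3"
          by (simp add: power3_eq_cube power2_eq_square)
        ultimately show ?thesis by simp
      qed
      finally show ?thesis using t r by (simp add: E_def space_pair_measure)
    qed
    have "1 - 1 / sqrt (real N) \<le> 1 - R.prob (BR t)" using BRt by simp
    also have "\<dots> = R.prob (space R - BR t)" by (rule R.prob_compl[symmetric]) simp
    also have "\<dots> \<le> R.prob (Pair t -` E)"
    proof (rule R.finite_measure_mono_AE)
      have "AE r in R. \<forall>p\<in>{..<N}. r p \<in> square (L, 0) D"
        unfolding R_def by (rule AE_uniform_squares[OF D(1)])
      then show "AE r in R. r \<in> space R - BR t \<longrightarrow> r \<in> Pair t -` E"
        by (rule AE_mp) (use good in auto)
      show "Pair t -` E \<in> sets R" by (rule sets_Pair1[OF E])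
    qed
    finally show ?thesis .
  qed
  have "(1 - 1 / sqrt (real N)) * (1 - 5 / real N) \<le> (1 - 1 / sqrt (real N)) * T.prob (space T - BT)"
  proof (rule mult_left_mono)
    show "1 - 5 / real N \<le> T.prob (space T - BT)" using BT T.prob_compl[OF mBT] by simp
    show "0 \<le> 1 - 1 / sqrt (real N)" using N by simp
  qed
  also have "\<dots> = (\<integral>t. (1 - 1 / sqrt (real N)) * indicator (space T - BT) t \<partial>T)"
    by simp
  also have "\<dots> \<le> (\<integral>t. R.prob (Pair t -` E) \<partial>T)"
  proof (rule integral_mono_AE)
    show "integrable T (\<lambda>t. (1 - 1 / sqrt (real N)) * indicator (space T - BT) t)"
      by (intro integrable_mult_right integrable_real_indicator) (auto simp: T.emeasure_eq_measure)
    have "(\<lambda>t. R.prob (Pair t -` E)) \<in> borel_measurable T"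
      unfolding measure_def using R.measurable_emeasure_Pair[OF E] by measurable
    then show "integrable T (\<lambda>t. R.prob (Pair t -` E))"
      by (rule T.integrable_const_bound[where B=1, rotated]) auto
    have "AE t in T. \<forall>i\<in>{..<N}. t i \<in> square (0, 0) D"
      unfolding T_def by (rule AE_uniform_squares[OF D(1)])
    then show "AE t in T. (1 - 1 / sqrt (real N)) * indicator (space T - BT) t \<le> R.prob (Pair t -` E)"
      by (rule AE_mp) (use sec_ge in \<open>auto simp: indicator_def\<close>)
  qed
  also have "\<dots> = measure (T \<Otimes>\<^sub>M R) E"
  proof -
    have "ennreal (measure (T \<Otimes>\<^sub>M R) E) = (\<integral>\<^sup>+t. emeasure R (Pair t -` E) \<partial>T)"
      using R.emeasure_pair_measure_alt[OF E] by (simp add: TR.P.emeasure_eq_measure)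
    also have "\<dots> = (\<integral>\<^sup>+t. ennreal (R.prob (Pair t -` E)) \<partial>T)"
      by (simp add: R.emeasure_eq_measure)
    finally have eq: "ennreal (measure (T \<Otimes>\<^sub>M R) E) = (\<integral>\<^sup>+t. ennreal (R.prob (Pair t -` E)) \<partial>T)" .
    have mm: "(\<lambda>t. R.prob (Pair t -` E)) \<in> borel_measurable T"
      unfolding measure_def using R.measurable_emeasure_Pair[OF E] by measurable
    have "(\<integral>t. R.prob (Pair t -` E) \<partial>T) = enn2real (ennreal (measure (T \<Otimes>\<^sub>M R) E))"
      unfolding eq by (rule integral_eq_nn_integral[OF mm]) simp
    then show ?thesis by simp
  qed
  finally have "(1 - 1 / sqrt (real N)) * (1 - 5 / real N) \<le> measure (T \<Otimes>\<^sub>M R) E" .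
  then show ?thesis
    unfolding place using E by (intro bexI[of _ E]) (auto simp: E_def \<psi>_def)
qed

section \<open>The capacity lower bound\<close>

lemma channel_matrix_eq_wave:
  assumes "0 < L" "r i \<in> square (L, 0) D" "t k \<in> square (0, 0) D"
  shows "channel_matrix G lam t r i k = of_real (sqrt G / L) * wave D L lam (r i) (t k)"
  using assms by (simp add: channel_matrix_def wave_def Let_def)

lemma capacity_rate_ge:
  fixes N :: nat and t r :: "nat \<Rightarrow> real \<times> real"
  assumes D: "0 < D" "2 * D \<le> L" and pos: "0 < lam" "0 < G" "0 < P" "0 < N"
    and cov: "has_covariance N nu S"
    and t: "\<And>i. i < N \<Longrightarrow> t i \<in> square (0, 0) D" and r: "\<And>p. p < N \<Longrightarrow> r p \<in> square (L, 0) D"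
    and gram: "(\<Sum>p<N. \<Sum>q<N. (cmod (\<Sum>i<N. wave D L lam (r p) (t i) * cnj (wave D L lam (r q) (t i))))\<^sup>2)
        \<le> 12048 * real N ^ 4 / min (real N) (spatial_dof D L lam)"
    and \<delta>: "0 \<le> \<delta>" "\<delta> \<le> 1"
  shows "ereal (real N * (\<delta>\<^sup>2 * (rho1 N L G P S + 1 / 16 * real N)\<^sup>2 /
      (sqrt (rho2 N L G P S) + sqrt (578304 * max (real N ^ 2) (real N ^ 3 / spatial_dof D L lam)))\<^sup>2) *
      log 2 (1 + G * P / L\<^sup>2 * ((1 - \<delta>) * (1 / 16) * real N - \<delta> * rho1 N L G P S) / (1 + G * P / L\<^sup>2 * rho1 N L G P S)))
    \<le> capacity N (channel_matrix G lam t r) nu P"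
proof -
  have L: "0 < L" using D by simp
  let ?H = "channel_matrix G lam t r"
  define m where "m = min (real N) (spatial_dof D L lam)"
  have m: "1 \<le> m" "m \<le> N" using pos spatial_dof_ge_1[of D L lam] by (auto simp: m_def)
  have H: "?H i k = of_real (sqrt G / L) * wave D L lam (r i) (t k)" if "i < N" "k < N" for i k
    using L t r that by (intro channel_matrix_eq_wave) auto
  have scale: "(sqrt G / L)\<^sup>2 = G / L\<^sup>2" using pos by (simp add: power_divide)
  have gain: "G / (4 * L\<^sup>2) \<le> (cmod (?H i k))\<^sup>2" if "i < N" "k < N" for i k
  proof -
    have "(1 / 2)\<^sup>2 \<le> (cmod (wave D L lam (r i) (t k)))\<^sup>2"
      using norm_wave_in(1)[OF D] t r that by (intro power_mono) auto
    then have "G / L\<^sup>2 * (1 / 2)\<^sup>2 \<le> G / L\<^sup>2 * (cmod (wave D L lam (r i) (t k)))\<^sup>2"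
      using pos by (intro mult_left_mono) auto
    also have "\<dots> = (cmod (?H i k))\<^sup>2"
      unfolding H[OF that] norm_mult power_mult_distrib norm_of_real power2_abs scale ..
    finally show ?thesis by (simp add: power2_eq_square)
  qed
  have gramH: "(\<Sum>p<N. \<Sum>q<N. (cmod (\<Sum>i<N. ?H p i * cnj (?H q i)))\<^sup>2) \<le> 12048 * (G / L\<^sup>2)\<^sup>2 * real N ^ 4 / m"
  proof -
    let ?w = "\<lambda>p q. \<Sum>i<N. wave D L lam (r p) (t i) * cnj (wave D L lam (r q) (t i))"
    have "(cmod (\<Sum>i<N. ?H p i * cnj (?H q i)))\<^sup>2 = (G / L\<^sup>2)\<^sup>2 * (cmod (?w p q))\<^sup>2" if "p < N" "q < N" for p q
    proof -
      have "(\<Sum>i<N. ?H p i * cnj (?H q i)) = of_real ((sqrt G / L)\<^sup>2) * ?w p q"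
        unfolding sum_distrib_left
      proof (intro sum.cong refl)
        fix i assume "i \<in> {..<N}"
        then have i: "i < N" by simp
        show "?H p i * cnj (?H q i) =
            of_real ((sqrt G / L)\<^sup>2) * (wave D L lam (r p) (t i) * cnj (wave D L lam (r q) (t i)))"
          unfolding H[OF that(1) i] H[OF that(2) i]
          by (simp only: complex_cnj_mult complex_cnj_complex_of_real power2_eq_square of_real_mult mult_ac)
      qed
      then show ?thesis unfolding scale by (simp only: norm_mult norm_of_real power_mult_distrib power2_abs)
    qed
    then have "(\<Sum>p<N. \<Sum>q<N. (cmod (\<Sum>i<N. ?H p i * cnj (?H q i)))\<^sup>2) =
        (G / L\<^sup>2)\<^sup>2 * (\<Sum>p<N. \<Sum>q<N. (cmod (?w p q))\<^sup>2)"
      by (simp add: sum_distrib_left)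
    also have "\<dots> \<le> (G / L\<^sup>2)\<^sup>2 * (12048 * real N ^ 4 / m)"
      using gram unfolding m_def by (rule mult_left_mono) simp
    finally show ?thesis by (simp add: mult_ac)
  qed
  have \<rho>1: "0 \<le> rho1 N L G P S"
    using covariance_trace_nonneg[OF cov] pos by (simp add: rho1_def)
  have s: "0 < G * P / L\<^sup>2" using pos L by simp
  have "real N * (\<delta>\<^sup>2 * (rho1 N L G P S + 1 / 16 * real N)\<^sup>2 /
      (sqrt (rho2 N L G P S) + sqrt (578304 * max (real N ^ 2) (real N ^ 3 / spatial_dof D L lam)))\<^sup>2) *
      log 2 (1 + G * P / L\<^sup>2 * ((1 - \<delta>) * (1 / 16) * real N - \<delta> * rho1 N L G P S) / (1 + G * P / L\<^sup>2 * rho1 N L G P S))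
    \<le> (1 / 16)\<^sup>2 / 578304 * min (real N) (spatial_dof D L lam) *
      log 2 (1 + G * P / L\<^sup>2 * (1 / 16 * real N) / (1 + G * P / L\<^sup>2 * rho1 N L G P S))"
    by (rule rate_bound_le[OF pos(4) s \<rho>1 rho2_nonneg[OF cov] spatial_dof_ge_1 _ _ \<delta>]) auto
  \<comment> \<open>The value 578304 of \<open>K2\<close> is 12288 * 12048 / 16^2, chosen to make
    the two prefactors coincide.\<close>
  also have "(1 / 16)\<^sup>2 / 578304 * min (real N) (spatial_dof D L lam) = m / (12288 * 12048)"
    by (simp add: m_def power2_eq_square)
  finally have le: "real N * (\<delta>\<^sup>2 * (rho1 N L G P S + 1 / 16 * real N)\<^sup>2 /
      (sqrt (rho2 N L G P S) + sqrt (578304 * max (real N ^ 2) (real N ^ 3 / spatial_dof D L lam)))\<^sup>2) *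
      log 2 (1 + G * P / L\<^sup>2 * ((1 - \<delta>) * (1 / 16) * real N - \<delta> * rho1 N L G P S) / (1 + G * P / L\<^sup>2 * rho1 N L G P S))
    \<le> m / (12288 * 12048) * log 2 (1 + G * P / L\<^sup>2 * (1 / 16 * real N) / (1 + G * P / L\<^sup>2 * rho1 N L G P S))" .
  show ?thesis
    by (rule order_trans[OF _ capacity_ge_of_gram[OF cov pos(2) L pos(3,4) _ m gain gramH]]) (use le in auto)
qed

lemma placement_probability_tendsto_1:
  assumes "\<And>N. 0 < N \<Longrightarrow> (1 - 1 / sqrt (real N)) * (1 - 5 / real N) \<le> p N" and "\<And>N. p N \<le> (1 :: real)"
  shows "p \<longlonglongrightarrow> 1"
proof (rule tendsto_sandwich)
  show "eventually (\<lambda>N. (1 - 1 / sqrt (real N)) * (1 - 5 / real N) \<le> p N) sequentially"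
    using assms(1) by (intro eventually_sequentiallyI[of 1]) auto
  show "(\<lambda>N. (1 - 1 / sqrt (real N)) * (1 - 5 / real N)) \<longlonglongrightarrow> 1"
  proof -
    have "(\<lambda>N. 1 / sqrt (real N)) \<longlonglongrightarrow> 0"
      by (intro tendsto_divide_0[OF tendsto_const] filterlim_at_top_imp_at_infinity
          filterlim_compose[OF sqrt_at_top filterlim_real_sequentially])
    moreover have "(\<lambda>N. 5 / real N) \<longlonglongrightarrow> 0"
      by (intro tendsto_divide_0[OF tendsto_const] filterlim_at_top_imp_at_infinity filterlim_real_sequentially)
    ultimately have "(\<lambda>N. (1 - 1 / sqrt (real N)) * (1 - 5 / real N)) \<longlonglongrightarrow> (1 - 0) * (1 - 0)"
      by (intro tendsto_intros)
    then show ?thesis by simp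
  qed
qed (use assms(2) in auto)

text \<open>The favourable event is determined by the geometry and the wavelength. On it the bound
  holds for all \<delta> simultaneously and for any interference law with the given covariance, so
  all parameters may vary with \<open>N\<close> under the same constants.\<close>

theorem theorem5:
  shows "\<exists>K1 > (0 :: real). \<exists>K2 > (0 :: real).
    \<forall>(D :: nat \<Rightarrow> real) (L :: nat \<Rightarrow> real) (lam :: nat \<Rightarrow> real) (G :: nat \<Rightarrow> real) (P :: nat \<Rightarrow> real)
      (nu :: nat \<Rightarrow> (nat \<Rightarrow> complex) measure) (S :: nat \<Rightarrow> nat \<Rightarrow> nat \<Rightarrow> complex).
      (\<forall>N. 0 < D N \<and> 2 * D N \<le> L N \<and> 0 < lam N \<and> 0 < G N \<and> 0 < P N \<and>
           has_covariance N (nu N) (S N)) \<longrightarrow>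
      with_high_probability (\<lambda>N. placement (D N) (L N) N) (\<lambda>N (t, r).
        \<forall>\<delta>\<in>{0..1 :: real}.
          (let snr = G N * P N / (L N)\<^sup>2;
               \<rho>1 = rho1 N (L N) (G N) (P N) (S N);
               \<rho>2 = rho2 N (L N) (G N) (P N) (S N);
               M = spatial_dof (D N) (L N) (lam N)
           in ereal (real N * (\<delta>\<^sup>2 * (\<rho>1 + K1 * real N)\<^sup>2 /
                          (sqrt \<rho>2 + sqrt (K2 * max (real N ^ 2) (real N ^ 3 / M)))\<^sup>2) *
                     log 2 (1 + snr * ((1 - \<delta>) * K1 * real N - \<delta> * \<rho>1) / (1 + snr * \<rho>1)))
              \<le> capacity N (channel_matrix (G N) (lam N) t r) (nu N) (P N)))"
proof (rule exI[of _ "1 / 16"], intro conjI, simp, rule exI[of _ "578304"], intro conjI allI impI)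
  fix D L lam G P :: "nat \<Rightarrow> real" and nu S
  assume asm: "\<forall>N. 0 < D N \<and> 2 * D N \<le> L N \<and> 0 < lam N \<and> 0 < G N \<and> 0 < P N \<and>
    has_covariance N (nu N) (S N)"
  let ?good = "\<lambda>N E. (\<forall>(t, r)\<in>E. (\<forall>i<N. t i \<in> square (0, 0) (D N)) \<and> (\<forall>p<N. r p \<in> square (L N, 0) (D N)) \<and>
      (\<Sum>p<N. \<Sum>q<N. (cmod (\<Sum>i<N. wave (D N) (L N) (lam N) (r p) (t i) * cnj (wave (D N) (L N) (lam N) (r q) (t i))))\<^sup>2)
        \<le> 12048 * real N ^ 4 / min (real N) (spatial_dof (D N) (L N) (lam N))) \<and>
    (1 - 1 / sqrt (real N)) * (1 - 5 / real N) \<le> measure (placement (D N) (L N) N) E"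
  \<comment> \<open>The estimates concern positive \<open>N\<close>; index 0 receives the empty
    event, which does not affect the limit.\<close>
  have "\<forall>N. \<exists>E. E \<in> sets (placement (D N) (L N) N) \<and> (if N = 0 then E = {} else ?good N E)"
  proof
    fix N
    show "\<exists>E. E \<in> sets (placement (D N) (L N) N) \<and> (if N = 0 then E = {} else ?good N E)"
    proof (cases "N = 0")
      case False
      then have "0 < N" by simp
      with placement_gram_event[of "D N" "L N" "lam N" N] asm False show ?thesis
        unfolding Bex_def by simp
    qed auto
  qed
  from choice[OF this] obtain E where EE: "\<forall>N. E N \<in> sets (placement (D N) (L N) N) \<and>
      (if N = 0 then E N = {} else ?good N (E N))" by (rule exE)
  have E: "E N \<in> sets (placement (D N) (L N) N)" for N by (rule conjunct1[OF spec[OF EE]])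
  have E0: "E 0 = {}" using conjunct2[OF spec[OF EE, of 0]] by simp
  have good: "?good N (E N)" if "0 < N" for N
  proof -
    have "N \<noteq> 0" using that by simp
    from conjunct2[OF spec[OF EE, of N], unfolded if_not_P[OF this]] show ?thesis .
  qed
  show "with_high_probability (\<lambda>N. placement (D N) (L N) N) (\<lambda>N (t, r).
      \<forall>\<delta>\<in>{0..1 :: real}.
        (let snr = G N * P N / (L N)\<^sup>2;
             \<rho>1 = rho1 N (L N) (G N) (P N) (S N);
             \<rho>2 = rho2 N (L N) (G N) (P N) (S N);
             M = spatial_dof (D N) (L N) (lam N)
         in ereal (real N * (\<delta>\<^sup>2 * (\<rho>1 + 1 / 16 * real N)\<^sup>2 /
                        (sqrt \<rho>2 + sqrt (578304 * max (real N ^ 2) (real N ^ 3 / M)))\<^sup>2) *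
                   log 2 (1 + snr * ((1 - \<delta>) * (1 / 16) * real N - \<delta> * \<rho>1) / (1 + snr * \<rho>1)))
            \<le> capacity N (channel_matrix (G N) (lam N) t r) (nu N) (P N)))"
    unfolding with_high_probability_def Let_def
  proof (intro exI[of _ E] conjI allI ballI)
    fix N \<omega> assume \<omega>: "\<omega> \<in> E N"
    obtain t r where tr: "\<omega> = (t, r)" by (cases \<omega>)
    have N: "0 < N" using \<omega> E0 by (cases N) auto
    have c: "0 < D N" "2 * D N \<le> L N" "0 < lam N" "0 < G N" "0 < P N" "has_covariance N (nu N) (S N)"
      using asm by auto
    have g: "\<And>i. i < N \<Longrightarrow> t i \<in> square (0, 0) (D N)" "\<And>p. p < N \<Longrightarrow> r p \<in> square (L N, 0) (D N)"
      "(\<Sum>p<N. \<Sum>q<N. (cmod (\<Sum>i<N. wave (D N) (L N) (lam N) (r p) (t i) * cnj (wave (D N) (L N) (lam N) (r q) (t i))))\<^sup>2)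
        \<le> 12048 * real N ^ 4 / min (real N) (spatial_dof (D N) (L N) (lam N))"
      using conjunct1[OF good[OF N]] \<omega> unfolding tr by auto
    show "case \<omega> of (t, r) \<Rightarrow> \<forall>\<delta>\<in>{0..1 :: real}.
      ereal (real N * (\<delta>\<^sup>2 * (rho1 N (L N) (G N) (P N) (S N) + 1 / 16 * real N)\<^sup>2 /
          (sqrt (rho2 N (L N) (G N) (P N) (S N)) + sqrt (578304 * max (real N ^ 2) (real N ^ 3 / spatial_dof (D N) (L N) (lam N))))\<^sup>2) *
        log 2 (1 + G N * P N / (L N)\<^sup>2 * ((1 - \<delta>) * (1 / 16) * real N - \<delta> * rho1 N (L N) (G N) (P N) (S N)) /
          (1 + G N * P N / (L N)\<^sup>2 * rho1 N (L N) (G N) (P N) (S N))))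
      \<le> capacity N (channel_matrix (G N) (lam N) t r) (nu N) (P N)"
      unfolding tr prod.case
    proof
      fix \<delta> :: real assume "\<delta> \<in> {0..1}"
      then have \<delta>: "0 \<le> \<delta>" "\<delta> \<le> 1" by auto
      show "ereal (real N * (\<delta>\<^sup>2 * (rho1 N (L N) (G N) (P N) (S N) + 1 / 16 * real N)\<^sup>2 /
          (sqrt (rho2 N (L N) (G N) (P N) (S N)) + sqrt (578304 * max (real N ^ 2) (real N ^ 3 / spatial_dof (D N) (L N) (lam N))))\<^sup>2) *
        log 2 (1 + G N * P N / (L N)\<^sup>2 * ((1 - \<delta>) * (1 / 16) * real N - \<delta> * rho1 N (L N) (G N) (P N) (S N)) /
          (1 + G N * P N / (L N)\<^sup>2 * rho1 N (L N) (G N) (P N) (S N))))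
      \<le> capacity N (channel_matrix (G N) (lam N) t r) (nu N) (P N)"
        by (rule capacity_rate_ge[OF c(1-5) N c(6) g \<delta>])
    qed
  next
    show "(\<lambda>N. measure (placement (D N) (L N) N) (E N)) \<longlonglongrightarrow> 1"
    proof (rule placement_probability_tendsto_1)
      fix N
      have c: "0 < D N" using asm by simp
      interpret pair_prob_space "PiM {..<N} (\<lambda>_. uniform_square (0, 0) (D N))" "PiM {..<N} (\<lambda>_. uniform_square (L N, 0) (D N))"
        by (intro pair_prob_space.intro pair_sigma_finite.intro prob_space_imp_sigma_finite
            prob_space_PiM prob_space_uniform_square c)
      show "measure (placement (D N) (L N) N) (E N) \<le> 1"
        unfolding placement_def by (rule P.prob_le_1)
    qed (rule conjunct2[OF good])
  qed (use E in auto)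
qed auto

end
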